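(* Let $n\ge 1$ and $0\le i,j,k\le n-1$. For any fixed $z\in S_n$ with $\mathrm{des}(z)=k$, $$[\phi_i\phi_j,\phi_k]=\bigl|\{(x,y)\in S_n\times S_n \mid \mathrm{des}(x)=i,\ \mathrm{des}(y)=j,\ xy=z\}\bigr|.$$
   Context: For $\pi\in S_n$, $\mathrm{des}(\pi)=|\{i\mid 1\le i\le n-1,\ \pi(i)>\pi(i+1)\}|$, $\ell(\pi)$ is the number of cycles of $\pi$ (fixed points included), and $C_i=\{\pi\in S_n\mid \ell(\pi)=i\}$ for $1\le i\le n$; in particular $C_1$ is the set of $n$-cycles. $\mathrm{CF}_\ell(S_n)$ is the complex vector space of all functions $\vartheta:S_n\to\mathbb{C}$ that depend only on $\ell$; for such $\vartheta$, $\vartheta(C_i)$ is the common value of $\vartheta$ on $C_i$. The inner product on $\mathrm{CF}_\ell(S_n)$ is $$[\vartheta,\psi]=\frac{1}{|S_n|}\sum_{i,j=1}^{n}\vartheta(C_i)\,\overline{\psi(C_j)}\;\mathbf{E}\,|\sigma C_i\cap\tau C_j|,$$ where $\sigma,\tau$ are independent and uniformly random elements of $C_1$, $\sigma C_i=\{\sigma x\mid x\in C_i\}$, and $\mathbf{E}$ is expectation. The product $\phi_i\phi_j$ is the pointwise product. For $0\le i\le n-1$, the Foulkes character $\phi_i$ of $S_n$ is the character afforded by the direct sum of the (skew) Specht modules $V_\beta$, one for each border shape $\beta$ (connected skew shape containing no $2\times 2$ square) with $n$ boxes and $i+1$ rows. Equivalently, $\phi_i(\pi)=\sum_{j=0}^{n-1}(-1)^{i-j}\binom{n+1}{i-j}(j+1)^{\ell(\pi)}$,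 with $\binom{a}{b}=0$ for $b<0$. *)

theory Defs
  imports
    "HOL-Probability.Probability"
    "HOL-Combinatorics.Combinatorics"
    "HOL-Library.Function_Algebras"
begin

section \<open>Permutations, descents and cycles\<close>

text \<open>The product \<open>xy\<close> in \<open>S\<^sub>n\<close> is the composition \<open>x \<circ> y\<close>.\<close>

definition perm_set :: "nat \<Rightarrow> (nat \<Rightarrow> nat) set" where
  "perm_set n = {\<pi>. \<pi> permutes {1..n}}"

definition des :: "nat \<Rightarrow> (nat \<Rightarrow> nat) \<Rightarrow> nat" where
  "des n \<pi> = card {i. 1 \<le> i \<and> i \<le> n - 1 \<and> \<pi> i > \<pi> (i + 1)}"

definition cycle_count :: "nat \<Rightarrow> (nat \<Rightarrow> nat) \<Rightarrow> nat" where
  "cycle_count n \<pi> = card (orbit \<pi> ` {1..n})"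

definition cyc_class :: "nat \<Rightarrow> nat \<Rightarrow> (nat \<Rightarrow> nat) set" where
  "cyc_class n i = {\<pi> \<in> perm_set n. cycle_count n \<pi> = i}"


section \<open>The inner product on functions that depend only on the number of cycles\<close>

definition class_value :: "nat \<Rightarrow> ((nat \<Rightarrow> nat) \<Rightarrow> complex) \<Rightarrow> nat \<Rightarrow> complex" where
  "class_value n \<theta> i = (THE c. \<forall>\<pi>\<in>cyc_class n i. \<theta> \<pi> = c)"

definition expected_overlap :: "nat \<Rightarrow> nat \<Rightarrow> nat \<Rightarrow> real" where
  "expected_overlap n i j =
     measure_pmf.expectation (pair_pmf (pmf_of_set (cyc_class n 1)) (pmf_of_set (cyc_class n 1)))
       (\<lambda>(\<sigma>, \<tau>). real (card ((\<lambda>x. \<sigma> \<circ> x) ` cyc_class n i \<inter> (\<lambda>x. \<tau> \<circ> x) ` cyc_class n j)))"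

definition cf_inner ::
  "nat \<Rightarrow> ((nat \<Rightarrow> nat) \<Rightarrow> complex) \<Rightarrow> ((nat \<Rightarrow> nat) \<Rightarrow> complex) \<Rightarrow> complex" where
  "cf_inner n \<theta> \<psi> =
     (1 / of_nat (card (perm_set n))) *
     (\<Sum>i=1..n. \<Sum>j=1..n. class_value n \<theta> i * cnj (class_value n \<psi> j) *
        of_real (expected_overlap n i j))"


section \<open>Border shapes\<close>

text \<open>
  A box is a pair (row, column), with rows numbered downwards. A partition is the weakly
  decreasing sequence of its parts, padded by zeros.
\<close>

definition partition_seq :: "(nat \<Rightarrow> nat) \<Rightarrow> bool" where
  "partition_seq p \<longleftrightarrow> antimono p \<and> finite {r. p r \<noteq> 0}"

definition skew_shape :: "(nat \<times> nat) set \<Rightarrow> bool" where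
  "skew_shape \<beta> \<longleftrightarrow>
     (\<exists>lam mu. partition_seq lam \<and> partition_seq mu \<and> mu \<le> lam \<and>
        \<beta> = {(r, c). mu r \<le> c \<and> c < lam r})"

text \<open>Boxes are adjacent if they share an edge.\<close>

definition adjacent :: "nat \<times> nat \<Rightarrow> nat \<times> nat \<Rightarrow> bool" where
  "adjacent a b \<longleftrightarrow>
     fst a = fst b \<and> (snd a = Suc (snd b) \<or> snd b = Suc (snd a)) \<or>
     snd a = snd b \<and> (fst a = Suc (fst b) \<or> fst b = Suc (fst a))"

definition connected_boxes :: "(nat \<times> nat) set \<Rightarrow> bool" where
  "connected_boxes \<beta> \<longleftrightarrow>
     (\<forall>a\<in>\<beta>. \<forall>b\<in>\<beta>. (a, b) \<in> {(x, y). x \<in> \<beta> \<and> y \<in> \<beta> \<and> adjacent x y}\<^sup>*)"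

text \<open>
  Shapes are understood up to translation; the representative is the one that meets both row 0 and
  column 0.
\<close>

definition border_shapes :: "nat \<Rightarrow> nat \<Rightarrow> (nat \<times> nat) set set" where
  "border_shapes n m =
     {\<beta>. skew_shape \<beta> \<and> connected_boxes \<beta> \<and>
        (\<nexists>r c. {(r, c), (r, Suc c), (Suc r, c), (Suc r, Suc c)} \<subseteq> \<beta>) \<and>
        (\<exists>c. (0, c) \<in> \<beta>) \<and> (\<exists>r. (r, 0) \<in> \<beta>) \<and>
        card \<beta> = n \<and> card (fst ` \<beta>) = m}"


section \<open>Skew Specht modules\<close>

definition tableaux :: "nat \<Rightarrow> (nat \<times> nat) set \<Rightarrow> (nat \<times> nat \<Rightarrow> nat) set" where
  "tableaux n \<beta> = {t. bij_betw t \<beta> {1..n}}"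

text \<open>
  The tabloid of \<open>t\<close>, i.e. its class under permuting the entries within each row, is encoded by
  the function that sends each entry to the row containing it.
\<close>

type_synonym tabloid = "nat \<Rightarrow> nat"

definition tabloid :: "(nat \<times> nat) set \<Rightarrow> (nat \<times> nat \<Rightarrow> nat) \<Rightarrow> tabloid" where
  "tabloid \<beta> t = restrict (\<lambda>x. fst (inv_into \<beta> t x)) (t ` \<beta>)"

definition col_stabilizer ::
  "nat \<Rightarrow> (nat \<times> nat) set \<Rightarrow> (nat \<times> nat \<Rightarrow> nat) \<Rightarrow> (nat \<Rightarrow> nat) set" where
  "col_stabilizer n \<beta> t =
     {\<pi> \<in> perm_set n. \<forall>x\<in>{1..n}. snd (inv_into \<beta> t (\<pi> x)) = snd (inv_into \<beta> t x)}"

text \<open>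
  Formal complex combinations of tabloids are their coefficient functions. A permutation \<open>\<pi>\<close> acts
  on tableaux by \<open>t \<mapsto> \<pi> \<circ> t\<close>, hence on encoded tabloids by \<open>T \<mapsto> T \<circ> inv \<pi>\<close>, and on coefficient
  functions as in \<open>perm_act\<close>.
\<close>

definition perm_act :: "(nat \<Rightarrow> nat) \<Rightarrow> (tabloid \<Rightarrow> complex) \<Rightarrow> (tabloid \<Rightarrow> complex)" where
  "perm_act \<pi> f = (\<lambda>T. f (T \<circ> \<pi>))"

definition polytabloid ::
  "nat \<Rightarrow> (nat \<times> nat) set \<Rightarrow> (nat \<times> nat \<Rightarrow> nat) \<Rightarrow> (tabloid \<Rightarrow> complex)" where
  "polytabloid n \<beta> t =
     (\<lambda>T. \<Sum>\<pi>\<in>col_stabilizer n \<beta> t. of_int (sign \<pi>) * (if T = tabloid \<beta> (\<pi> \<circ> t) then 1 else 0))"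

definition fscale :: "complex \<Rightarrow> ('a \<Rightarrow> complex) \<Rightarrow> ('a \<Rightarrow> complex)" where
  "fscale a f = (\<lambda>x. a * f x)"

global_interpretation cfun: vector_space fscale
  by unfold_locales (auto simp: fscale_def fun_eq_iff algebra_simps)

definition specht :: "nat \<Rightarrow> (nat \<times> nat) set \<Rightarrow> (tabloid \<Rightarrow> complex) set" where
  "specht n \<beta> = cfun.span (polytabloid n \<beta> ` tableaux n \<beta>)"

text \<open>
  The trace of an operator \<open>A\<close> on a finite-dimensional \<open>A\<close>-invariant subspace \<open>V\<close>: the sum of the
  diagonal matrix entries with respect to a basis of \<open>V\<close>, which does not depend on the basis.
\<close>

definition trace_on ::
  "('a \<Rightarrow> complex) set \<Rightarrow> (('a \<Rightarrow> complex) \<Rightarrow> ('a \<Rightarrow> complex)) \<Rightarrow> complex" where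
  "trace_on V A =
     (let B = (SOME B. cfun.independent B \<and> cfun.span B = V)
      in \<Sum>b\<in>B. cfun.representation B (A b) b)"

definition specht_char :: "nat \<Rightarrow> (nat \<times> nat) set \<Rightarrow> (nat \<Rightarrow> nat) \<Rightarrow> complex" where
  "specht_char n \<beta> \<pi> = trace_on (specht n \<beta>) (perm_act \<pi>)"


section \<open>Foulkes characters\<close>

text \<open>The character of a direct sum is the sum of the characters of the summands.\<close>

definition foulkes :: "nat \<Rightarrow> nat \<Rightarrow> (nat \<Rightarrow> nat) \<Rightarrow> complex" where
  "foulkes n i \<pi> = (\<Sum>\<beta>\<in>border_shapes n (i + 1). specht_char n \<beta> \<pi>)"

end

theory Submission
  imports Defs
begin

text \<open>
  Write \<open>r\<^sup>\<ell>\<close> for the function \<open>\<pi> \<mapsto> r ^ cycle_count n \<pi>\<close> and \<open>eul n i r\<close> for the binomial coefficient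
  \<open>(r + n - 1 - i) choose n\<close>. The proof rests on three facts.

  First, \<open>r\<^sup>\<ell> = (\<Sum>i<n. eul n i r \<cdot> \<phi>\<^sub>i)\<close>. The functions on tabloids with a fixed sequence of row lengths
  are the direct sum of the Specht modules of the border shapes obtained by gluing consecutive rows;
  taking traces and summing over all row lengths counts the words with \<open>r\<close> letters fixed by \<open>\<pi>\<close>.

  Second, the elements \<open>(\<Sum>x. eul n (des x) r \<cdot> x)\<close> of the group algebra multiply like the numbers \<open>r\<close>,
  by stable sorting of words; the functions \<open>r\<^sup>\<ell>\<close> obviously do so as well. Since the matrix \<open>eul n i r\<close>
  is invertible, the \<open>\<phi>\<^sub>i\<close> have the same structure constants as the descent classes.

  Third, the \<open>\<phi>\<^sub>i\<close> are orthonormal: the average of \<open>r\<^sup>\<ell>\<close> over \<open>\<sigma>\<^sup>-\<^sup>1 g\<close>, with \<open>\<sigma>\<close> a uniform \<open>n\<close>-cycle, has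
  the generating function \<open>X \<cdot> (\<Prod>A. 1 - X ^ card A) / (1 - X) ^ (n + 2)\<close> in \<open>r\<close>, the product running over
  the cycles \<open>A\<close> of \<open>g\<close>, and the sum over \<open>g\<close> of products of two such functions is elementary.
\<close>

hide_const (open) Finite_Cartesian_Product.transpose

section \<open>Cycles and transpositions\<close>

text \<open>A permutation \<open>g\<close> lies in both \<open>\<sigma> C_i\<close> and
  \<open>\<tau> C_j\<close> iff \<open>inv \<sigma> \<circ> g\<close> and
  \<open>inv \<tau> \<circ> g\<close> have \<open>i\<close> and \<open>j\<close> cycles. The pairing
  is therefore a sum over \<open>g\<close> of products of two averages over n-cycles. These averages
  are computed by letting n grow: inserting n + 1 into the cycle notation of \<sigma> and of
  \<open>g\<close> multiplies by transpositions, which cut or join cycles, and a new fixed point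
  costs a factor r, which is X d/dX on generating functions.

  The obstacle is that the Foulkes characters are traces on spans of polytabloids of many shapes.
  All these spaces are pulled back to functions on words, that is, on S_n. A word, cut at its
  ascents, is a standard filling of exactly one border shape, so there are n! standard polytabloids
  in a space of dimension n!. Column antisymmetrizers and a positive definite pairing separate the
  shapes, an energy on tabloids separates the polytabloids of one shape; the dimension count then
  gives standard bases and the direct sum at once, without straightening.\<close>

definition cycles :: "'a set \<Rightarrow> ('a \<Rightarrow> 'a) \<Rightarrow> 'a set set" where
  "cycles S p = orbit p ` S"

lemma cycle_count_eq: "cycle_count n p = card (cycles {1..n} p)"
  by (simp add: cycle_count_def cycles_def)

context
  fixes p :: "'a \<Rightarrow> 'a" and S :: "'a set"
  assumes p: "p permutes S" and fin: "finite S"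
begin

lemma permutation_p: "permutation p"
  using p fin by (auto simp: permutation_permutes)

lemma self_in_orbit: "x \<in> orbit p x"
  by (rule permutation_self_in_orbit[OF permutation_p])

lemma orbit_eq_iff: "orbit p x = orbit p y \<longleftrightarrow> x \<in> orbit p y"
  using self_in_orbit cyclic_on_orbit'[OF permutation_p] orbit_cyclic_eq3 by metis

lemma orbit_disjoint: "orbit p x \<noteq> orbit p y \<Longrightarrow> orbit p x \<inter> orbit p y = {}"
  using orbit_eq_iff by blast

lemma orbit_closed: "p y \<in> orbit p x \<longleftrightarrow> y \<in> orbit p x"
  using orbit_eq_iff permutation_orbit_step[OF permutation_p] by metis

lemma finite_orbit_p: "finite (orbit p x)"
  by (rule finite_orbit[OF self_in_orbit])

lemma finite_cycles: "finite (cycles S p)"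
  by (simp add: cycles_def fin)

lemma Union_cycles: "\<Union>(cycles S p) = S"
  using self_in_orbit permutes_orbit_subset[OF p] by (auto simp: cycles_def)

lemma cycles_disjoint: "A \<in> cycles S p \<Longrightarrow> B \<in> cycles S p \<Longrightarrow> A \<noteq> B \<Longrightarrow> A \<inter> B = {}"
  using orbit_disjoint by (auto simp: cycles_def)

lemma in_cycle_eq: "A \<in> cycles S p \<Longrightarrow> x \<in> A \<Longrightarrow> A = orbit p x"
  using orbit_eq_iff by (auto simp: cycles_def)

text \<open>The new map sends \<open>a\<close> to \<open>p b\<close> and \<open>b\<close> to
  \<open>p a\<close>, so a walk from \<open>a\<close> runs through the whole cycle of
  \<open>b\<close> before it continues in that of \<open>a\<close>. Points outside both cycles never
  meet the change.\<close>

lemma orbit_merge: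
  assumes "b \<notin> orbit p a"
  shows "orbit (p \<circ> transpose a b) a = orbit p a \<union> orbit p b"
    and "orbit (p \<circ> transpose a b) b = orbit p a \<union> orbit p b"
    and "x \<notin> orbit p a \<Longrightarrow> x \<notin> orbit p b \<Longrightarrow> orbit (p \<circ> transpose a b) x = orbit p x"
proof -
  let ?h = "p \<circ> transpose a b"
  have ab: "a \<noteq> b" using assms self_in_orbit by auto
  have a_nb: "a \<notin> orbit p b" using assms orbit_eq_iff self_in_orbit by metis
  have h: "?h a = p b" "?h b = p a" "\<And>x. x \<noteq> a \<Longrightarrow> x \<noteq> b \<Longrightarrow> ?h x = p x"
    by (auto simp: Transposition.transpose_def)
  have sub: "x \<in> orbit p a \<union> orbit p b" if "x \<in> orbit ?h a" for x
    using that
  proof induction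
    case base then show ?case by (auto simp: orbit.base)
  next
    case (step y)
    then show ?case using h self_in_orbit orbit_closed
      by (cases "y = a"; cases "y = b") (auto simp: orbit.base)
  qed
  have supb: "x \<in> orbit ?h a" if "x \<in> orbit p b" for x
    using that
  proof induction
    case base then show ?case using orbit.base[of ?h a] unfolding h(1) .
  next
    case (step y)
    then have "y \<noteq> a" using a_nb by auto
    then show ?case using step orbit.base[of ?h a] orbit.step[of y ?h a] h(1) h(3)[of y] by (cases "y = b") metis+
  qed
  have supa: "x \<in> orbit ?h a" if "x \<in> orbit p a" for x
    using that
  proof induction
    case base then show ?case using orbit.step[OF supb[OF self_in_orbit]] unfolding h(2) .
  next
    case (step y)
    then have "y \<noteq> b" using assms by auto
    then show ?case using step orbit.step[OF supb[OF self_in_orbit]] orbit.step[of y ?h a] h(2) h(3)[of y]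
      by (cases "y = a") metis+
  qed
  show 1: "orbit ?h a = orbit p a \<union> orbit p b"
    using sub supa supb by blast
  have "permutation ?h" by (rule permutation_compose[OF permutation_p permutation_swap_id])
  then have "orbit ?h b = orbit ?h a"
    using cyclic_on_orbit' orbit_cyclic_eq3 1 self_in_orbit by (metis UnI2)
  then show "orbit ?h b = orbit p a \<union> orbit p b" using 1 by simp
  show "orbit ?h x = orbit p x" if "x \<notin> orbit p a" "x \<notin> orbit p b"
  proof (rule orbit_cong[OF self_in_orbit])
    fix s assume "s \<in> orbit p x"
    then have "s \<noteq> a" "s \<noteq> b" using that orbit_eq_iff self_in_orbit by metis+
    then show "?h s = p s" using h by simp
  qed
qed

lemma cycles_merge:
  assumes "a \<in> S" "b \<in> S" "b \<notin> orbit p a"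
  shows "cycles S (p \<circ> transpose a b) =
    insert (orbit p a \<union> orbit p b) (cycles S p - {orbit p a, orbit p b})" (is "?L = ?R")
proof
  note m = orbit_merge[OF assms(3)]
  show "?L \<subseteq> ?R"
  proof
    fix A assume "A \<in> ?L"
    then obtain x where x: "x \<in> S" "A = orbit (p \<circ> transpose a b) x" by (auto simp: cycles_def)
    show "A \<in> ?R"
    proof (cases "x \<in> orbit p a \<union> orbit p b")
      case True
      have "permutation (p \<circ> transpose a b)"
        by (rule permutation_compose[OF permutation_p permutation_swap_id])
      then have "A = orbit (p \<circ> transpose a b) a"
        using orbit_cyclic_eq3[OF cyclic_on_orbit', of "p \<circ> transpose a b" x a] True m(1) x(2)
        by simp
      then show ?thesis using m by simp
    next
      case False
      then show ?thesis using m(3) x orbit_eq_iff by (auto simp: cycles_def)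
    qed
  qed
  show "?R \<subseteq> ?L"
  proof
    fix A assume "A \<in> ?R"
    then consider "A = orbit p a \<union> orbit p b"
      | x where "x \<in> S" "A = orbit p x" "A \<noteq> orbit p a" "A \<noteq> orbit p b"
      by (auto simp: cycles_def)
    then show "A \<in> ?L"
    proof cases
      case 1 then show ?thesis using m(1) assms by (auto simp: cycles_def)
    next
      case 2 then show ?thesis using m(3)[of x] orbit_eq_iff by (auto simp: cycles_def)
    qed
  qed
qed

lemma orbit_funpow:
  assumes "a \<in> S"
  shows "orbit p a = (\<lambda>i. (p ^^ i) a) ` {0..<card (orbit p a)}"
    and "inj_on (\<lambda>i. (p ^^ i) a) {0..<card (orbit p a)}"
    and "(p ^^ card (orbit p a)) a = a"
proof -
  let ?c = "funpow_dist1 p a a"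
  have "card (orbit p a) = ?c"
    using orbit_conv_funpow_dist1[OF self_in_orbit] inj_on_funpow_dist1[OF self_in_orbit]
      card_image by (metis card_atLeastLessThan diff_zero)
  then show "orbit p a = (\<lambda>i. (p ^^ i) a) ` {0..<card (orbit p a)}"
    and "inj_on (\<lambda>i. (p ^^ i) a) {0..<card (orbit p a)}"
    and "(p ^^ card (orbit p a)) a = a"
    using orbit_conv_funpow_dist1[OF self_in_orbit] inj_on_funpow_dist1[OF self_in_orbit]
      funpow_dist1_prop[OF self_in_orbit] by metis+
qed

end

text \<open>The chord from \<open>b\<close> back to \<open>p a\<close> cuts off the points from
  \<open>p a\<close> to \<open>(p ^^ m) a\<close>, a cycle of length \<open>m\<close>. The rest
  comes from \<open>orbit_merge\<close> applied to \<open>h\<close>, since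
  \<open>p = h \<circ> transpose a b\<close>.\<close>

lemma cycles_split:
  assumes p: "p permutes S" "finite S" and a: "a \<in> S" and m: "0 < m" "m < card (orbit p a)"
    and b: "b = (p ^^ m) a"
  defines "h \<equiv> p \<circ> transpose a b"
  shows "cycles S h = insert (orbit h a) (insert (orbit h b) (cycles S p - {orbit p a}))"
    and "orbit h a \<inter> orbit h b = {}" "orbit h a \<union> orbit h b = orbit p a"
    and "card (orbit h b) = m" "card (orbit h a) = card (orbit p a) - m"
proof -
  note of = orbit_funpow[OF p a]
  have bS: "b \<in> S" using b a p by (simp add: permutes_in_image permutes_in_funpow_image)
  have h: "h permutes S" unfolding h_def using p a bS by (intro permutes_compose permutes_swap_id)
  have ne: "(p ^^ i) a \<noteq> (p ^^ j) a" if "i < j" "j < card (orbit p a)" for i j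
    using inj_onD[OF of(2), of i j] that by auto
  have hb: "h b = p a" by (simp add: h_def)
  have hi: "h ((p ^^ i) a) = (p ^^ Suc i) a" if "0 < i" "i < m" for i
    using ne[of 0 i] ne[of i m] that m b by (simp add: h_def Transposition.transpose_def)
  have orb: "orbit h b = (\<lambda>i. (p ^^ i) a) ` {1..m}"
  proof
    show "orbit h b \<subseteq> (\<lambda>i. (p ^^ i) a) ` {1..m}"
    proof
      fix x assume "x \<in> orbit h b"
      then show "x \<in> (\<lambda>i. (p ^^ i) a) ` {1..m}"
      proof induction
        case base
        then show ?case using hb m by (intro image_eqI[of _ _ 1]) auto
      next
        case (step y)
        then obtain i where i: "y = (p ^^ i) a" "1 \<le> i" "i \<le> m" by auto
        show ?case
        proof (cases "i = m")
          case True
          then show ?thesis using i hb b m by (intro image_eqI[of _ _ 1]) auto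
        next
          case False
          then show ?thesis using i hi[of i] by (intro image_eqI[of _ _ "Suc i"]) auto
        qed
      qed
    qed
    have "(p ^^ i) a \<in> orbit h b" if "1 \<le> i" "i \<le> m" for i
      using that
    proof (induction i rule: dec_induct)
      case base
      then show ?case using orbit.base[of h b] hb by simp
    next
      case (step i)
      then show ?case using orbit.step[of "(p ^^ i) a" h b] hi[of i] by simp
    qed
    then show "(\<lambda>i. (p ^^ i) a) ` {1..m} \<subseteq> orbit h b" by auto
  qed
  have "inj_on (\<lambda>i. (p ^^ i) a) {1..m}"
    by (rule inj_on_subset[OF of(2)]) (use m in auto)
  then show c: "card (orbit h b) = m" using orb by (simp add: card_image)
  have a_n: "a \<notin> orbit h b" using ne[of 0] m unfolding orb by fastforce
  have b_n: "b \<notin> orbit h a" using a_n orbit_eq_iff[OF h p(2)] self_in_orbit[OF h p(2)] by metis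
  have ph: "p = h \<circ> transpose a b" by (simp add: h_def comp_assoc)
  note mm = orbit_merge[OF h p(2) b_n, folded ph]
  show d: "orbit h a \<inter> orbit h b = {}"
    using orbit_disjoint[OF h p(2)] a_n self_in_orbit[OF h p(2)] by metis
  show u: "orbit h a \<union> orbit h b = orbit p a" using mm(1) by simp
  show "card (orbit h a) = card (orbit p a) - m"
    using c card_Un_disjoint[OF finite_orbit_p[OF h p(2)] finite_orbit_p[OF h p(2)] d] u by simp
  have "orbit p a \<notin> cycles S h - {orbit h a, orbit h b}"
  proof
    assume "orbit p a \<in> cycles S h - {orbit h a, orbit h b}"
    then show False
      using in_cycle_eq[OF h p(2), of "orbit p a" a] self_in_orbit[OF p, of a] by auto
  qed
  then have "cycles S p - {orbit p a} = cycles S h - {orbit h a, orbit h b}"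
    using cycles_merge[OF h p(2) a bS b_n, folded ph] u by auto
  moreover have "orbit h a \<in> cycles S h" "orbit h b \<in> cycles S h" using a bS by (auto simp: cycles_def)
  ultimately show "cycles S h = insert (orbit h a) (insert (orbit h b) (cycles S p - {orbit p a}))"
    by auto
qed

section \<open>The product of 1 - x^|A| over the cycles A, and its change under
  transpositions\<close>

definition cycle_prod :: "'b::comm_ring_1 \<Rightarrow> 'a set \<Rightarrow> ('a \<Rightarrow> 'a) \<Rightarrow> 'b" where
  "cycle_prod x S p = (\<Prod>A\<in>cycles S p. 1 - x ^ card A)"

text \<open>Leaves out the cycle of the marked point \<open>a\<close>, the one that
  \<open>transpose a j\<close> cuts or enlarges.\<close>

definition other_prod :: "'b::comm_ring_1 \<Rightarrow> 'a set \<Rightarrow> ('a \<Rightarrow> 'a) \<Rightarrow> 'a \<Rightarrow> 'b" where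
  "other_prod x S p a = (\<Prod>A\<in>cycles S p - {orbit p a}. 1 - x ^ card A)"

lemma cycle_prod_eq_other:
  assumes "p permutes S" "finite S" "a \<in> S"
  shows "cycle_prod x S p = (1 - x ^ card (orbit p a)) * other_prod x S p a"
  unfolding cycle_prod_def other_prod_def
  by (rule prod.remove) (use assms in \<open>auto simp: finite_cycles cycles_def\<close>)

lemma fps_deriv_prod:
  assumes "finite A"
  shows "fps_deriv (\<Prod>x\<in>A. f x) = (\<Sum>x\<in>A. fps_deriv (f x) * (\<Prod>y\<in>A - {x}. f y :: 'b::comm_ring_1 fps))"
  using assms
proof (induction A)
  case (insert a A)
  have "(\<Prod>y\<in>insert a A - {x}. f y) = f a * (\<Prod>y\<in>A - {x}. f y)" if "x \<in> A" for x
    using that insert by (subst insert_Diff_if) (auto simp: prod.insert_if)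
  then have "(\<Sum>x\<in>A. fps_deriv (f x) * (\<Prod>y\<in>insert a A - {x}. f y)) =
     f a * (\<Sum>x\<in>A. fps_deriv (f x) * (\<Prod>y\<in>A - {x}. f y))"
    by (auto simp: sum_distrib_left algebra_simps intro!: sum.cong)
  moreover have "insert a A - {a} = A" using insert by auto
  ultimately show ?case using insert by (simp add: algebra_simps)
qed simp

lemma X_deriv_one_minus_X_power:
  "fps_X * fps_deriv (1 - fps_X ^ k) = - of_nat k * (fps_X ^ k :: 'b::comm_ring_1 fps)"
proof -
  have "fps_X * fps_deriv (fps_X ^ k) = of_nat k * (fps_X ^ k :: 'b fps)"
    by (induction k) (simp_all add: algebra_simps)
  then show ?thesis by simp
qed

text \<open>With \<open>j = (p ^^ m) a\<close> the cycle of \<open>a\<close>, of length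
  \<open>c\<close>, splits into lengths \<open>m\<close> and \<open>c - m\<close>, and each
  \<open>m\<close> from \<open>1\<close> to \<open>c - 1\<close> occurs once.\<close>

lemma sum_cycle_prod_transpose_same:
  assumes p: "p permutes S" "finite S" and a: "a \<in> S"
  shows "(\<Sum>j\<in>orbit p a - {a}. cycle_prod x S (p \<circ> transpose a j)) =
     (\<Sum>m=1..<card (orbit p a). (1 - x ^ m) * (1 - x ^ (card (orbit p a) - m))) * other_prod x S p a"
proof -
  let ?c = "card (orbit p a)"
  note of = orbit_funpow[OF p a]
  have cpos: "?c > 0"
    using finite_orbit_p[OF p] orbit_nonempty[of p a] by (simp add: card_gt_0_iff)
  have "bij_betw (\<lambda>i. (p ^^ i) a) {1..<?c} (orbit p a - {a})"
  proof -
    have d: "{1..<?c} = {0..<?c} - {0}" by auto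
    have "(\<lambda>i. (p ^^ i) a) ` ({0..<?c} - {0}) = orbit p a - {(p ^^ 0) a}"
      unfolding of(1)[symmetric] using inj_on_image_set_diff[OF of(2), of "{0..<?c}" "{0}"] cpos of(1) by simp
    then show ?thesis unfolding d bij_betw_def using inj_on_subset[OF of(2)] by auto
  qed
  then have "(\<Sum>j\<in>orbit p a - {a}. cycle_prod x S (p \<circ> transpose a j)) =
     (\<Sum>m=1..<?c. cycle_prod x S (p \<circ> transpose a ((p ^^ m) a)))"
    by (rule sum.reindex_bij_betw[symmetric])
  also have "\<dots> = (\<Sum>m=1..<?c. (1 - x ^ m) * (1 - x ^ (?c - m)) * other_prod x S p a)"
  proof (rule sum.cong[OF refl])
    fix m assume "m \<in> {1..<?c}"
    then have m: "0 < m" "m < ?c" by auto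
    define b where "b = (p ^^ m) a"
    define h where "h = p \<circ> transpose a b"
    note sp = cycles_split[OF p a m b_def, folded h_def]
    have bS: "b \<in> S" using b_def a p by (simp add: permutes_in_funpow_image)
    have h: "h permutes S" unfolding h_def using p a bS by (intro permutes_compose permutes_swap_id)
    have ne: "orbit h a \<noteq> orbit h b" using sp(2) orbit_nonempty[of h a] by auto
    have nin: "A \<notin> cycles S p - {orbit p a}" if AB: "A = orbit h a \<or> A = orbit h b" for A
    proof
      assume A: "A \<in> cycles S p - {orbit p a}"
      obtain x where x: "x \<in> A" using AB orbit_nonempty[of h] by blast
      then have "x \<in> orbit p a" using sp(3) AB by auto
      then show False using in_cycle_eq[OF p, of A x] A x orbit_eq_iff[OF p] by auto
    qed
    have fc: "finite (cycles S p - {orbit p a})" using finite_cycles[OF p] by simp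
    have "cycle_prod x S h = (1 - x ^ card (orbit h a)) * ((1 - x ^ card (orbit h b)) * other_prod x S p a)"
      unfolding cycle_prod_def sp(1) other_prod_def using ne nin fc by (subst prod.insert; auto)+
    then show "cycle_prod x S (p \<circ> transpose a ((p ^^ m) a)) =
       (1 - x ^ m) * (1 - x ^ (?c - m)) * other_prod x S p a"
      using sp(4,5) by (simp add: h_def b_def algebra_simps)
  qed
  finally show ?thesis by (simp add: sum_distrib_right)
qed

text \<open>There are \<open>k = card A\<close> ways to join another cycle \<open>A\<close>, and
  \<open>1 - X^(c + k) = (1 - X^k) + X^k (1 - X^c)\<close>. The first summands give copies of
  \<open>R\<close>; the second, weighted by \<open>k\<close>, assemble
  \<open>fps_X * fps_deriv R\<close> up to sign.\<close>

lemma sum_cycle_prod_transpose_other: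
  fixes p :: "'a \<Rightarrow> 'a"
  assumes p: "p permutes S" "finite S" and a: "a \<in> S"
  defines "c \<equiv> card (orbit p a)" and "R \<equiv> other_prod fps_X S p a :: 'b::comm_ring_1 fps"
  shows "(\<Sum>j\<in>S - orbit p a. cycle_prod fps_X S (p \<circ> transpose a j)) =
     of_nat (card S - c) * R - (1 - fps_X ^ c) * (fps_X * fps_deriv R)"
proof -
  let ?C = "cycles S p - {orbit p a}"
  let ?f = "\<lambda>A. 1 - fps_X ^ card A :: 'b fps"
  have fC: "finite ?C" using finite_cycles[OF p] by simp
  have oa: "orbit p a \<in> cycles S p" using a by (auto simp: cycles_def)
  have U: "S - orbit p a = \<Union>?C"
  proof -
    have "x \<notin> orbit p a" if "x \<in> A" "A \<in> ?C" for x A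
      using in_cycle_eq[OF p, of A x] that orbit_eq_iff[OF p] by auto
    then show ?thesis using Union_cycles[OF p] by auto
  qed
  have fA: "finite A" if "A \<in> cycles S p" for A using that finite_orbit_p[OF p] by (auto simp: cycles_def)
  have dj: "A \<inter> B = {}" if "A \<in> ?C" "B \<in> ?C" "A \<noteq> B" for A B
    using that cycles_disjoint[OF p] by auto
  have cardS: "card S - c = (\<Sum>A\<in>?C. card A)"
  proof -
    have "card S - c = card (S - orbit p a)" unfolding c_def
      using card_Diff_subset[OF finite_orbit_p[OF p] permutes_orbit_subset[OF p(1) a]] by simp
    also have "\<dots> = (\<Sum>A\<in>?C. card A)" unfolding U
      by (rule card_Union_disjoint) (use fA dj in \<open>auto simp: pairwise_def disjnt_def\<close>)
    finally show ?thesis .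
  qed
  have prod_A: "cycle_prod fps_X S (p \<circ> transpose a j) =
     (1 - fps_X ^ (c + card A)) * (\<Prod>B\<in>?C - {A}. ?f B)" if A: "A \<in> ?C" "j \<in> A" for A j
  proof -
    have Aj: "A = orbit p j" using A in_cycle_eq[OF p] by auto
    have jS: "j \<in> S" using A Union_cycles[OF p] by auto
    have jn: "j \<notin> orbit p a" using A Aj orbit_eq_iff[OF p] by auto
    have cy: "cycles S (p \<circ> transpose a j) = insert (orbit p a \<union> A) (?C - {A})"
      using cycles_merge[OF p a jS jn] Aj by auto
    have "orbit p a \<union> A \<notin> ?C - {A}"
    proof
      assume "orbit p a \<union> A \<in> ?C - {A}"
      then show False using in_cycle_eq[OF p, of "orbit p a \<union> A" j] Aj A by auto
    qed
    moreover have "card (orbit p a \<union> A) = c + card A"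
      using A oa fA cycles_disjoint[OF p] unfolding c_def by (subst card_Un_disjoint) auto
    ultimately show ?thesis unfolding cycle_prod_def cy using fC by (subst prod.insert) auto
  qed
  have R_A: "R = ?f A * (\<Prod>B\<in>?C - {A}. ?f B)" if "A \<in> ?C" for A
    unfolding R_def other_prod_def using that fC by (rule prod.remove[rotated])
  have XR: "fps_X * fps_deriv R = - (\<Sum>A\<in>?C. of_nat (card A) * fps_X ^ card A * (\<Prod>B\<in>?C - {A}. ?f B))"
    unfolding R_def other_prod_def fps_deriv_prod[OF fC] sum_distrib_left sum_negf[symmetric]
    by (rule sum.cong[OF refl]) (simp only: mult.assoc[symmetric] X_deriv_one_minus_X_power, simp)
  have "(\<Sum>j\<in>S - orbit p a. cycle_prod fps_X S (p \<circ> transpose a j)) =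
     (\<Sum>A\<in>?C. \<Sum>j\<in>A. cycle_prod fps_X S (p \<circ> transpose a j) :: 'b fps)"
    unfolding U using fA dj by (subst sum.Union_disjoint) auto
  also have "\<dots> = (\<Sum>A\<in>?C. of_nat (card A) * ((1 - fps_X ^ (c + card A)) * (\<Prod>B\<in>?C - {A}. ?f B)))"
    by (intro sum.cong refl) (simp add: prod_A)
  also have "\<dots> = (\<Sum>A\<in>?C. of_nat (card A) * R +
       (1 - fps_X ^ c) * (of_nat (card A) * fps_X ^ card A * (\<Prod>B\<in>?C - {A}. ?f B)))"
    by (intro sum.cong refl, subst R_A) (auto simp: algebra_simps power_add)
  also have "\<dots> = of_nat (card S - c) * R - (1 - fps_X ^ c) * (fps_X * fps_deriv R)"
    unfolding XR cardS by (simp add: sum.distrib sum_distrib_left sum_distrib_right)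
  finally show ?thesis .
qed

text \<open>Multiplied through by \<open>1 - x\<close>, which need not be invertible in the
  ring.\<close>

lemma geometric_split_sum:
  fixes x :: "'b::comm_ring_1"
  assumes "c > 0"
  shows "(1 - x) * (\<Sum>m=1..<c. (1 - x ^ m) * (1 - x ^ (c - m))) =
     of_nat (c - 1) * (1 - x) * (1 + x ^ c) - 2 * (x - x ^ c)"
proof -
  have g: "(1 - x) * (\<Sum>m=1..<c. x ^ m) = x - x ^ c"
    using assms
  proof (induction c rule: nat_induct_non_zero)
    case (Suc n)
    have "(\<Sum>m=1..<Suc n. x ^ m) = (\<Sum>m=1..<n. x ^ m) + x ^ n"
      using Suc by simp
    then have "(1 - x) * (\<Sum>m=1..<Suc n. x ^ m) = (1 - x) * (\<Sum>m=1..<n. x ^ m) + (1 - x) * x ^ n"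
      by (simp only: distrib_left)
    then show ?case unfolding Suc.IH by (simp add: algebra_simps)
  qed simp
  have rev: "(\<Sum>m=1..<c. x ^ (c - m)) = (\<Sum>m=1..<c. x ^ m)"
    by (subst sum.atLeastLessThan_rev) (auto intro!: sum.cong)
  have "(\<Sum>m=1..<c. (1 - x ^ m) * (1 - x ^ (c - m))) = (\<Sum>m=1..<c. (1 + x ^ c) - x ^ m - x ^ (c - m))"
    by (intro sum.cong refl) (auto simp: algebra_simps power_add[symmetric])
  also have "\<dots> = of_nat (c - 1) * (1 + x ^ c) - 2 * (\<Sum>m=1..<c. x ^ m)"
    by (simp add: sum_subtractf rev[unfolded One_nat_def])
  finally have e: "(\<Sum>m=1..<c. (1 - x ^ m) * (1 - x ^ (c - m))) = \<dots>" .
  have "(1 - x) * (N * y - 2 * G) = N * (1 - x) * y - 2 * ((1 - x) * G)" for N y G :: 'b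
    by (simp add: algebra_simps)
  then show ?thesis unfolding e g[symmetric] .
qed

text \<open>The derivative of \<open>X w / (1 - X)^(n + 2)\<close>, with \<open>n = card S\<close>,
  is the first line divided by \<open>(1 - X)^(n + 3)\<close>; this is the origin of the
  \<open>+ 2\<close>. The right side is \<open>n\<close> times the cycle product after a new point
  has joined the cycle of \<open>a\<close>. The identity is the induction step for the averages over
  n-cycles.\<close>

lemma cycle_prod_recursion:
  fixes p :: "'a \<Rightarrow> 'a"
  assumes p: "p permutes S" "finite S" and a: "a \<in> S"
  defines "w \<equiv> cycle_prod fps_X S p :: 'b::comm_ring_1 fps"
  shows "(1 - fps_X) * (w + fps_X * fps_deriv w) + of_nat (card S + 2) * fps_X * w
     + (1 - fps_X) * (\<Sum>j\<in>S - {a}. cycle_prod fps_X S (p \<circ> transpose a j)) =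
     of_nat (card S) * (1 - fps_X ^ Suc (card (orbit p a))) * other_prod fps_X S p a"
proof -
  let ?c = "card (orbit p a)" and ?R = "other_prod fps_X S p a :: 'b fps"
  have cpos: "?c > 0"
    using finite_orbit_p[OF p] orbit_nonempty[of p a] by (simp add: card_gt_0_iff)
  have cle: "?c \<le> card S" using permutes_orbit_subset[OF p(1) a] p(2) by (simp add: card_mono)
  have aO: "a \<in> orbit p a" by (rule self_in_orbit[OF p])
  have w: "w = (1 - fps_X ^ ?c) * ?R" unfolding w_def by (rule cycle_prod_eq_other[OF p a])
  have Xw: "fps_X * fps_deriv w = (1 - fps_X ^ ?c) * (fps_X * fps_deriv ?R) - of_nat ?c * fps_X ^ ?c * ?R"
  proof -
    have "fps_X * fps_deriv w =
       (fps_X * fps_deriv (1 - fps_X ^ ?c)) * ?R + (1 - fps_X ^ ?c) * (fps_X * fps_deriv ?R)"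
      unfolding w by (simp add: algebra_simps)
    then show ?thesis by (simp only: X_deriv_one_minus_X_power) (simp add: algebra_simps)
  qed
  have "S - {a} = (orbit p a - {a}) \<union> (S - orbit p a)"
    using permutes_orbit_subset[OF p(1) a] aO by auto
  then have S1: "(\<Sum>j\<in>S - {a}. cycle_prod fps_X S (p \<circ> transpose a j) :: 'b fps) =
    (\<Sum>j\<in>orbit p a - {a}. cycle_prod fps_X S (p \<circ> transpose a j)) +
    (\<Sum>j\<in>S - orbit p a. cycle_prod fps_X S (p \<circ> transpose a j))"
    using p(2) finite_orbit_p[OF p] by (simp only:) (rule sum.union_disjoint; auto)
  have S: "(1 - fps_X) * (\<Sum>j\<in>S - {a}. cycle_prod fps_X S (p \<circ> transpose a j) :: 'b fps) =
     (of_nat (?c - 1) * (1 - fps_X) * (1 + fps_X ^ ?c) - 2 * (fps_X - fps_X ^ ?c)) * ?R +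
     (1 - fps_X) * (of_nat (card S - ?c) * ?R - (1 - fps_X ^ ?c) * (fps_X * fps_deriv ?R))"
    unfolding S1 sum_cycle_prod_transpose_same[OF p a] sum_cycle_prod_transpose_other[OF p a]
      distrib_left[of "1 - fps_X"] mult.assoc[symmetric] geometric_split_sum[OF cpos] by simp
  obtain c' where c': "?c = Suc c'" using cpos by (cases ?c) auto
  obtain d where d: "card S = ?c + d" using cle by (metis le_Suc_ex)
  \<comment> \<open>Here \<open>y\<close> stands for \<open>x ^ c\<close>, \<open>D\<close> for
    \<open>fps_X * fps_deriv R\<close>, \<open>N + 1\<close> for the length \<open>c\<close> of the
    cycle of \<open>a\<close>, and \<open>e\<close> for the number of points outside it.\<close>
  have alg: "(1 - x) * ((1 - y) * R + ((1 - y) * D - (N + 1) * y * R)) + (N + 1 + e + 2) * x * ((1 - y) * R)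
      + ((N * (1 - x) * (1 + y) - 2 * (x - y)) * R + (1 - x) * (e * R - (1 - y) * D)) =
      (N + 1 + e) * (1 - x * y) * R" for x y R D N e :: "'b fps"
    by (simp add: algebra_simps)
  have n: "of_nat (card S + 2) = of_nat c' + 1 + of_nat d + (2 :: 'b fps)" "card S - ?c = d"
    "of_nat (card S) = of_nat c' + 1 + (of_nat d :: 'b fps)" "of_nat ?c = of_nat c' + (1 :: 'b fps)" "?c - 1 = c'"
    unfolding d c' by simp_all
  show ?thesis unfolding S Xw n unfolding w power_Suc by (rule alg)
qed

section \<open>Inserting a new largest element\<close>

text \<open>In cycle notation this inserts \<open>Suc n\<close> between \<open>j\<close> and
  \<open>p j\<close>; for \<open>j = Suc n\<close> it leaves \<open>Suc n\<close> fixed. Every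
  permutation of \<open>{1..Suc n}\<close> arises once, with \<open>j\<close> the preimage of
  \<open>Suc n\<close>.\<close>

abbreviation insert_last :: "nat \<Rightarrow> (nat \<Rightarrow> nat) \<Rightarrow> nat \<Rightarrow> nat \<Rightarrow> nat" where
  "insert_last n p j \<equiv> p \<circ> transpose j (Suc n)"

lemma perm_setD: "p \<in> perm_set n \<Longrightarrow> p permutes {1..n}"
  by (simp add: perm_set_def)

lemma finite_perm_set [simp]: "finite (perm_set n)"
  by (simp add: perm_set_def finite_permutations)

lemma perm_set_Suc: "p \<in> perm_set n \<Longrightarrow> p \<in> perm_set (Suc n)"
  by (auto simp: perm_set_def intro: permutes_subset)

lemma perm_set_fixes_Suc: "p \<in> perm_set n \<Longrightarrow> p (Suc n) = Suc n"
  by (auto simp: perm_set_def permutes_def)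

lemma perm_set_comp: "p \<in> perm_set n \<Longrightarrow> q \<in> perm_set n \<Longrightarrow> p \<circ> q \<in> perm_set n"
  by (auto simp: perm_set_def intro: permutes_compose)

lemma perm_set_inv: "p \<in> perm_set n \<Longrightarrow> inv p \<in> perm_set n"
  by (auto simp: perm_set_def intro: permutes_inv)

lemma perm_set_transpose: "a \<in> {1..n} \<Longrightarrow> b \<in> {1..n} \<Longrightarrow> transpose a b \<in> perm_set n"
  by (auto simp: perm_set_def intro: permutes_swap_id)

lemma insert_last_in_perm_set:
  "p \<in> perm_set n \<Longrightarrow> j \<in> {1..Suc n} \<Longrightarrow> insert_last n p j \<in> perm_set (Suc n)"
  by (rule perm_set_comp[OF perm_set_Suc perm_set_transpose]) auto

lemma bij_betw_insert_last:
  "bij_betw (\<lambda>(p, j). insert_last n p j) (perm_set n \<times> {1..Suc n}) (perm_set (Suc n))"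
proof (rule bij_betwI')
  fix x y assume xy: "x \<in> perm_set n \<times> {1..Suc n}" "y \<in> perm_set n \<times> {1..Suc n}"
  obtain p j q k where x: "x = (p, j)" and y: "y = (q, k)" by (cases x, cases y)
  have p: "p \<in> perm_set n" and q: "q \<in> perm_set n" using xy x y by auto
  show "((case x of (p, j) \<Rightarrow> insert_last n p j) = (case y of (p, j) \<Rightarrow> insert_last n p j)) = (x = y)"
  proof
    assume "(case x of (p, j) \<Rightarrow> insert_last n p j) = (case y of (p, j) \<Rightarrow> insert_last n p j)"
    then have e: "insert_last n p j = insert_last n q k" by (simp add: x y)
    have "insert_last n q k j = insert_last n p j j" using e by simp
    also have "\<dots> = q (Suc n)" using perm_set_fixes_Suc[OF p] perm_set_fixes_Suc[OF q] by simp
    finally have "transpose k (Suc n) j = Suc n"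
      using permutes_inj[OF perm_setD[OF q]] by (simp add: inj_eq)
    then have jk: "j = k" by (metis transpose_apply_second transpose_involutory)
    then have "insert_last n p j \<circ> transpose j (Suc n) = insert_last n q j \<circ> transpose j (Suc n)"
      using e by simp
    then have "p = q" by (simp add: comp_assoc)
    then show "x = y" using jk x y by simp
  qed simp
next
  fix x assume "x \<in> perm_set n \<times> {1..Suc n}"
  then show "(case x of (p, j) \<Rightarrow> insert_last n p j) \<in> perm_set (Suc n)"
    by (auto intro!: insert_last_in_perm_set)
next
  fix h assume h: "h \<in> perm_set (Suc n)"
  note hp = perm_setD[OF h]
  define j where "j = inv h (Suc n)"
  have j: "j \<in> {1..Suc n}" "h j = Suc n"
    using permutes_in_image[OF permutes_inv[OF hp]] permutes_inverses[OF hp] by (auto simp: j_def)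
  define p where "p = h \<circ> transpose j (Suc n)"
  have p1: "p permutes {1..Suc n}" unfolding p_def using hp j by (intro permutes_compose permutes_swap_id) auto
  have "p (Suc n) = Suc n" using j by (simp add: p_def)
  then have "p permutes {1..n}"
    using permutes_superset[OF p1, of "{1..n}"] by (auto simp: le_Suc_eq)
  moreover have "h = insert_last n p j" by (simp add: p_def comp_assoc)
  ultimately show "\<exists>x\<in>perm_set n \<times> {1..Suc n}. h = (case x of (p, j) \<Rightarrow> insert_last n p j)"
    using j by (intro bexI[of _ "(p, j)"]) (auto simp: perm_set_def)
qed

lemma sum_perm_set_Suc:
  "(\<Sum>h\<in>perm_set (Suc n). F h) = (\<Sum>p\<in>perm_set n. F p + (\<Sum>j=1..n. F (insert_last n p j)))"
proof -
  have "(\<Sum>h\<in>perm_set (Suc n). F h) = (\<Sum>(p, j)\<in>perm_set n \<times> {1..Suc n}. F (insert_last n p j))"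
    by (subst sum.reindex_bij_betw[OF bij_betw_insert_last, symmetric]) (simp add: case_prod_unfold)
  also have "\<dots> = (\<Sum>p\<in>perm_set n. \<Sum>j=1..Suc n. F (insert_last n p j))"
    by (rule sum.cartesian_product[symmetric])
  finally show ?thesis by (simp add: add.commute)
qed

lemma cycles_Suc:
  assumes "p \<in> perm_set n"
  shows "cycles {1..Suc n} p = insert {Suc n} (cycles {1..n} p)" "{Suc n} \<notin> cycles {1..n} p"
    "orbit p (Suc n) = {Suc n}"
proof -
  show o: "orbit p (Suc n) = {Suc n}"
    using perm_set_fixes_Suc[OF assms] by (simp add: orbit_eq_singleton_iff)
  show "cycles {1..Suc n} p = insert {Suc n} (cycles {1..n} p)"
    by (simp add: cycles_def atLeastAtMostSuc_conv o)
  show "{Suc n} \<notin> cycles {1..n} p"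
  proof
    assume "{Suc n} \<in> cycles {1..n} p"
    then have "Suc n \<in> \<Union>(cycles {1..n} p)" by blast
    then show False unfolding Union_cycles[OF perm_setD[OF assms] finite_atLeastAtMost] by simp
  qed
qed

lemma cycles_insert_last:
  assumes p: "p \<in> perm_set n" and j: "j \<in> {1..n}"
  defines "h \<equiv> insert_last n p j"
  shows "orbit h (Suc n) = insert (Suc n) (orbit p j)"
    and "cycles {1..Suc n} h - {orbit h (Suc n)} = cycles {1..n} p - {orbit p j}"
    and "cycles {1..Suc n} h = insert (insert (Suc n) (orbit p j)) (cycles {1..n} p - {orbit p j})"
    and "insert (Suc n) (orbit p j) \<notin> cycles {1..n} p"
proof -
  note ps = perm_setD[OF p] perm_setD[OF perm_set_Suc[OF p]]
  have sub: "orbit p j \<subseteq> {1..n}" using permutes_orbit_subset[OF ps(1) j] .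
  then have ni: "Suc n \<notin> orbit p j" by auto
  note m = orbit_merge(2)[OF ps(2) _ ni, folded h_def] cycles_merge[OF ps(2) _ _ _ ni, folded h_def]
  show 1: "orbit h (Suc n) = insert (Suc n) (orbit p j)" using m(1) cycles_Suc[OF p] by simp
  show 2: "cycles {1..Suc n} h = insert (insert (Suc n) (orbit p j)) (cycles {1..n} p - {orbit p j})"
    using m(2) j cycles_Suc[OF p] by auto
  show 3: "insert (Suc n) (orbit p j) \<notin> cycles {1..n} p"
  proof
    assume "insert (Suc n) (orbit p j) \<in> cycles {1..n} p"
    then have "Suc n \<in> \<Union>(cycles {1..n} p)" by blast
    then show False unfolding Union_cycles[OF ps(1) finite_atLeastAtMost] by simp
  qed
  show "cycles {1..Suc n} h - {orbit h (Suc n)} = cycles {1..n} p - {orbit p j}"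
    using 1 2 3 by auto
qed

lemma cycle_count_Suc: "p \<in> perm_set n \<Longrightarrow> cycle_count (Suc n) p = Suc (cycle_count n p)"
  using cycles_Suc[of p n] finite_cycles[OF perm_setD] by (simp add: cycle_count_eq)

lemma cycle_count_insert_last:
  assumes "p \<in> perm_set n" "j \<in> {1..n}"
  shows "cycle_count (Suc n) (insert_last n p j) = cycle_count n p"
proof -
  have f: "finite (cycles {1..n} p)" by (simp add: cycles_def)
  have "orbit p j \<in> cycles {1..n} p" using assms by (auto simp: cycles_def)
  then have "cycle_count n p > 0" using f by (auto simp: cycle_count_eq card_gt_0_iff)
  then show ?thesis unfolding cycle_count_eq cycles_insert_last(3)[OF assms]
    using f cycles_insert_last(4)[OF assms] \<open>orbit p j \<in> _\<close>
    by (subst card_insert_disjoint) (auto simp: cycle_count_eq)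
qed

section \<open>Conjugation, and recursions for sums over n-cycles\<close>

lemma orbit_conj:
  assumes "p permutes S" "finite S" "s permutes S"
  shows "orbit (s \<circ> p \<circ> inv s) (s x) = s ` orbit p x"
  by (rule orbit_inverse[symmetric, OF self_in_orbit[OF assms(1,2)]])
    (simp add: permutes_inverses[OF assms(3)])

lemma cycles_conj:
  assumes "p permutes S" "finite S" "s permutes S"
  shows "cycles S (s \<circ> p \<circ> inv s) = (`) s ` cycles S p"
proof -
  have "cycles S (s \<circ> p \<circ> inv s) = orbit (s \<circ> p \<circ> inv s) ` s ` S"
    using permutes_image[OF assms(3)] by (simp add: cycles_def)
  then show ?thesis by (simp add: cycles_def image_image orbit_conj[OF assms])
qed

text \<open>The two products are conjugate by \<open>x\<close>.\<close>

lemma cycle_count_comp_commute: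
  assumes "x \<in> perm_set n" "y \<in> perm_set n"
  shows "cycle_count n (x \<circ> y) = cycle_count n (y \<circ> x)"
proof -
  note x = perm_setD[OF assms(1)]
  have e: "x \<circ> y = x \<circ> (y \<circ> x) \<circ> inv x"
    by (simp add: comp_assoc permutes_inv_o[OF x])
  have "inj_on ((`) x) A" for A
    using permutes_inj[OF x] by (simp add: inj_on_def inj_image_eq_iff)
  then show ?thesis unfolding cycle_count_eq
    using cycles_conj[OF perm_setD[OF perm_set_comp[OF assms(2,1)]] _ x] e by (simp add: card_image)
qed

lemma cyc_class_subset: "cyc_class n i \<subseteq> perm_set n"
  by (auto simp: cyc_class_def)

lemma bij_betw_ncycles:
  assumes "n \<ge> 1"
  shows "bij_betw (\<lambda>(p, j). insert_last n p j) (cyc_class n 1 \<times> {1..n}) (cyc_class (Suc n) 1)"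
proof -
  let ?f = "\<lambda>(p, j). insert_last n p j"
  have cc: "cycle_count n p > 0" if "p \<in> perm_set n" for p
    using assms finite_cycles[OF perm_setD[OF that]]
    by (auto simp: cycle_count_eq cycles_def card_gt_0_iff)
  have "inj_on ?f (cyc_class n 1 \<times> {1..n})"
    by (rule inj_on_subset[OF bij_betw_imp_inj_on[OF bij_betw_insert_last[of n]]])
      (auto simp: cyc_class_def)
  moreover have "?f ` (cyc_class n 1 \<times> {1..n}) = cyc_class (Suc n) 1"
  proof
    show "?f ` (cyc_class n 1 \<times> {1..n}) \<subseteq> cyc_class (Suc n) 1"
      by (auto simp: cyc_class_def cycle_count_insert_last
          intro!: insert_last_in_perm_set)
    show "cyc_class (Suc n) 1 \<subseteq> ?f ` (cyc_class n 1 \<times> {1..n})"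
    proof
      fix h assume h: "h \<in> cyc_class (Suc n) 1"
      then have "h \<in> ?f ` (perm_set n \<times> {1..Suc n})"
        using bij_betw_imp_surj_on[OF bij_betw_insert_last[of n]] by (auto simp: cyc_class_def)
      then obtain p j where pj: "p \<in> perm_set n" "j \<in> {1..Suc n}" "h = insert_last n p j" by auto
      \<comment> \<open>Otherwise \<open>Suc n\<close> would be a fixed point beside at least one
        more cycle, as \<open>n \<ge> 1\<close>.\<close>
      have "j \<noteq> Suc n"
      proof
        assume "j = Suc n"
        then have "h = p" using pj by simp
        then show False using h cycle_count_Suc[OF pj(1)] cc[OF pj(1)] by (simp add: cyc_class_def)
      qed
      then have "j \<in> {1..n}" using pj by auto
      then show "h \<in> ?f ` (cyc_class n 1 \<times> {1..n})"
        using pj h cycle_count_insert_last[OF pj(1)] by (force simp: cyc_class_def)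
    qed
  qed
  ultimately show ?thesis by (simp add: bij_betw_def)
qed

text \<open>The average over n-cycles without the factor \<open>1 / fact (n - 1)\<close>, so that
  its recursions in \<open>n\<close> have integer coefficients.\<close>

definition ncycle_sum :: "nat \<Rightarrow> (nat \<Rightarrow> nat) \<Rightarrow> nat \<Rightarrow> real" where
  "ncycle_sum n g r = (\<Sum>\<sigma>\<in>cyc_class n 1. real r ^ cycle_count n (inv \<sigma> \<circ> g))"

lemma ncycle_sum_Suc:
  assumes "n \<ge> 1"
  shows "ncycle_sum (Suc n) g r = (\<Sum>\<sigma>\<in>cyc_class n 1. \<Sum>j=1..n.
     real r ^ cycle_count (Suc n) (transpose j (Suc n) \<circ> (inv \<sigma> \<circ> g)))"
proof -
  have "inv (insert_last n \<sigma> j) = transpose j (Suc n) \<circ> inv \<sigma>" if "\<sigma> \<in> cyc_class n 1" for \<sigma> j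
    using that permutes_bij[OF perm_setD] by (subst o_inv_distrib) (auto simp: cyc_class_def)
  note inv = this
  have "ncycle_sum (Suc n) g r = (\<Sum>(\<sigma>, j)\<in>cyc_class n 1 \<times> {1..n}.
     real r ^ cycle_count (Suc n) (inv (insert_last n \<sigma> j) \<circ> g))"
    unfolding ncycle_sum_def
    by (subst sum.reindex_bij_betw[OF bij_betw_ncycles[OF assms], symmetric]) (simp add: case_prod_unfold)
  also have "\<dots> = (\<Sum>\<sigma>\<in>cyc_class n 1. \<Sum>j=1..n. real r ^ cycle_count (Suc n) (inv (insert_last n \<sigma> j) \<circ> g))"
    by (rule sum.cartesian_product[symmetric])
  finally show ?thesis by (simp add: inv comp_assoc)
qed

text \<open>The extra transposition puts the fixed point \<open>Suc n\<close> of
  \<open>inv \<sigma> \<circ> g\<close> into an existing cycle, so the number of cycles stays that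
  of \<open>inv \<sigma> \<circ> g\<close> on \<open>{1..n}\<close>; each of the \<open>n\<close>
  values of \<open>j\<close> gives the old sum.\<close>

lemma ncycle_sum_fixed:
  assumes "n \<ge> 1" "g \<in> perm_set n"
  shows "ncycle_sum (Suc n) g r = n * ncycle_sum n g r"
proof -
  have "cycle_count (Suc n) (transpose j (Suc n) \<circ> (inv \<sigma> \<circ> g)) = cycle_count n (inv \<sigma> \<circ> g)"
    if "\<sigma> \<in> cyc_class n 1" "j \<in> {1..n}" for \<sigma> j
  proof -
    have w: "inv \<sigma> \<circ> g \<in> perm_set n"
      using that assms by (auto simp: cyc_class_def intro: perm_set_comp perm_set_inv)
    then show ?thesis
      using that cycle_count_comp_commute[OF perm_set_transpose[of j "Suc n" "Suc n"] perm_set_Suc[OF w]]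
        cycle_count_insert_last[OF w] by simp
  qed
  then show ?thesis unfolding ncycle_sum_Suc[OF assms(1)] by (simp add: ncycle_sum_def sum_distrib_left)
qed

text \<open>For \<open>j = a\<close> the two transpositions with \<open>Suc n\<close> cancel up to
  conjugation, and \<open>Suc n\<close> becomes a cycle by itself, hence the factor
  \<open>r\<close>. For \<open>j \<noteq> a\<close> their product equals
  \<open>transpose a j\<close> followed by a fresh insertion of \<open>Suc n\<close> behind
  \<open>a\<close>, which does not change the number of cycles.\<close>

lemma ncycle_sum_insert_last:
  assumes "n \<ge> 1" and g: "g \<in> perm_set n" and a: "a \<in> {1..n}"
  shows "ncycle_sum (Suc n) (insert_last n g a) r =
    r * ncycle_sum n g r + (\<Sum>j\<in>{1..n} - {a}. ncycle_sum n (g \<circ> transpose a j) r)"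
proof -
  let ?t = "\<lambda>j. transpose j (Suc n)"
  have eq: "cycle_count (Suc n) (?t j \<circ> (inv \<sigma> \<circ> insert_last n g a)) =
     (if j = a then Suc (cycle_count n (inv \<sigma> \<circ> g)) else cycle_count n (inv \<sigma> \<circ> (g \<circ> transpose a j)))"
    if "\<sigma> \<in> cyc_class n 1" and j: "j \<in> {1..n}" for \<sigma> j
  proof -
    have w: "inv \<sigma> \<circ> g \<in> perm_set n"
      using that assms by (auto simp: cyc_class_def intro: perm_set_comp perm_set_inv)
    have "cycle_count (Suc n) (?t j \<circ> (inv \<sigma> \<circ> insert_last n g a)) =
       cycle_count (Suc n) (insert_last n (inv \<sigma> \<circ> g) a \<circ> ?t j)"
      using cycle_count_comp_commute[OF perm_set_transpose[of j "Suc n" "Suc n"] insert_last_in_perm_set[OF w, of a]] j a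
      by (simp add: comp_assoc)
    also have "\<dots> = (if j = a then Suc (cycle_count n (inv \<sigma> \<circ> g)) else cycle_count n (inv \<sigma> \<circ> (g \<circ> transpose a j)))"
    proof (cases "j = a")
      case True
      then show ?thesis using cycle_count_Suc[OF w] by (simp add: comp_assoc)
    next
      case False
      have "?t a \<circ> ?t j = transpose a j \<circ> ?t a"
        using False a j by (auto simp: fun_eq_iff Transposition.transpose_def)
      then have "insert_last n (inv \<sigma> \<circ> g) a \<circ> ?t j = insert_last n (inv \<sigma> \<circ> (g \<circ> transpose a j)) a"
        by (simp add: comp_assoc)
      moreover have "inv \<sigma> \<circ> (g \<circ> transpose a j) \<in> perm_set n"
        using perm_set_comp[OF w perm_set_transpose[OF a j]] by (simp add: comp_assoc)
      ultimately show ?thesis using False cycle_count_insert_last[OF _ a] by simp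
    qed
    finally show ?thesis .
  qed
  have "ncycle_sum (Suc n) (insert_last n g a) r = (\<Sum>\<sigma>\<in>cyc_class n 1. \<Sum>j=1..n.
     real r ^ (if j = a then Suc (cycle_count n (inv \<sigma> \<circ> g)) else cycle_count n (inv \<sigma> \<circ> (g \<circ> transpose a j))))"
    unfolding ncycle_sum_Suc[OF assms(1)] by (intro sum.cong refl) (simp add: eq)
  also have "\<dots> = (\<Sum>\<sigma>\<in>cyc_class n 1. real r * real r ^ cycle_count n (inv \<sigma> \<circ> g) +
     (\<Sum>j\<in>{1..n} - {a}. real r ^ cycle_count n (inv \<sigma> \<circ> (g \<circ> transpose a j))))"
    by (intro sum.cong refl, subst sum.remove[OF _ a]) auto
  also have "\<dots> = r * ncycle_sum n g r + (\<Sum>j\<in>{1..n} - {a}. ncycle_sum n (g \<circ> transpose a j) r)"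
    unfolding ncycle_sum_def
    by (simp add: sum.distrib sum_distrib_left) (rule sum.swap)
  finally show ?thesis .
qed

section \<open>Averages over \<open>n\<close>-cycles\<close>

definition cycle_weight :: "(nat \<Rightarrow> 'b::comm_ring_1) \<Rightarrow> 'a set \<Rightarrow> ('a \<Rightarrow> 'a) \<Rightarrow> 'b" where
  "cycle_weight f S p = (\<Prod>A\<in>cycles S p. f (card A))"

text \<open>A point inserted behind \<open>a\<close> lengthens only the cycle of \<open>a\<close>.
  Giving this cycle its own weight \<open>f0\<close> closes the recursion: \<open>f0\<close> is
  replaced by its shift, which for \<open>f0 c = x ^ c\<close> is just a factor
  \<open>x\<close>.\<close>

definition marked_weight :: "(nat \<Rightarrow> 'b::comm_ring_1) \<Rightarrow> (nat \<Rightarrow> 'b) \<Rightarrow> 'a set \<Rightarrow> ('a \<Rightarrow> 'a) \<Rightarrow> 'a \<Rightarrow> 'b" where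
  "marked_weight f0 f S p a = f0 (card (orbit p a)) * (\<Prod>A\<in>cycles S p - {orbit p a}. f (card A))"

lemma cycle_weight_eq_marked:
  assumes "p permutes S" "finite S" "a \<in> S"
  shows "cycle_weight f S p = marked_weight f f S p a"
  unfolding cycle_weight_def marked_weight_def
  by (rule prod.remove) (use assms in \<open>auto simp: finite_cycles cycles_def\<close>)

lemma marked_weight_conj:
  assumes "p permutes S" "finite S" "s permutes S"
  shows "marked_weight f0 f S (s \<circ> p \<circ> inv s) (s a) = marked_weight f0 f S p a"
proof -
  have inj: "inj ((`) s)"
    using permutes_inj[OF assms(3)] by (simp add: inj_on_def inj_image_eq_iff)
  have c: "card (s ` A) = card A" for A
    using permutes_inj[OF assms(3)] by (simp add: card_image inj_on_subset)
  have "(`) s ` cycles S p - {s ` orbit p a} = (`) s ` (cycles S p - {orbit p a})"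
    using inj by (simp add: image_set_diff)
  then show ?thesis unfolding marked_weight_def cycles_conj[OF assms] orbit_conj[OF assms]
    using inj by (simp add: c prod.reindex inj_on_subset o_def)
qed

lemma sum_marked_weight_eq:
  assumes "a \<in> {1..n}" "b \<in> {1..n}"
  shows "(\<Sum>p\<in>perm_set n. marked_weight f0 f {1..n} p a) = (\<Sum>p\<in>perm_set n. marked_weight f0 f {1..n} p b)"
proof (rule sum.reindex_bij_witness)
  let ?s = "transpose a b"
  have s: "?s \<in> perm_set n" using assms by (rule perm_set_transpose)
  fix p assume p: "p \<in> perm_set n"
  show "?s \<circ> p \<circ> ?s \<in> perm_set n" using s p by (intro perm_set_comp)
  show "?s \<circ> p \<circ> ?s \<in> perm_set n" using s p by (intro perm_set_comp)
  show "?s \<circ> (?s \<circ> p \<circ> ?s) \<circ> ?s = p" by (auto simp: fun_eq_iff)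
  show "?s \<circ> (?s \<circ> p \<circ> ?s) \<circ> ?s = p" by (auto simp: fun_eq_iff)
  show "marked_weight f0 f {1..n} (?s \<circ> p \<circ> ?s) b = marked_weight f0 f {1..n} p a"
    using marked_weight_conj[OF perm_setD[OF p] _ perm_setD[OF s], of f0 f a] by simp
qed

text \<open>The new point carries the mark. It is alone in its cycle, or it joins the cycle of some
  \<open>j\<close>, and by conjugation every \<open>j\<close> contributes as much as
  \<open>j = n\<close>.\<close>

lemma sum_marked_weight_Suc:
  assumes "n \<ge> 1"
  shows "(\<Sum>p\<in>perm_set (Suc n). marked_weight f0 f {1..Suc n} p (Suc n)) =
    f0 1 * (\<Sum>p\<in>perm_set n. cycle_weight f {1..n} p) +
    of_nat n * (\<Sum>p\<in>perm_set n. marked_weight (\<lambda>c. f0 (Suc c)) f {1..n} p n)"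
proof -
  have 1: "marked_weight f0 f {1..Suc n} p (Suc n) = f0 1 * cycle_weight f {1..n} p"
    if "p \<in> perm_set n" for p
    using cycles_Suc[OF that] by (simp add: marked_weight_def cycle_weight_def insert_Diff_if)
  have 2: "marked_weight f0 f {1..Suc n} (insert_last n p j) (Suc n) =
      marked_weight (\<lambda>c. f0 (Suc c)) f {1..n} p j" if "p \<in> perm_set n" "j \<in> {1..n}" for p j
  proof -
    have "Suc n \<notin> orbit p j" using permutes_orbit_subset[OF perm_setD] that by fastforce
    moreover have "finite (orbit p j)" using finite_orbit_p[OF perm_setD[OF that(1)]] by simp
    ultimately show ?thesis
      unfolding marked_weight_def cycles_insert_last(2)[OF that]
      unfolding cycles_insert_last(1)[OF that] by simp
  qed
  have "(\<Sum>p\<in>perm_set n. \<Sum>j=1..n. marked_weight (\<lambda>c. f0 (Suc c)) f {1..n} p j) =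
     (\<Sum>j=1..n. \<Sum>p\<in>perm_set n. marked_weight (\<lambda>c. f0 (Suc c)) f {1..n} p j)"
    by (rule sum.swap)
  also have "\<dots> = (\<Sum>j=1..n. \<Sum>p\<in>perm_set n. marked_weight (\<lambda>c. f0 (Suc c)) f {1..n} p n)"
    by (rule sum.cong[OF refl], rule sum_marked_weight_eq) (use assms in auto)
  finally show ?thesis unfolding sum_perm_set_Suc
    by (simp add: 1 2 sum.distrib sum_distrib_left del: One_nat_def)
qed

lemma perm_set_1: "perm_set 1 = {id}"
  by (auto simp: perm_set_def)

lemma cycles_singleton_id: "cycles {a} id = {{a}}" "orbit id a = {a}"
  by (simp_all add: cycles_def orbit_eq_singleton_iff)

text \<open>A cycle of length \<open>c\<close> has weight \<open>1 - q^c - p^c + (q p)^c\<close>.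
  Splitting the weight of the cycle of \<open>n\<close> writes the sum \<open>Z\<close> in terms of
  four marked sums \<open>M x\<close> with \<open>x = 1, q, p, q p\<close>, and each obeys
  \<open>M x (Suc n) = x (Z n + n M x n)\<close>.\<close>

lemma sum_cycle_prod_mult:
  fixes q p :: "'b::comm_ring_1"
  assumes "n \<ge> 1"
  shows "(\<Sum>g\<in>perm_set n. cycle_prod q {1..n} g * cycle_prod p {1..n} g) =
    of_nat (fact n) * ((1 - q) * (1 - p) * (\<Sum>i<n. (q * p) ^ i))"
proof -
  define u where "u = q * p"
  define w where "w = (1 - q) * (1 - p)"
  define f where "f c = (1 - q ^ c) * (1 - p ^ c)" for c
  define br where "br n = (\<Sum>i<n. u ^ i)" for n
  define S where "S n = (\<Sum>m<n. br m)" for n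
  define Z where "Z n = (\<Sum>g\<in>perm_set n. cycle_weight f {1..n} g)" for n
  define M where "M x n = (\<Sum>g\<in>perm_set n. marked_weight (\<lambda>c. x ^ c) f {1..n} g n)" for x n
  have Z: "Z n = M 1 n - M q n - M p n + M u n" if "n \<ge> 1" for n
  proof -
    have "cycle_weight f {1..n} g = marked_weight (\<lambda>c. 1 ^ c) f {1..n} g n - marked_weight (\<lambda>c. q ^ c) f {1..n} g n
       - marked_weight (\<lambda>c. p ^ c) f {1..n} g n + marked_weight (\<lambda>c. u ^ c) f {1..n} g n"
      if g: "g \<in> perm_set n" for g
      unfolding cycle_weight_eq_marked[OF perm_setD[OF g] _ , of n] using \<open>n \<ge> 1\<close>
      by (subst cycle_weight_eq_marked[OF perm_setD[OF g] _ , of n])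
        (auto simp: marked_weight_def f_def u_def algebra_simps power_mult_distrib)
    then show ?thesis unfolding Z_def M_def by (simp add: sum.distrib sum_subtractf del: power_one)
  qed
  have M: "M x (Suc n) = x * (Z n + of_nat n * M x n)" if "n \<ge> 1" for x n
  proof -
    have "marked_weight (\<lambda>c. x ^ Suc c) f {1..n} g n = x * marked_weight (\<lambda>c. x ^ c) f {1..n} g n" for g
      by (simp add: marked_weight_def algebra_simps)
    then show ?thesis unfolding M_def sum_marked_weight_Suc[OF that] Z_def
      by (simp add: sum_distrib_left[symmetric] algebra_simps)
  qed
  have br: "br (Suc n) = 1 + u * br n" "br (Suc n) = br n + u ^ n" for n
  proof -
    show "br (Suc n) = br n + u ^ n" by (simp add: br_def)
    show "br (Suc n) = 1 + u * br n" unfolding br_def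
      by (subst sum.lessThan_Suc_shift) (simp add: sum_distrib_left)
  qed
  have S: "S (Suc n) = S n + br n" for n by (simp add: S_def)
  \<comment> \<open>\<open>br n\<close> is the geometric sum in \<open>u\<close> and
    \<open>S n\<close> the sum of these; the rules for \<open>u * br n\<close> and
    \<open>u * S n\<close> take the place of division by \<open>1 - u\<close>.\<close>
  have geo: "u * br n = br n + u ^ n - 1" for n using br(1)[of n] br(2)[of n] by (simp add: algebra_simps)
  have uS: "u * S n = S n + br n - of_nat n" for n
  proof (induction n)
    case (Suc n) then show ?case unfolding S distrib_left Suc geo br(2) by simp
  qed (simp add: S_def br_def)
  \<comment> \<open>The five closed forms are proved together: each next \<open>M\<close> needs
    \<open>Z\<close>, and the next \<open>Z\<close> is read off the four \<open>M\<close>.\<close>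
  have inv: "M 1 n = of_nat (fact (n - 1)) * (1 + w * S n) \<and>
     M q n = of_nat (fact (n - 1)) * (1 - (1 - q) * br n) \<and>
     M p n = of_nat (fact (n - 1)) * (1 - (1 - p) * br n) \<and>
     M u n = of_nat (fact (n - 1)) * (u ^ n + w * (of_nat (n - 1) * br n - S n)) \<and>
     Z n = of_nat (fact n) * (w * br n)"
    using assms
  proof (induction n rule: nat_induct_at_least)
    case base
    have M1: "M x 1 = x" for x
      unfolding M_def perm_set_1 by (simp add: marked_weight_def cycles_singleton_id)
    have "Z 1 = w" using Z[of 1] by (simp add: M1[unfolded One_nat_def] u_def w_def algebra_simps)
    moreover have "br 1 = 1" "S 1 = 0" by (simp_all add: br_def S_def)
    ultimately show ?case by (simp add: M1 del: One_nat_def)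
  next
    case (Suc n)
    have fact: "of_nat (fact n) = of_nat n * (of_nat (fact (n - 1)) :: 'b)"
      using Suc.hyps by (simp add: fact_reduce)
    define K where "K = (of_nat (fact n) :: 'b)"
    have n1: "of_nat (n - 1) = of_nat n - (1 :: 'b)" using Suc.hyps by (simp add: of_nat_diff)
    have step: "M x (Suc n) = K * (x * (w * br n + y))"
      if "M x n = of_nat (fact (n - 1)) * y" for x y
      unfolding M[OF Suc.hyps] that using Suc.IH fact by (simp add: K_def algebra_simps)
    have a1: "M 1 (Suc n) = K * (1 + w * S (Suc n))"
      using step[OF conjunct1[OF Suc.IH]] by (simp add: S algebra_simps)
    have a2: "M q (Suc n) = K * (1 - (1 - q) * br (Suc n))"
    proof -
      have "q * (w * br n + (1 - (1 - q) * br n)) = 1 - (1 - q) * (1 + u * br n)"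
        unfolding u_def w_def by (simp add: algebra_simps)
      then show ?thesis using step Suc.IH br(1) by simp
    qed
    have a3: "M p (Suc n) = K * (1 - (1 - p) * br (Suc n))"
    proof -
      have "p * (w * br n + (1 - (1 - p) * br n)) = 1 - (1 - p) * (1 + u * br n)"
        unfolding u_def w_def by (simp add: algebra_simps)
      then show ?thesis using step Suc.IH br(1) by simp
    qed
    have a4: "M u (Suc n) = K * (u ^ Suc n + w * (of_nat n * br (Suc n) - S (Suc n)))"
    proof -
      have "u * (w * br n + (u ^ n + w * (of_nat (n - 1) * br n - S n))) =
         u ^ Suc n + w * (of_nat n * (u * br n) - u * S n)"
        unfolding n1 by (simp add: algebra_simps)
      also have "\<dots> = u ^ Suc n + w * (of_nat n * br (Suc n) - S (Suc n))"
        unfolding uS geo S br(2) by (simp add: algebra_simps)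
      finally show ?thesis using step[of u] Suc.IH by simp
    qed
    have "Z (Suc n) = K * (u ^ Suc n - 1 + (2 - q - p) * br (Suc n) + w * of_nat n * br (Suc n))"
      using Z[of "Suc n"] by (simp add: a1 a2 a3 a4 algebra_simps)
    also have "u ^ Suc n - 1 = u * br (Suc n) - br (Suc n)" unfolding geo by simp
    also have "K * (u * br (Suc n) - br (Suc n) + (2 - q - p) * br (Suc n) + w * of_nat n * br (Suc n)) =
       K * ((1 + of_nat n) * (w * br (Suc n)))"
      unfolding w_def u_def by (simp add: algebra_simps)
    finally have "Z (Suc n) = of_nat (fact (Suc n)) * (w * br (Suc n))"
      by (simp add: K_def algebra_simps)
    then show ?case using a1 a2 a3 a4 by (simp add: K_def)
  qed
  have "cycle_prod q {1..n} g * cycle_prod p {1..n} g = cycle_weight f {1..n} g" for g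
    by (simp add: cycle_prod_def cycle_weight_def f_def prod.distrib)
  then show ?thesis using inv by (simp add: Z_def w_def br_def u_def)
qed

section \<open>Generating functions in the number of letters\<close>

definition eul :: "nat \<Rightarrow> nat \<Rightarrow> nat \<Rightarrow> nat" where
  "eul n i r = (r + (n - 1 - i)) choose n"

text \<open>By Pascal's rule, multiplication by \<open>1 - X\<close> lowers \<open>n\<close> by
  one.\<close>

lemma binomial_fps: "Abs_fps (\<lambda>k. of_nat ((n + k) choose n)) * (1 - fps_X) ^ Suc n = (1 :: 'b::comm_ring_1 fps)"
proof (induction n)
  case 0
  show ?case by (rule fps_ext) (simp add: algebra_simps fps_mult_fps_X_commute[symmetric])
next
  case (Suc n)
  have "Abs_fps (\<lambda>k. of_nat ((Suc n + k) choose Suc n)) * (1 - fps_X) = (Abs_fps (\<lambda>k. of_nat ((n + k) choose n)) :: 'b fps)"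
  proof (rule fps_ext)
    fix k
    show "fps_nth (Abs_fps (\<lambda>k. of_nat ((Suc n + k) choose Suc n)) * (1 - fps_X)) k =
      fps_nth (Abs_fps (\<lambda>k. of_nat ((n + k) choose n)) :: 'b fps) k"
      by (cases k) (simp_all add: algebra_simps binomial_eq_0)
  qed
  note e = this
  have "Abs_fps (\<lambda>k. of_nat ((Suc n + k) choose Suc n)) * (1 - fps_X) ^ Suc (Suc n) =
      Abs_fps (\<lambda>k. of_nat ((Suc n + k) choose Suc n)) * (1 - fps_X) * ((1 - fps_X) ^ Suc n :: 'b fps)"
    by (simp only: power_Suc mult.assoc)
  then show ?case unfolding e Suc .
qed

text \<open>The coefficients at \<open>r \<le> i\<close> vanish and the others are those of
  \<open>binomial_fps\<close>, shifted. This is what turns powers of \<open>X\<close> in a numerator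
  into numbers \<open>eul n i r\<close>.\<close>

lemma eul_fps:
  assumes "i < n"
  shows "Abs_fps (\<lambda>r. of_nat (eul n i r)) * (1 - fps_X) ^ Suc n = (fps_X ^ Suc i :: 'b::comm_ring_1 fps)"
proof -
  have "Abs_fps (\<lambda>r. of_nat (eul n i r)) = (fps_X ^ Suc i * Abs_fps (\<lambda>k. of_nat ((n + k) choose n)) :: 'b fps)"
  proof (rule fps_ext)
    fix r
    show "fps_nth (Abs_fps (\<lambda>r. of_nat (eul n i r))) r =
      fps_nth (fps_X ^ Suc i * Abs_fps (\<lambda>k. of_nat ((n + k) choose n)) :: 'b fps) r"
    proof (cases "r \<le> i")
      case True
      then show ?thesis using assms by (simp add: eul_def fps_X_power_mult_nth binomial_eq_0 del: power_Suc)
    next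
      case False
      then have "eul n i r = (n + (r - Suc i)) choose n" unfolding eul_def using assms
        by (intro arg_cong[where f = "\<lambda>m. m choose n"]) simp
      then show ?thesis using False by (simp add: fps_X_power_mult_nth del: power_Suc)
    qed
  qed
  then show ?thesis using binomial_fps[of n, where 'b='b] by (simp add: mult.assoc)
qed

text \<open>Induction on \<open>n\<close> with \<open>g = insert_last n p a\<close>. If
  \<open>Suc n\<close> is fixed, the cycle product gains the factor \<open>1 - X\<close>; otherwise
  multiplication by \<open>r\<close> becomes \<open>X d/dX\<close>, and
  \<open>cycle_prod_recursion\<close> evaluates the outcome.\<close>

lemma ncycle_sum_fps:
  assumes "n \<ge> 1" "g \<in> perm_set n"
  shows "Abs_fps (ncycle_sum n g) * (1 - fps_X) ^ (n + 2) =
    of_nat (fact (n - 1)) * fps_X * cycle_prod fps_X {1..n} g"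
  using assms
proof (induction n arbitrary: g rule: nat_induct_at_least)
  case base
  have c1: "cycle_count 1 id = 1" by (simp add: cycle_count_eq cycles_singleton_id)
  then have cc: "cyc_class 1 1 = {id}" by (auto simp: cyc_class_def perm_set_1[simplified])
  have g: "g = id" using base perm_set_1 by auto
  have a: "Abs_fps (ncycle_sum 1 g) = Abs_fps (\<lambda>r. of_nat r)"
    unfolding ncycle_sum_def cc g using c1 by simp
  have "Abs_fps (\<lambda>r. of_nat r) * (1 - fps_X) ^ 2 = (fps_X :: real fps)"
    using eul_fps[of 0 1, where 'b=real] by (simp add: eul_def numeral_2_eq_2)
  from arg_cong[OF this, of "\<lambda>f. f * (1 - fps_X)"]
  have e: "Abs_fps (\<lambda>r. of_nat r) * (1 - fps_X) ^ (1 + 2) = (fps_X * (1 - fps_X) :: real fps)"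
    by (simp add: eval_nat_numeral mult.assoc)
  show ?case unfolding a e by (simp add: cycle_prod_def g cycles_singleton_id[unfolded id_def])
next
  case (Suc n)
  let ?W = "1 - fps_X :: real fps" and ?K = "of_nat (fact (n - 1)) :: real fps"
  have fact: "of_nat (fact n) = of_nat n * ?K" using Suc.hyps by (simp add: fact_reduce)
  have "g \<in> (\<lambda>(p, j). insert_last n p j) ` (perm_set n \<times> {1..Suc n})"
    using bij_betw_imp_surj_on[OF bij_betw_insert_last] Suc.prems by simp
  then obtain p a where pa: "p \<in> perm_set n" "a \<in> {1..Suc n}" "g = insert_last n p a" by auto
  note pp = perm_setD[OF pa(1)]
  show ?case
  proof (cases "a = Suc n")
    case True
    then have gp: "g = p" using pa by simp
    have "Abs_fps (ncycle_sum (Suc n) g) = of_nat n * Abs_fps (ncycle_sum n p)"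
      unfolding gp by (rule fps_ext) (simp add: ncycle_sum_fixed[OF Suc.hyps pa(1)] fps_of_nat[symmetric])
    then have "Abs_fps (ncycle_sum (Suc n) g) * ?W ^ (Suc n + 2) = of_nat n * (Abs_fps (ncycle_sum n p) * ?W ^ (n + 2)) * ?W"
      by (simp add: algebra_simps)
    also have "\<dots> = of_nat n * ?K * fps_X * (cycle_prod fps_X {1..n} p * ?W)"
      unfolding Suc.IH[OF pa(1)] by (simp add: algebra_simps)
    also have "cycle_prod fps_X {1..n} p * ?W = cycle_prod fps_X {1..Suc n} g"
      unfolding cycle_prod_def gp cycles_Suc(1)[OF pa(1)]
      using cycles_Suc(2)[OF pa(1)] finite_cycles[OF pp] by simp
    finally show ?thesis using fact by simp
  next
    case False
    then have a: "a \<in> {1..n}" using pa by auto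
    let ?F = "\<lambda>p. Abs_fps (ncycle_sum n p)"
    let ?t = "\<lambda>j. p \<circ> transpose a j"
    let ?w = "cycle_prod fps_X {1..n} p :: real fps"
    have "Abs_fps (ncycle_sum (Suc n) g) = fps_X * fps_deriv (?F p) + (\<Sum>j\<in>{1..n} - {a}. ?F (?t j))"
    proof (rule fps_ext)
      fix r
      show "fps_nth (Abs_fps (ncycle_sum (Suc n) g)) r =
         fps_nth (fps_X * fps_deriv (?F p) + (\<Sum>j\<in>{1..n} - {a}. ?F (?t j))) r"
        unfolding pa(3) by (cases r)
          (simp_all add: ncycle_sum_insert_last[OF Suc.hyps pa(1) a] fps_sum_nth Suc_eq_plus1[symmetric] del: One_nat_def)
    qed
    moreover have "fps_deriv (?F p) * ?W ^ (n + 3) =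
       ?K * (?W * (?w + fps_X * fps_deriv ?w) + of_nat (n + 2) * fps_X * ?w)"
    proof -
      have "fps_deriv (?F p * ?W ^ (n + 2)) = fps_deriv (?K * fps_X * ?w)"
        unfolding Suc.IH[OF pa(1)] ..
      also have "fps_deriv (?K * fps_X * ?w) = ?K * (?w + fps_X * fps_deriv ?w)"
      proof -
        have "fps_deriv ?K = 0" by (simp add: fps_of_nat[symmetric] del: of_nat_fact)
        then show ?thesis by (simp add: algebra_simps del: of_nat_fact)
      qed
      finally have d1: "fps_deriv (?F p * ?W ^ (n + 2)) = ?K * (?w + fps_X * fps_deriv ?w)" .
      have d2: "fps_deriv (?F p * ?W ^ (n + 2)) * ?W =
         fps_deriv (?F p) * ?W ^ (n + 3) - of_nat (n + 2) * (?F p * ?W ^ (n + 2))"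
      proof -
        have e: "fps_deriv (?W ^ (n + 2)) = - of_nat (n + 2) * ?W ^ (n + 1)"
          unfolding fps_deriv_power by (simp only: fps_of_nat) simp
        have W: "?W ^ (n + 1) * ?W = ?W ^ (n + 2)" "?W ^ (n + 2) * ?W = ?W ^ (n + 3)"
          by (simp_all add: eval_nat_numeral)
        have g: "(F * (- N * w1) + F' * w2) * w = F' * (w2 * w) - N * (F * (w1 * w))"
          for F F' N w1 w2 w :: "real fps" by (simp add: algebra_simps)
        show ?thesis unfolding fps_deriv_mult[of "?F p" "?W ^ (n + 2)"] e by (subst g) (simp only: W)
      qed
      have "a = b * w + N * (k * x * c) \<Longrightarrow> b = k * e \<Longrightarrow> a = k * (w * e + N * x * c)"
        for a b w N k x c e :: "real fps" by (simp add: algebra_simps)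
      then show ?thesis using d2 unfolding Suc.IH[OF pa(1)] d1[unfolded Suc.IH[OF pa(1)]] by (simp only: eq_diff_eq)
    qed
    moreover have "(\<Sum>j\<in>{1..n} - {a}. ?F (?t j)) * ?W ^ (n + 3) =
       ?K * fps_X * (?W * (\<Sum>j\<in>{1..n} - {a}. cycle_prod fps_X {1..n} (?t j)))"
    proof -
      have "?F (?t j) * ?W ^ (n + 3) = ?K * fps_X * (?W * cycle_prod fps_X {1..n} (?t j))" if "j \<in> {1..n} - {a}" for j
      proof -
        have "?t j \<in> perm_set n" using pa(1) a that by (intro perm_set_comp perm_set_transpose) auto
        note IH = Suc.IH[OF this]
        have W: "?W ^ (n + 3) = ?W ^ (n + 2) * ?W" by (simp add: eval_nat_numeral)
        show ?thesis unfolding W mult.assoc[symmetric] IH by (simp only: ac_simps)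
      qed
      then show ?thesis by (simp add: sum_distrib_left sum_distrib_right del: One_nat_def)
    qed
    ultimately have "Abs_fps (ncycle_sum (Suc n) g) * ?W ^ (n + 3) = ?K * fps_X *
       (?W * (?w + fps_X * fps_deriv ?w) + of_nat (n + 2) * fps_X * ?w
        + ?W * (\<Sum>j\<in>{1..n} - {a}. cycle_prod fps_X {1..n} (?t j)))"
      by (simp add: distrib_left distrib_right mult.assoc mult.left_commute del: One_nat_def)
    also have "?W * (?w + fps_X * fps_deriv ?w) + of_nat (n + 2) * fps_X * ?w
        + ?W * (\<Sum>j\<in>{1..n} - {a}. cycle_prod fps_X {1..n} (?t j)) =
        of_nat n * (1 - fps_X ^ Suc (card (orbit p a))) * other_prod fps_X {1..n} p a"
      using cycle_prod_recursion[OF pp _ a, where 'b=real] by simp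
    also have "?K * fps_X * \<dots> = of_nat (fact n) * fps_X * ((1 - fps_X ^ Suc (card (orbit p a))) * other_prod fps_X {1..n} p a)"
      unfolding fact by (simp add: algebra_simps)
    also have "(1 - fps_X ^ Suc (card (orbit p a))) * other_prod fps_X {1..n} p a = cycle_prod fps_X {1..Suc n} g"
    proof -
      have "Suc n \<notin> orbit p a" using permutes_orbit_subset[OF pp a] by auto
      then have c: "card (insert (Suc n) (orbit p a)) = Suc (card (orbit p a))"
        using finite_orbit_p[OF pp] by simp
      show ?thesis
        unfolding cycle_prod_def other_prod_def pa(3) cycles_insert_last(3)[OF pa(1) a]
        using cycles_insert_last(4)[OF pa(1) a] finite_cycles[OF pp] c by simp
    qed
    finally show ?thesis by (simp add: eval_nat_numeral)
  qed
qed

lemma poly_cycle_prod: "poly (cycle_prod [:0, 1:] S g) x = cycle_prod x S g" for x :: "'b::{idom,ring_char_0}"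
  by (simp add: cycle_prod_def poly_prod)

lemma fps_of_poly_cycle_prod: "fps_of_poly (cycle_prod [:0, 1:] S g) = cycle_prod fps_X S g"
  for g :: "'a \<Rightarrow> 'a"
  by (simp add: cycle_prod_def fps_of_poly_prod fps_of_poly_simps)

lemma fps_const_cycle_prod: "fps_const (cycle_prod x S g) = cycle_prod (fps_const x) S g"
proof -
  have "fps_const (\<Prod>A\<in>C. 1 - x ^ card A) = (\<Prod>A\<in>C. 1 - fps_const x ^ card A)" for C :: "'b set set"
    by (induction C rule: infinite_finite_induct)
      (simp_all add: fps_const_mult[symmetric] fps_const_sub[symmetric] fps_const_power[symmetric]
        del: fps_const_mult fps_const_sub fps_const_power)
  then show ?thesis by (simp add: cycle_prod_def)
qed

text \<open>The natural argument has one formal variable for \<open>r\<close> and one for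
  \<open>s\<close>; here they are treated in turn. One average is first replaced by
  \<open>cycle_prod x\<close> at a real number \<open>x\<close>, which leaves a series in a single
  variable. After its coefficient at \<open>s\<close> is taken, \<open>x\<close> itself becomes the
  variable for \<open>r\<close>.\<close>

lemma sum_ncycle_sum_mult:
  assumes n: "n \<ge> 1"
  shows "(\<Sum>g\<in>perm_set n. ncycle_sum n g r * ncycle_sum n g s) =
    fact n * fact (n - 1) ^ 2 * (\<Sum>i<n. real (eul n i r) * real (eul n i s))"
proof -
  let ?W = "1 - fps_X :: real fps" and ?K = "fact (n - 1) :: real" and ?X = "fps_X :: real fps"
  let ?F = "\<lambda>g. Abs_fps (ncycle_sum n g)" and ?C = "\<lambda>i. Abs_fps (\<lambda>r. real (eul n i r))"
  let ?w = "\<lambda>g. cycle_prod fps_X {1..n} g :: real fps"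
  have W0: "?W ^ k \<noteq> 0" for k
  proof -
    have "fps_nth ?W 0 = 1" by simp
    then show ?thesis by (metis fps_zero_nth power_not_zero zero_neq_one)
  qed
  have K: "of_nat (fact k) = fps_const (fact k :: real)" for k
    by (simp add: fps_of_nat[symmetric])
  have C: "fps_X ^ Suc i = ?C i * ?W ^ Suc n" if "i < n" for i
    using eul_fps[OF that, where 'b=real] by simp
  have F: "?F g * ?W ^ (n + 2) = fps_const ?K * ?X * ?w g" if "g \<in> perm_set n" for g
    using ncycle_sum_fps[OF n that] K by simp
  have a: "(\<Sum>g\<in>perm_set n. cycle_prod x {1..n} g * ncycle_sum n g s) =
     ?K * fact n * (1 - x) * (\<Sum>i<n. x ^ i * real (eul n i s))" for x
  proof -
    let ?L = "\<Sum>g\<in>perm_set n. fps_const (cycle_prod x {1..n} g) * ?F g"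
    let ?R = "fps_const (?K * fact n * (1 - x)) * (\<Sum>i<n. fps_const (x ^ i) * ?C i)"
    have "?L * ?W ^ (n + 2) = (\<Sum>g\<in>perm_set n. fps_const (cycle_prod x {1..n} g) * (fps_const ?K * ?X * ?w g))"
      unfolding sum_distrib_right by (rule sum.cong[OF refl]) (simp only: F mult.assoc)
    also have "\<dots> = fps_const ?K * ?X * (\<Sum>g\<in>perm_set n. cycle_prod ?X {1..n} g * cycle_prod (fps_const x) {1..n} g)"
      unfolding sum_distrib_left fps_const_cycle_prod by (simp add: ac_simps)
    also have "\<dots> = fps_const ?K * ?X * (fps_const (fact n) * (?W * (1 - fps_const x) * (\<Sum>i<n. (?X * fps_const x) ^ i)))"
      unfolding sum_cycle_prod_mult[OF n] K ..
    also have "\<dots> = fps_const (?K * fact n * (1 - x)) * ((\<Sum>i<n. fps_const (x ^ i) * fps_X ^ Suc i) * ?W)"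
    proof -
      have "?X * (\<Sum>i<n. (?X * fps_const x) ^ i) = (\<Sum>i<n. fps_const (x ^ i) * fps_X ^ Suc i)"
        unfolding sum_distrib_left by (intro sum.cong refl) (simp add: power_mult_distrib fps_const_power mult.commute mult.left_commute)
      note X = this
      have K: "fps_const (?K * fact n * (1 - x)) = fps_const ?K * (fps_const (fact n) * (1 - fps_const x))"
        by (simp add: mult.assoc)
      have "k * y * (l * (w * m * s)) = (k * (l * m)) * ((y * s) * w)" for k y l w m s :: "real fps"
        by (simp add: algebra_simps)
      then show ?thesis unfolding K X[symmetric] .
    qed
    also have "(\<Sum>i<n. fps_const (x ^ i) * fps_X ^ Suc i) = (\<Sum>i<n. fps_const (x ^ i) * ?C i) * ?W ^ Suc n"
      unfolding sum_distrib_right by (intro sum.cong refl) (simp only: C lessThan_iff mult.assoc)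
    finally have "?L * ?W ^ (n + 2) = ?R * ?W ^ (n + 2)" by (simp add: mult.assoc mult.commute mult.left_commute)
    then have "?L = ?R" using W0[of "n + 2"] by simp
    then have "fps_nth ?L s = fps_nth ?R s" by simp
    then show ?thesis by (simp add: fps_sum_nth)
  qed
  \<comment> \<open>Both sides of \<open>a\<close> are polynomial in \<open>x\<close> and agree at
    every real number, hence agree as polynomials, and \<open>x\<close> may be replaced by
    \<open>fps_X\<close>.\<close>
  have b: "(\<Sum>g\<in>perm_set n. smult (ncycle_sum n g s) (cycle_prod [:0, 1:] {1..n} g)) =
     smult (?K * fact n) ((1 - [:0, 1:]) * (\<Sum>i<n. smult (real (eul n i s)) ([:0, 1:] ^ i)))"
    by (subst poly_eq_poly_eq_iff[symmetric])
      (use a in \<open>simp add: fun_eq_iff poly_sum poly_cycle_prod ac_simps\<close>)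
  have b': "(\<Sum>g\<in>perm_set n. fps_const (ncycle_sum n g s) * ?w g) =
     fps_const (?K * fact n) * (?W * (\<Sum>i<n. fps_const (real (eul n i s)) * ?X ^ i))"
    using arg_cong[OF b, of fps_of_poly]
    by (simp add: fps_of_poly_sum fps_of_poly_smult fps_of_poly_cycle_prod fps_of_poly_mult fps_of_poly_simps)
  let ?L = "\<Sum>g\<in>perm_set n. fps_const (ncycle_sum n g s) * ?F g"
  let ?R = "fps_const (?K * ?K * fact n) * (\<Sum>i<n. fps_const (real (eul n i s)) * ?C i)"
  have "?L * ?W ^ (n + 2) = fps_const ?K * ?X * (\<Sum>g\<in>perm_set n. fps_const (ncycle_sum n g s) * ?w g)"
    unfolding sum_distrib_right sum_distrib_left
    by (rule sum.cong[OF refl]) (simp only: mult.assoc F mult.left_commute)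
  also have "\<dots> = fps_const (?K * ?K * fact n) * ((\<Sum>i<n. fps_const (real (eul n i s)) * ?X ^ Suc i) * ?W)"
  proof -
    have "?X * (\<Sum>i<n. fps_const (real (eul n i s)) * ?X ^ i) = (\<Sum>i<n. fps_const (real (eul n i s)) * ?X ^ Suc i)"
      unfolding sum_distrib_left by (simp add: mult.left_commute)
    note X = this
    have K: "fps_const (?K * ?K * fact n) = fps_const ?K * fps_const (?K * fact n)" by (simp add: mult.assoc)
    have "k * y * (l * (w * s)) = (k * l) * ((y * s) * w)" for k y l w s :: "real fps"
      by (simp add: algebra_simps)
    then show ?thesis unfolding b' K X[symmetric] .
  qed
  also have "(\<Sum>i<n. fps_const (real (eul n i s)) * ?X ^ Suc i) = (\<Sum>i<n. fps_const (real (eul n i s)) * ?C i) * ?W ^ Suc n"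
    unfolding sum_distrib_right by (intro sum.cong refl) (simp only: C lessThan_iff mult.assoc)
  finally have "?L * ?W ^ (n + 2) = ?R * ?W ^ (n + 2)" by (simp add: mult.assoc mult.commute mult.left_commute)
  then have "?L = ?R" using W0[of "n + 2"] by simp
  then have "fps_nth ?L r = fps_nth ?R r" by simp
  then show ?thesis by (simp add: fps_sum_nth power2_eq_square ac_simps)
qed

lemma card_ncycles:
  assumes "n \<ge> 1"
  shows "card (cyc_class n 1) = fact (n - 1)"
  using assms
proof (induction n rule: nat_induct_at_least)
  case base
  have "cycle_count 1 id = 1" by (simp add: cycle_count_eq cycles_singleton_id)
  then have "cyc_class 1 1 = {id}" by (auto simp: cyc_class_def perm_set_1[simplified])
  then show ?case by simp
next
  case (Suc n)
  then show ?case using bij_betw_same_card[OF bij_betw_ncycles[OF Suc.hyps]]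
    by (simp add: card_cartesian_product fact_reduce mult.commute)
qed

section \<open>Multiplication of the descent classes\<close>

text \<open>\<open>rk v\<close> counts the keys up to \<open>K v\<close>. The permutation sought is
  \<open>inv rk\<close>, which lists \<open>1..n\<close> by increasing key, and distinct keys allow
  only one such list.\<close>

lemma rank_perm:
  fixes K :: "nat \<Rightarrow> nat"
  assumes K: "inj_on K {1..n}"
  shows "\<exists>x\<in>perm_set n. (\<forall>v\<in>{1..n}. \<forall>w\<in>{1..n}. inv x v < inv x w \<longleftrightarrow> K v < K w) \<and>
    (\<forall>y\<in>perm_set n. (\<forall>i\<in>{1..<n}. K (y i) < K (y (Suc i))) \<longrightarrow> y = x)"
proof -
  define rk where "rk v = (if v \<in> {1..n} then card {u \<in> {1..n}. K u \<le> K v} else v)" for v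
  have mono: "rk v < rk w" if "v \<in> {1..n}" "w \<in> {1..n}" "K v < K w" for v w
  proof -
    have "{u \<in> {1..n}. K u \<le> K v} \<subseteq> {u \<in> {1..n}. K u \<le> K w}"
      "w \<in> {u \<in> {1..n}. K u \<le> K w} - {u \<in> {1..n}. K u \<le> K v}" using that by auto
    then have "{u \<in> {1..n}. K u \<le> K v} \<subset> {u \<in> {1..n}. K u \<le> K w}" by blast
    then show ?thesis using that psubset_card_mono[of "{u \<in> {1..n}. K u \<le> K w}"] by (simp add: rk_def)
  qed
  have iff: "rk v < rk w \<longleftrightarrow> K v < K w" if "v \<in> {1..n}" "w \<in> {1..n}" for v w
    using mono[OF that] mono[OF that(2,1)] K that by (metis inj_on_eq_iff linorder_less_linear not_less_iff_gr_or_eq)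
  have "rk permutes {1..n}"
  proof (rule inj_imp_permutes)
    show "inj_on rk {1..n}"
      by (rule inj_onI) (metis iff K inj_onD linorder_less_linear nat_neq_iff)
    show "rk v \<in> {1..n}" if "v \<in> {1..n}" for v
    proof -
      have "card {u \<in> {1..n}. K u \<le> K v} \<le> card {1..n}" by (rule card_mono) auto
      moreover have "card {u \<in> {1..n}. K u \<le> K v} > 0" using that by (auto simp: card_gt_0_iff)
      ultimately show ?thesis using that by (simp add: rk_def)
    qed
  qed (auto simp: rk_def)
  note rk = this
  have unique: "y = inv rk" if y: "y \<in> perm_set n" "\<And>i. i \<in> {1..<n} \<Longrightarrow> K (y i) < K (y (Suc i))" for y
  proof -
    note yp = perm_setD[OF y(1)]
    have lt: "K (y i) < K (y j)" if "1 \<le> i" "i < j" "j \<le> n" for i j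
      using that(2,1,3)
    proof (induction j)
      case 0 then show ?case by simp
    next
      case (Suc j)
      then show ?case using y(2)[of j] by (cases "i = j") (auto intro: less_trans)
    qed
    have "rk (y i) = i" if i: "i \<in> {1..n}" for i
    proof -
      have "K (y j) \<le> K (y i) \<longleftrightarrow> j \<le> i" if "j \<in> {1..n}" for j
        using lt[of i j] lt[of j i] i that by (cases "i = j"; cases "i < j") auto
      then have "{j \<in> {1..n}. K (y j) \<le> K (y i)} = {1..i}" using i by auto
      moreover have "{u \<in> y ` {1..n}. K u \<le> K (y i)} = y ` {j \<in> {1..n}. K (y j) \<le> K (y i)}" by auto
      ultimately have "{u \<in> {1..n}. K u \<le> K (y i)} = y ` {1..i}"
        unfolding permutes_image[OF yp] by simp
      then have "rk (y i) = card (y ` {1..i})"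
        using permutes_in_image[OF yp, of i] i by (simp add: rk_def)
      then show ?thesis using permutes_inj_on[OF yp] by (simp add: card_image)
    qed
    moreover have "rk (y i) = i" if "i \<notin> {1..n}" for i
      using that permutes_not_in[OF yp that] permutes_not_in[OF rk that] by simp
    ultimately show ?thesis using permutes_inv_eq[OF rk] by (metis ext)
  qed
  show ?thesis
  proof (intro bexI[of _ "inv rk"] conjI ballI impI)
    show "inv rk \<in> perm_set n" using permutes_inv[OF rk] by (simp add: perm_set_def)
    show "inv (inv rk) v < inv (inv rk) w \<longleftrightarrow> K v < K w" if "v \<in> {1..n}" "w \<in> {1..n}" for v w
      unfolding permutes_inv_inv[OF rk] by (rule iff[OF that])
    show "y = inv rk" if "y \<in> perm_set n" "\<forall>i\<in>{1..<n}. K (y i) < K (y (Suc i))" for y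
      by (rule unique) (use that in auto)
  qed
qed

text \<open>The hockey-stick sum; with \<open>m \<le> n\<close> its starting value
  \<open>m choose Suc n\<close> is zero.\<close>

lemma sum_binomial_shift:
  assumes "m \<le> n"
  shows "(\<Sum>v<r. (v + m) choose n) = (r + m) choose (Suc n)"
  by (induction r) (use assms in \<open>auto simp: binomial_eq_0\<close>)

definition weak_runs :: "nat \<Rightarrow> (nat \<Rightarrow> bool) \<Rightarrow> nat \<Rightarrow> (nat \<Rightarrow> nat) set" where
  "weak_runs n D r = {f \<in> {1..n} \<rightarrow>\<^sub>E {..<r}. \<forall>i\<in>{1..<n}. if D i then f i < f (Suc i) else f i \<le> f (Suc i)}"

lemma weak_runs_mono:
  assumes "f \<in> weak_runs n D r" "1 \<le> i" "i \<le> j" "j \<le> n"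
  shows "f i \<le> f j"
  using assms(3,2,4)
proof (induction j rule: dec_induct)
  case (step j)
  then show ?case using assms(1) by (auto simp: weak_runs_def split: if_splits dest!: bspec[of _ _ j])
qed simp

text \<open>A last letter \<open>v\<close> leaves a word on the letters below \<open>b v\<close>,
  which is \<open>v\<close> before a strict step and \<open>Suc v\<close> before a weak one. The
  hockey-stick sum over \<open>v\<close> does the rest.\<close>

lemma card_weak_runs:
  assumes "n \<ge> 1"
  shows "card (weak_runs n D r) = (r + (n - 1 - card {i \<in> {1..<n}. D i})) choose n"
  using assms
proof (induction n arbitrary: r rule: nat_induct_at_least)
  case base
  have "weak_runs 1 D r = {1} \<rightarrow>\<^sub>E {..<r}" by (simp add: weak_runs_def)
  then show ?case by (simp add: card_PiE)
next
  case (Suc n)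
  define b where "b v = (if D n then v else Suc v)" for v
  define d where "d = card {i \<in> {1..<n}. D i}"
  have d: "d < n"
  proof -
    have "d \<le> card {1..<n}" unfolding d_def by (rule card_mono) auto
    then show ?thesis using Suc.hyps by simp
  qed
  have "bij_betw (\<lambda>(v, f). f(Suc n := v)) (SIGMA v:{..<r}. weak_runs n D (b v)) (weak_runs (Suc n) D r)"
  proof (rule bij_betw_byWitness[where f' = "\<lambda>f. (f (Suc n), restrict f {1..n})"])
    show "\<forall>a\<in>SIGMA v:{..<r}. weak_runs n D (b v). (\<lambda>f. (f (Suc n), restrict f {1..n})) (case a of (v, f) \<Rightarrow> f(Suc n := v)) = a"
      by (auto simp: weak_runs_def fun_eq_iff PiE_def extensional_def)
    show "\<forall>f\<in>weak_runs (Suc n) D r. (case (f (Suc n), restrict f {1..n}) of (v, f) \<Rightarrow> f(Suc n := v)) = f"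
      by (auto simp: weak_runs_def fun_eq_iff PiE_def extensional_def)
    show "(\<lambda>(v, f). f(Suc n := v)) ` (SIGMA v:{..<r}. weak_runs n D (b v)) \<subseteq> weak_runs (Suc n) D r"
    proof clarify
      fix v f assume v: "v < r" and f: "f \<in> weak_runs n D (b v)"
      have fb: "f i < b v" if "i \<in> {1..n}" for i using f that by (auto simp: weak_runs_def)
      then have "f i < r" if "i \<in> {1..n}" for i
        using that v by (fastforce simp: b_def split: if_splits)
      moreover have "f n < b v" using fb Suc.hyps by simp
      ultimately show "f(Suc n := v) \<in> weak_runs (Suc n) D r"
        using f v by (auto simp: weak_runs_def PiE_def extensional_def b_def less_Suc_eq split: if_splits)
    qed
    show "(\<lambda>f. (f (Suc n), restrict f {1..n})) ` weak_runs (Suc n) D r \<subseteq> (SIGMA v:{..<r}. weak_runs n D (b v))"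
    proof clarify
      fix f assume f: "f \<in> weak_runs (Suc n) D r"
      have "if D n then f n < f (Suc n) else f n \<le> f (Suc n)"
        using f Suc.hyps by (auto simp: weak_runs_def)
      then have "f i < b (f (Suc n))" if "i \<in> {1..n}" for i
        using weak_runs_mono[OF f, of i n] that by (auto simp: b_def split: if_splits)
      then show "f (Suc n) \<in> {..<r} \<and> restrict f {1..n} \<in> weak_runs n D (b (f (Suc n)))"
        using f by (auto simp: weak_runs_def)
    qed
  qed
  from bij_betw_same_card[OF this]
  have "card (weak_runs (Suc n) D r) = (\<Sum>v<r. card (weak_runs n D (b v)))"
    by (simp add: card_SigmaI weak_runs_def finite_PiE)
  also have "\<dots> = (\<Sum>v<r. (b v + (n - 1 - d)) choose n)" using Suc.IH by (simp add: d_def)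
  also have "\<dots> = (r + (Suc n - 1 - card {i \<in> {1..<Suc n}. D i})) choose Suc n"
  proof (cases "D n")
    case True
    have "{i \<in> {1..<Suc n}. D i} = insert n {i \<in> {1..<n}. D i}" using True Suc.hyps by auto
    then have "card {i \<in> {1..<Suc n}. D i} = Suc d" by (simp add: d_def)
    then show ?thesis using sum_binomial_shift[of "n - 1 - d" n r] True by (simp add: b_def)
  next
    case False
    have "{i \<in> {1..<Suc n}. D i} = {i \<in> {1..<n}. D i}" using False by (auto simp: less_Suc_eq)
    moreover have "b v + (n - 1 - d) = v + (n - d)" for v using False d by (simp add: b_def)
    ultimately show ?thesis using sum_binomial_shift[of "n - d" n r] by (simp add: d_def)
  qed
  finally show ?case .
qed

text \<open>The pairs \<open>(f i, x i)\<close> increase lexicographically: \<open>f\<close> is a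
  word after sorting and \<open>x\<close> lists the positions its letters came from, ties being kept
  in order of position. A descent of \<open>x\<close> forces a strict step of
  \<open>f\<close>.\<close>

definition compat :: "nat \<Rightarrow> nat \<Rightarrow> (nat \<Rightarrow> nat) \<Rightarrow> (nat \<Rightarrow> nat) set" where
  "compat n r x = {f \<in> {1..n} \<rightarrow>\<^sub>E {..<r}. \<forall>i\<in>{1..<n}. f i < f (Suc i) \<or> f i = f (Suc i) \<and> x i < x (Suc i)}"

lemma finite_compat: "finite (compat n r x)"
  by (simp add: compat_def finite_PiE)

lemma card_compat:
  assumes "n \<ge> 1" "x \<in> perm_set n"
  shows "card (compat n r x) = eul n (des n x) r"
proof -
  have "x i \<noteq> x (Suc i)" for i
    using permutes_inj[OF perm_setD[OF assms(2)]] by (metis injD n_not_Suc_n)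
  then have "f i < f (Suc i) \<or> f i = f (Suc i) \<and> x i < x (Suc i) \<longleftrightarrow>
      (if x i > x (Suc i) then f i < f (Suc i) else f i \<le> f (Suc i))" for i and f :: "nat \<Rightarrow> nat"
    by (metis le_less less_asym linorder_less_linear not_less)
  then have "compat n r x = weak_runs n (\<lambda>i. x i > x (Suc i)) r"
    by (simp add: compat_def weak_runs_def)
  moreover have "{i \<in> {1..<n}. x i > x (Suc i)} = {i. 1 \<le> i \<and> i \<le> n - 1 \<and> x i > x (i + 1)}"
    using assms(1) by auto
  ultimately show ?thesis using card_weak_runs[OF assms(1), of _ r] by (simp add: eul_def des_def)
qed

lemma des_less: "n \<ge> 1 \<Longrightarrow> des n x < n"
proof -
  assume "n \<ge> 1"
  have "des n x \<le> card {1..n - 1}" unfolding des_def by (rule card_mono) auto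
  then show ?thesis using \<open>n \<ge> 1\<close> by simp
qed

lemma lex_encode_less:
  fixes g g' a a' r :: nat
  assumes "a < r" "a' < r"
  shows "g * r + a < g' * r + a' \<longleftrightarrow> g < g' \<or> g = g' \<and> a < a'"
    and "g * r + a = g' * r + a' \<longleftrightarrow> g = g' \<and> a = a'"
proof -
  have lt: "g * r + a < g' * r + a'" if "g < g'" "a < r" for g g' a a' :: nat
  proof -
    have "g * r + a < Suc g * r" using that by simp
    also have "\<dots> \<le> g' * r" using that by (intro mult_le_mono1) simp
    finally show ?thesis by simp
  qed
  show "g * r + a < g' * r + a' \<longleftrightarrow> g < g' \<or> g = g' \<and> a < a'"
    using lt[of g g' a a'] lt[of g' g a' a] assms by (cases "g < g'"; cases "g' < g") auto
  show "g * r + a = g' * r + a' \<longleftrightarrow> g = g' \<and> a = a'"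
    using lt[of g g' a a'] lt[of g' g a' a] assms by (cases "g < g'"; cases "g' < g") auto
qed

lemma sorting_perm:
  fixes a :: "nat \<Rightarrow> nat"
  shows "\<exists>x\<in>perm_set n. (\<forall>v\<in>{1..n}. \<forall>w\<in>{1..n}. inv x v < inv x w \<longleftrightarrow> a v < a w \<or> a v = a w \<and> v < w) \<and>
    (\<forall>y\<in>perm_set n. (\<forall>i\<in>{1..<n}. a (y i) < a (y (Suc i)) \<or> a (y i) = a (y (Suc i)) \<and> y i < y (Suc i)) \<longrightarrow> y = x)"
proof -
  \<comment> \<open>Since \<open>v < Suc n\<close>, the position \<open>v\<close> is the low digit
    in base \<open>Suc n\<close> and breaks ties.\<close>
  define K where "K v = a v * Suc n + v" for v
  have K: "K v < K w \<longleftrightarrow> a v < a w \<or> a v = a w \<and> v < w" "K v = K w \<longleftrightarrow> v = w"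
    if "v \<in> {1..n}" "w \<in> {1..n}" for v w
    unfolding K_def using lex_encode_less[of v "Suc n" w "a v" "a w"] that by auto
  have "inj_on K {1..n}" using K(2) by (auto simp: inj_on_def)
  from rank_perm[OF this] obtain s where s: "s \<in> perm_set n"
      "\<forall>v\<in>{1..n}. \<forall>w\<in>{1..n}. inv s v < inv s w \<longleftrightarrow> K v < K w"
      "\<forall>y\<in>perm_set n. (\<forall>i\<in>{1..<n}. K (y i) < K (y (Suc i))) \<longrightarrow> y = s"
    by blast
  show ?thesis
  proof (intro bexI[of _ s] conjI ballI impI)
    show "inv s v < inv s w \<longleftrightarrow> a v < a w \<or> a v = a w \<and> v < w" if "v \<in> {1..n}" "w \<in> {1..n}" for v w
      unfolding K(1)[OF that, symmetric] using s(2) that by blast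
    fix y assume y: "y \<in> perm_set n"
      and c: "\<forall>i\<in>{1..<n}. a (y i) < a (y (Suc i)) \<or> a (y i) = a (y (Suc i)) \<and> y i < y (Suc i)"
    have "K (y i) < K (y (Suc i))" if i: "i \<in> {1..<n}" for i
      using K(1)[of "y i" "y (Suc i)"] permutes_in_image[OF perm_setD[OF y]] c i by auto
    then show "y = s" using s(3) y by blast
  qed fact
qed

text \<open>The words sorted by \<open>x\<close> are the words \<open>f \<circ> inv x\<close> with \<open>f \<in> compat n r x\<close>.\<close>

definition stable_sort :: "nat \<Rightarrow> (nat \<Rightarrow> nat) \<Rightarrow> nat \<Rightarrow> nat" where
  "stable_sort n a = (SOME s. s \<in> perm_set n \<and>
     (\<forall>v\<in>{1..n}. \<forall>w\<in>{1..n}. inv s v < inv s w \<longleftrightarrow> a v < a w \<or> a v = a w \<and> v < w) \<and>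
     (\<forall>y\<in>perm_set n. (\<forall>i\<in>{1..<n}. a (y i) < a (y (Suc i)) \<or> a (y i) = a (y (Suc i)) \<and> y i < y (Suc i)) \<longrightarrow> y = s))"

lemma stable_sort:
  shows "stable_sort n a \<in> perm_set n"
    and "v \<in> {1..n} \<Longrightarrow> w \<in> {1..n} \<Longrightarrow>
       inv (stable_sort n a) v < inv (stable_sort n a) w \<longleftrightarrow> a v < a w \<or> a v = a w \<and> v < w"
    and "x \<in> perm_set n \<Longrightarrow> restrict (a \<circ> x) {1..n} \<in> compat n r x \<Longrightarrow> x = stable_sort n a"
proof -
  note S = someI_ex[OF sorting_perm[unfolded Bex_def], of n a, folded stable_sort_def]
  show "stable_sort n a \<in> perm_set n"
    and "v \<in> {1..n} \<Longrightarrow> w \<in> {1..n} \<Longrightarrow>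
       inv (stable_sort n a) v < inv (stable_sort n a) w \<longleftrightarrow> a v < a w \<or> a v = a w \<and> v < w"
    using S by blast+
  show "x = stable_sort n a" if x: "x \<in> perm_set n" and c: "restrict (a \<circ> x) {1..n} \<in> compat n r x"
  proof -
    have "\<forall>i\<in>{1..<n}. a (x i) < a (x (Suc i)) \<or> a (x i) = a (x (Suc i)) \<and> x i < x (Suc i)"
      using c by (auto simp: compat_def)
    then show ?thesis using S x by blast
  qed
qed

text \<open>Radix sort. By \<open>card_compat\<close> the left side counts pairs of a word
  \<open>a\<close> on \<open>r\<close> letters, whose stable sort is \<open>x\<close>, and a word
  \<open>g\<close> on \<open>s\<close> letters compatible with \<open>inv x \<circ> z\<close>. Such
  a pair amounts to one word on \<open>r * s\<close> letters compatible with
  \<open>z\<close>.\<close>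

lemma eul_mult:
  assumes n: "n \<ge> 1" and z: "z \<in> perm_set n"
  shows "(\<Sum>x\<in>perm_set n. eul n (des n x) r * eul n (des n (inv x \<circ> z)) s) = eul n (des n z) (r * s)"
proof -
  let ?Fr = "{1..n} \<rightarrow>\<^sub>E {..<r} :: (nat \<Rightarrow> nat) set"
  define st where "st = stable_sort n"
  note st = stable_sort(1)[of n, folded st_def] stable_sort(2,3)[of _ n, folded st_def]
  note zp = perm_setD[OF z]
  have in_img: "x i \<in> {1..n}" if "x \<in> perm_set n" "i \<in> {1..n}" for x i
    using permutes_in_image[OF perm_setD[OF that(1)]] that(2) by simp
  have st_compat: "restrict (a \<circ> st a) {1..n} \<in> compat n r (st a)" if a: "a \<in> ?Fr" for a
  proof -
    note sp = perm_setD[OF st(1)[of a]]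
    have "a (st a i) < a (st a (Suc i)) \<or> a (st a i) = a (st a (Suc i)) \<and> st a i < st a (Suc i)"
      if "i \<in> {1..<n}" for i
      using st(2)[OF in_img[OF st(1)[of a], of i] in_img[OF st(1)[of a], of "Suc i"], of a] that
        permutes_inverses[OF sp] by auto
    moreover have "a (st a i) < r" if "i \<in> {1..n}" for i
      using in_img[OF st(1)[of a] that] a by auto
    ultimately show ?thesis by (auto simp: compat_def)
  qed
  have key: "restrict (restrict (f \<circ> inv x) {1..n} \<circ> x) {1..n} = f"
    and fr: "restrict (f \<circ> inv x) {1..n} \<in> ?Fr"
    if "x \<in> perm_set n" "f \<in> compat n r x" for x f
    using that in_img in_img[OF perm_set_inv[OF that(1)]] permutes_inverses[OF perm_setD[OF that(1)]]
    by (auto simp: fun_eq_iff compat_def PiE_def extensional_def)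
  have st_inv: "st (restrict (f \<circ> inv x) {1..n}) = x" if "x \<in> perm_set n" "f \<in> compat n r x" for x f
    using st(3)[OF that(1), of "restrict (f \<circ> inv x) {1..n}"] key[OF that] that(2) by simp
  have bij1: "bij_betw (\<lambda>(x, f). restrict (f \<circ> inv x) {1..n}) (SIGMA x:perm_set n. compat n r x) ?Fr"
  proof (rule bij_betw_byWitness[where f' = "\<lambda>a. (st a, restrict (a \<circ> st a) {1..n})"])
    show "\<forall>a\<in>SIGMA x:perm_set n. compat n r x. (\<lambda>a. (st a, restrict (a \<circ> st a) {1..n}))
        (case a of (x, f) \<Rightarrow> restrict (f \<circ> inv x) {1..n}) = a"
      using key st_inv by auto
    show "\<forall>a\<in>?Fr. (case (st a, restrict (a \<circ> st a) {1..n}) of (x, f) \<Rightarrow> restrict (f \<circ> inv x) {1..n}) = a"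
    proof
      fix a assume a: "a \<in> ?Fr"
      show "(case (st a, restrict (a \<circ> st a) {1..n}) of (x, f) \<Rightarrow> restrict (f \<circ> inv x) {1..n}) = a"
        using in_img[OF perm_set_inv[OF st(1)[of a]]] permutes_inverses[OF perm_setD[OF st(1)[of a]]] a
        by (auto simp: fun_eq_iff PiE_def extensional_def)
    qed
    show "(\<lambda>(x, f). restrict (f \<circ> inv x) {1..n}) ` (SIGMA x:perm_set n. compat n r x) \<subseteq> ?Fr"
    proof
      fix a assume "a \<in> (\<lambda>(x, f). restrict (f \<circ> inv x) {1..n}) ` (SIGMA x:perm_set n. compat n r x)"
      then obtain x f where "x \<in> perm_set n" "f \<in> compat n r x" "a = restrict (f \<circ> inv x) {1..n}" by auto
      then show "a \<in> ?Fr" by (simp only: fr)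
    qed
    show "(\<lambda>a. (st a, restrict (a \<circ> st a) {1..n})) ` ?Fr \<subseteq> (SIGMA x:perm_set n. compat n r x)"
      using st(1) st_compat by auto
  qed
  have "(\<Sum>x\<in>perm_set n. eul n (des n x) r * eul n (des n (inv x \<circ> z)) s) =
    (\<Sum>x\<in>perm_set n. \<Sum>f\<in>compat n r x. card (compat n s (inv x \<circ> z)))"
    using n z by (intro sum.cong refl) (simp add: card_compat perm_set_comp perm_set_inv)
  also have "\<dots> = (\<Sum>(x, f)\<in>(SIGMA x:perm_set n. compat n r x). card (compat n s (inv x \<circ> z)))"
    by (rule sum.Sigma) (auto simp: finite_compat)
  also have "\<dots> = (\<Sum>(x, f)\<in>(SIGMA x:perm_set n. compat n r x).
      card (compat n s (inv (st (restrict (f \<circ> inv x) {1..n})) \<circ> z)))"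
    by (intro sum.cong refl) (auto simp: st_inv[unfolded One_nat_def])
  also have "\<dots> = (\<Sum>a\<in>?Fr. card (compat n s (inv (st a) \<circ> z)))"
    by (subst sum.reindex_bij_betw[OF bij1, symmetric]) (simp add: case_prod_unfold)
  also have "\<dots> = card (SIGMA a:?Fr. compat n s (inv (st a) \<circ> z))"
    by (simp add: card_SigmaI finite_PiE finite_compat)
  also have "\<dots> = card (compat n (r * s) z)"
  proof -
    \<comment> \<open>In base \<open>r\<close>, the high digit is \<open>g i\<close> and the low
      digit is \<open>a (z i)\<close>.\<close>
    let ?f = "\<lambda>(a, g). restrict (\<lambda>i. g i * r + a (z i)) {1..n}"
    let ?f' = "\<lambda>h. (restrict (\<lambda>v. h (inv z v) mod r) {1..n}, restrict (\<lambda>i. h i div r) {1..n})"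
    \<comment> \<open>For \<open>g i = g (Suc i)\<close> the left side compares \<open>z i\<close>
      and \<open>z (Suc i)\<close> in the list sorted by \<open>a\<close>, that is, first by
      \<open>a\<close> and then by position. This is the comparison of the low digits with its tie
      rule.\<close>
    have iff: "(\<forall>i\<in>{1..<n}. g i < g (Suc i) \<or> g i = g (Suc i) \<and> (inv (st a) \<circ> z) i < (inv (st a) \<circ> z) (Suc i)) \<longleftrightarrow>
      (\<forall>i\<in>{1..<n}. g i * r + a (z i) < g (Suc i) * r + a (z (Suc i)) \<or>
         g i * r + a (z i) = g (Suc i) * r + a (z (Suc i)) \<and> z i < z (Suc i))"
      if a: "a \<in> ?Fr" for a g
    proof (rule ball_cong[OF refl])
      fix i assume "i \<in> {1..<n}"
      then have i: "z i \<in> {1..n}" "z (Suc i) \<in> {1..n}" using in_img[OF z] by auto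
      then have "a (z i) < r" "a (z (Suc i)) < r" using a by auto
      note l = lex_encode_less[OF this, of "g i" "g (Suc i)"]
      show "(g i < g (Suc i) \<or> g i = g (Suc i) \<and> (inv (st a) \<circ> z) i < (inv (st a) \<circ> z) (Suc i)) =
         (g i * r + a (z i) < g (Suc i) * r + a (z (Suc i)) \<or>
         g i * r + a (z i) = g (Suc i) * r + a (z (Suc i)) \<and> z i < z (Suc i))"
        unfolding l using st(2)[OF i, of a] by auto
    qed
    have "bij_betw ?f (SIGMA a:?Fr. compat n s (inv (st a) \<circ> z)) (compat n (r * s) z)"
    proof (rule bij_betw_byWitness[where f' = ?f'])
      show "\<forall>a\<in>SIGMA a:?Fr. compat n s (inv (st a) \<circ> z). ?f' (?f a) = a"
      proof
        fix x assume "x \<in> (SIGMA a:?Fr. compat n s (inv (st a) \<circ> z))"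
        then obtain a g where x: "x = (a, g)" and a: "a \<in> ?Fr" and g: "g \<in> compat n s (inv (st a) \<circ> z)"
          by blast
        have ar: "a v < r" if "v \<in> {1..n}" for v using a that by auto
        have "restrict (\<lambda>v. (?f (a, g)) (inv z v) mod r) {1..n} = a"
          using ar in_img[OF perm_set_inv[OF z]] permutes_inverses[OF zp] a
          by (auto simp: fun_eq_iff PiE_def extensional_def)
        moreover have "restrict (\<lambda>i. (?f (a, g)) i div r) {1..n} = g"
        proof
          fix i show "restrict (\<lambda>i. (?f (a, g)) i div r) {1..n} i = g i"
          proof (cases "i \<in> {1..n}")
            case True
            then have "a (z i) < r" using ar in_img[OF z] by simp
            then show ?thesis using True by simp
          next
            case False
            then show ?thesis using g by (auto simp: compat_def PiE_def extensional_def)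
          qed
        qed
        ultimately show "?f' (?f x) = x" by (simp add: x)
      qed
      show "\<forall>h\<in>compat n (r * s) z. ?f (?f' h) = h"
        using in_img[OF z] permutes_inverses[OF zp]
        by (auto simp: fun_eq_iff compat_def PiE_def extensional_def)
      show "?f ` (SIGMA a:?Fr. compat n s (inv (st a) \<circ> z)) \<subseteq> compat n (r * s) z"
      proof clarify
        fix a g assume a: "a \<in> ?Fr" and g: "g \<in> compat n s (inv (st a) \<circ> z)"
        have lt: "g i * r + a (z i) < r * s" if "i \<in> {1..n}" for i
        proof -
          have "a (z i) < r" "g i < s" using a g in_img[OF z that] that by (auto simp: compat_def)
          then have "g i * r + a (z i) < Suc (g i) * r" by simp
          also have "\<dots> \<le> s * r" using \<open>g i < s\<close> by (intro mult_le_mono1) simp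
          finally show ?thesis by (simp add: mult.commute)
        qed
        then show "restrict (\<lambda>i. g i * r + a (z i)) {1..n} \<in> compat n (r * s) z"
          using g iff[OF a, of g] unfolding compat_def by auto
      qed
      show "?f' ` compat n (r * s) z \<subseteq> (SIGMA a:?Fr. compat n s (inv (st a) \<circ> z))"
      proof clarify
        fix h assume h: "h \<in> compat n (r * s) z"
        have hlt: "h i < r * s" if "i \<in> {1..n}" for i using h that by (auto simp: compat_def)
        \<comment> \<open>A word exists and has a letter because \<open>n \<ge> 1\<close>, so
          \<open>r * s > 0\<close>; only then are remainders modulo \<open>r\<close>
          letters.\<close>
        then have r: "r > 0" using n by (metis atLeastAtMost_iff le_refl gr0I less_nat_zero_code mult_is_0)
        let ?a = "restrict (\<lambda>v. h (inv z v) mod r) {1..n}" and ?g = "restrict (\<lambda>i. h i div r) {1..n}"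
        have a: "?a \<in> ?Fr" using r by auto
        have e: "?g i * r + ?a (z i) = h i" if "i \<in> {1..n}" for i
          using that in_img[OF z that] permutes_inverses[OF zp] by simp
        have "\<forall>i\<in>{1..<n}. ?g i < ?g (Suc i) \<or> ?g i = ?g (Suc i) \<and> (inv (st ?a) \<circ> z) i < (inv (st ?a) \<circ> z) (Suc i)"
          unfolding iff[OF a]
        proof
          fix i assume i: "i \<in> {1..<n}"
          then show "?g i * r + ?a (z i) < ?g (Suc i) * r + ?a (z (Suc i)) \<or>
              ?g i * r + ?a (z i) = ?g (Suc i) * r + ?a (z (Suc i)) \<and> z i < z (Suc i)"
            using e[of i] e[of "Suc i"] h by (auto simp: compat_def)
        qed
        moreover have "?g \<in> {1..n} \<rightarrow>\<^sub>E {..<s}"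
          using hlt by (auto simp: less_mult_imp_div_less mult.commute)
        ultimately have "?g \<in> compat n s (inv (st ?a) \<circ> z)" unfolding compat_def by blast
        then show "?a \<in> ?Fr \<and> ?g \<in> compat n s (inv (st ?a) \<circ> z)" using a by blast
      qed
    qed
    then show ?thesis by (rule bij_betw_same_card)
  qed
  also have "\<dots> = eul n (des n z) (r * s)" by (rule card_compat[OF n z])
  finally show ?thesis .
qed

section \<open>The inner product\<close>

text \<open>At \<open>r = k + 1\<close> the matrix is unitriangular: \<open>eul n i (k + 1)\<close>
  is 1 for \<open>i = k\<close> and 0 for \<open>i > k\<close>. Row \<open>k\<close> of the inverse
  is found by eliminating with the earlier rows.\<close>

lemma eul_inverse:
  "\<exists>m :: nat \<Rightarrow> nat \<Rightarrow> real. \<forall>k<n. \<forall>i<n. (\<Sum>r=1..n. m k r * real (eul n i r)) = (if i = k then 1 else 0)"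
proof -
  have "\<exists>m :: nat \<Rightarrow> real. \<forall>i<n. (\<Sum>r=1..n. m r * real (eul n i r)) = (if i = k then 1 else 0)" if "k < n" for k
    using that
  proof (induction k rule: less_induct)
    case (less k)
    then have "\<forall>j. \<exists>m :: nat \<Rightarrow> real. j < k \<longrightarrow> (\<forall>i<n. (\<Sum>r=1..n. m r * real (eul n i r)) = (if i = j then 1 else 0))"
      by (meson less_trans)
    then obtain M :: "nat \<Rightarrow> nat \<Rightarrow> real" where
      M: "\<And>j i. j < k \<Longrightarrow> i < n \<Longrightarrow> (\<Sum>r=1..n. M j r * real (eul n i r)) = (if i = j then 1 else 0)"
      by metis
    define m where "m r = (if r = Suc k then 1 else 0) - (\<Sum>j<k. real (eul n j (Suc k)) * M j r)" for r
    have "(\<Sum>r=1..n. m r * real (eul n i r)) = (if i = k then 1 else 0)" if i: "i < n" for i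
    proof -
      have "(\<Sum>r=1..n. m r * real (eul n i r)) =
         (\<Sum>r=1..n. if r = Suc k then real (eul n i r) else 0) -
         (\<Sum>r=1..n. \<Sum>j<k. real (eul n j (Suc k)) * (M j r * real (eul n i r)))"
        unfolding sum_subtractf[symmetric]
        by (intro sum.cong refl) (auto simp: m_def left_diff_distrib sum_distrib_right mult.assoc)
      also have "(\<Sum>r=1..n. if r = Suc k then real (eul n i r) else 0) = real (eul n i (Suc k))"
        using less.prems by (simp add: sum.delta)
      also have "(\<Sum>r=1..n. \<Sum>j<k. real (eul n j (Suc k)) * (M j r * real (eul n i r))) =
         (\<Sum>j<k. real (eul n j (Suc k)) * (\<Sum>r=1..n. M j r * real (eul n i r)))"
        unfolding sum_distrib_left by (rule sum.swap)
      also have "\<dots> = (\<Sum>j<k. if i = j then real (eul n j (Suc k)) else 0)"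
        using i by (intro sum.cong refl) (simp add: M[unfolded One_nat_def])
      also have "\<dots> = (if i < k then real (eul n i (Suc k)) else 0)"
        by (simp add: sum.delta)
      finally have e: "(\<Sum>r=1..n. m r * real (eul n i r)) =
        real (eul n i (Suc k)) - (if i < k then real (eul n i (Suc k)) else 0)" .
      have "eul n i (Suc k) = (if i = k then 1 else 0)" if "\<not> i < k"
      proof (cases "i = k")
        case True
        then have "Suc k + (n - 1 - i) = n" using i by simp
        then show ?thesis using True by (simp only: eul_def) simp
      next
        case False
        then have "Suc k + (n - 1 - i) < n" using i that by simp
        then show ?thesis using False by (simp only: eul_def binomial_eq_0) simp
      qed
      then show ?thesis using e by auto
    qed
    then show ?case by blast
  qed
  then have "\<forall>k. \<exists>m :: nat \<Rightarrow> real. k < n \<longrightarrow> (\<forall>i<n. (\<Sum>r=1..n. m r * real (eul n i r)) = (if i = k then 1 else 0))"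
    by blast
  from choice[OF this] show ?thesis by blast
qed

lemma sum_swap3:
  "(\<Sum>a\<in>A. \<Sum>b\<in>B. \<Sum>c\<in>C. f a b c) = (\<Sum>c\<in>C. \<Sum>a\<in>A. \<Sum>b\<in>B. f a b c)"
proof -
  have "(\<Sum>a\<in>A. \<Sum>b\<in>B. \<Sum>c\<in>C. f a b c) = (\<Sum>a\<in>A. \<Sum>c\<in>C. \<Sum>b\<in>B. f a b c)"
    by (intro sum.cong refl sum.swap)
  also have "\<dots> = (\<Sum>c\<in>C. \<Sum>a\<in>A. \<Sum>b\<in>B. f a b c)" by (rule sum.swap)
  finally show ?thesis .
qed

lemma cycle_count_range:
  assumes "n \<ge> 1" "p \<in> perm_set n"
  shows "cycle_count n p \<in> {1..n}"
proof -
  have "cycle_count n p \<le> card {1..n}" unfolding cycle_count_def by (rule card_image_le) simp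
  moreover have "cycle_count n p > 0" using assms by (auto simp: cycle_count_def card_gt_0_iff)
  ultimately show ?thesis by simp
qed

lemma inv_comp_mem_cyc_class:
  assumes "\<sigma> \<in> perm_set n"
  shows "g \<in> (\<lambda>x. \<sigma> \<circ> x) ` cyc_class n i \<longleftrightarrow> g \<in> perm_set n \<and> cycle_count n (inv \<sigma> \<circ> g) = i"
proof
  note s = permutes_inv_o[OF perm_setD[OF assms]]
  show "g \<in> perm_set n \<and> cycle_count n (inv \<sigma> \<circ> g) = i" if "g \<in> (\<lambda>x. \<sigma> \<circ> x) ` cyc_class n i"
    using that assms by (auto simp: cyc_class_def comp_assoc[symmetric] s intro: perm_set_comp)
  show "g \<in> (\<lambda>x. \<sigma> \<circ> x) ` cyc_class n i" if "g \<in> perm_set n \<and> cycle_count n (inv \<sigma> \<circ> g) = i"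
    using that assms by (intro image_eqI[of _ _ "inv \<sigma> \<circ> g"])
      (auto simp: cyc_class_def comp_assoc[symmetric] s intro: perm_set_comp perm_set_inv)
qed

lemma class_value_eq:
  assumes "\<And>p. p \<in> perm_set n \<Longrightarrow> \<theta> p = t (cycle_count n p)" "cyc_class n i \<noteq> {}"
  shows "class_value n \<theta> i = t i"
  unfolding class_value_def
  by (rule the_equality) (use assms in \<open>auto simp: cyc_class_def\<close>)

text \<open>Once the overlap is counted by permutations \<open>g\<close>, the sums over
  \<open>i\<close> and \<open>j\<close> merely evaluate \<open>\<theta>\<close> and
  \<open>\<psi>\<close> at \<open>inv \<sigma> \<circ> g\<close> and
  \<open>inv \<tau> \<circ> g\<close>. The square of \<open>fact (n - 1)\<close> is the number of
  pairs of n-cycles.\<close>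

lemma cf_inner_eq:
  assumes n: "n \<ge> 1"
    and \<theta>: "\<And>p. p \<in> perm_set n \<Longrightarrow> \<theta> p = t (cycle_count n p)"
    and \<psi>: "\<And>p. p \<in> perm_set n \<Longrightarrow> \<psi> p = u (cycle_count n p)"
  shows "cf_inner n \<theta> \<psi> = 1 / (fact n * (fact (n - 1))\<^sup>2) *
     (\<Sum>g\<in>perm_set n. (\<Sum>\<sigma>\<in>cyc_class n 1. \<theta> (inv \<sigma> \<circ> g)) * cnj (\<Sum>\<tau>\<in>cyc_class n 1. \<psi> (inv \<tau> \<circ> g)))"
proof -
  let ?C = "cyc_class n 1"
  have fC: "finite (cyc_class n i)" for i by (rule finite_subset[OF cyc_class_subset]) simp
  have Cne: "?C \<noteq> {}" using card_ncycles[OF n] by (metis card.empty fact_nonzero)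
  define ov where "ov i j \<sigma> \<tau> = card ((\<lambda>x. \<sigma> \<circ> x) ` cyc_class n i \<inter> (\<lambda>x. \<tau> \<circ> x) ` cyc_class n j)" for i j and \<sigma> \<tau> :: "nat \<Rightarrow> nat"
  have E: "expected_overlap n i j = (\<Sum>\<sigma>\<in>?C. \<Sum>\<tau>\<in>?C. real (ov i j \<sigma> \<tau>)) / (fact (n - 1))\<^sup>2" for i j
  proof -
    have "pair_pmf (pmf_of_set ?C) (pmf_of_set ?C) = pmf_of_set (?C \<times> ?C)"
    proof (rule pmf_eqI)
      fix x :: "(nat \<Rightarrow> nat) \<times> (nat \<Rightarrow> nat)"
      obtain a b where x: "x = (a, b)" by (cases x)
      have ne: "?C \<times> ?C \<noteq> {}" and fin: "finite (?C \<times> ?C)" using fC Cne by simp_all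
      show "pmf (pair_pmf (pmf_of_set ?C) (pmf_of_set ?C)) x = pmf (pmf_of_set (?C \<times> ?C)) x"
        unfolding x pmf_pair pmf_of_set[OF Cne fC] pmf_of_set[OF ne fin] card_cartesian_product
        by (simp add: indicator_def del: One_nat_def)
    qed
    then have "expected_overlap n i j = (\<Sum>(\<sigma>, \<tau>)\<in>?C \<times> ?C. real (ov i j \<sigma> \<tau>)) / real (card (?C \<times> ?C))"
      unfolding expected_overlap_def ov_def using fC Cne
      by (simp add: integral_pmf_of_set case_prod_unfold)
    then show ?thesis
      using card_ncycles[OF n] by (simp add: sum.cartesian_product card_cartesian_product power2_eq_square)
  qed
  \<comment> \<open>On an empty class \<open>class_value\<close> is unspecified, but the overlap
    vanishes there, so the values \<open>t i\<close> and \<open>u j\<close> may be used in every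
    summand.\<close>
  have ov0: "ov i j \<sigma> \<tau> = 0" if "cyc_class n i = {} \<or> cyc_class n j = {}" for i j \<sigma> \<tau>
    using that by (auto simp: ov_def)
  have summand: "class_value n \<theta> i * cnj (class_value n \<psi> j) * of_real (expected_overlap n i j) =
     t i * cnj (u j) * (\<Sum>\<sigma>\<in>?C. \<Sum>\<tau>\<in>?C. of_nat (ov i j \<sigma> \<tau>)) / (fact (n - 1))\<^sup>2" for i j
  proof (cases "cyc_class n i = {} \<or> cyc_class n j = {}")
    case True
    then show ?thesis by (simp add: E ov0)
  next
    case False
    then have "class_value n \<theta> i = t i" "class_value n \<psi> j = u j"
      using class_value_eq[of n \<theta> t i, OF \<theta>] class_value_eq[of n \<psi> u j, OF \<psi>] by auto
    then show ?thesis by (simp add: E)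
  qed
  have sum_ij: "(\<Sum>i=1..n. \<Sum>j=1..n. t i * cnj (u j) * of_nat (ov i j \<sigma> \<tau>)) =
     (\<Sum>g\<in>perm_set n. \<theta> (inv \<sigma> \<circ> g) * cnj (\<psi> (inv \<tau> \<circ> g)))" if st: "\<sigma> \<in> ?C" "\<tau> \<in> ?C" for \<sigma> \<tau>
  proof -
    have s: "\<sigma> \<in> perm_set n" "\<tau> \<in> perm_set n" using st by (auto simp: cyc_class_def)
    let ?a = "\<lambda>g. cycle_count n (inv \<sigma> \<circ> g)" and ?b = "\<lambda>g. cycle_count n (inv \<tau> \<circ> g)"
    have mem: "inv \<sigma> \<circ> g \<in> perm_set n" "inv \<tau> \<circ> g \<in> perm_set n" if "g \<in> perm_set n" for g
      using that s by (auto intro: perm_set_comp perm_set_inv)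
    have ov: "ov i j \<sigma> \<tau> = card {g \<in> perm_set n. ?a g = i \<and> ?b g = j}" for i j
    proof -
      have "(\<lambda>x. \<sigma> \<circ> x) ` cyc_class n i \<inter> (\<lambda>x. \<tau> \<circ> x) ` cyc_class n j = {g \<in> perm_set n. ?a g = i \<and> ?b g = j}"
        by (rule set_eqI, simp only: Int_iff inv_comp_mem_cyc_class[OF s(1)] inv_comp_mem_cyc_class[OF s(2)]) blast
      then show ?thesis by (simp only: ov_def)
    qed
    have "t i * cnj (u j) * of_nat (ov i j \<sigma> \<tau>) =
       (\<Sum>g\<in>perm_set n. if ?a g = i then if ?b g = j then t i * cnj (u j) else 0 else 0)" for i j
    proof -
      have "t i * cnj (u j) * of_nat (ov i j \<sigma> \<tau>) = (\<Sum>g\<in>{g \<in> perm_set n. ?a g = i \<and> ?b g = j}. t i * cnj (u j))"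
        unfolding ov by simp
      also have "\<dots> = (\<Sum>g\<in>perm_set n. if ?a g = i \<and> ?b g = j then t i * cnj (u j) else 0)"
        by (rule sum.inter_filter) simp
      finally show ?thesis by (simp add: if_if_eq_conj)
    qed
    then have "(\<Sum>i=1..n. \<Sum>j=1..n. t i * cnj (u j) * of_nat (ov i j \<sigma> \<tau>)) =
      (\<Sum>i=1..n. \<Sum>j=1..n. \<Sum>g\<in>perm_set n. if ?a g = i then if ?b g = j then t i * cnj (u j) else 0 else 0)"
      by simp
    also have "\<dots> = (\<Sum>g\<in>perm_set n. \<Sum>i=1..n. \<Sum>j=1..n. if ?a g = i then if ?b g = j then t i * cnj (u j) else 0 else 0)"
      by (rule sum_swap3)
    also have "\<dots> = (\<Sum>g\<in>perm_set n. t (?a g) * cnj (u (?b g)))"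
    proof (rule sum.cong[OF refl])
      fix g assume g: "g \<in> perm_set n"
      have "(\<Sum>j=1..n. if ?a g = i then if ?b g = j then t i * cnj (u j) else 0 else 0) =
         (if ?a g = i then t i * cnj (u (?b g)) else 0)" for i
        using cycle_count_range[OF n mem(2)[OF g]] by (simp add: sum.delta)
      then show "(\<Sum>i=1..n. \<Sum>j=1..n. if ?a g = i then if ?b g = j then t i * cnj (u j) else 0 else 0) = t (?a g) * cnj (u (?b g))"
        using cycle_count_range[OF n mem(1)[OF g]] by (simp add: sum.delta)
    qed
    finally show ?thesis using mem by (simp add: \<theta> \<psi>)
  qed
  have "(\<Sum>i=1..n. \<Sum>j=1..n. class_value n \<theta> i * cnj (class_value n \<psi> j) * of_real (expected_overlap n i j)) =
     (\<Sum>i=1..n. \<Sum>j=1..n. \<Sum>\<sigma>\<in>?C. \<Sum>\<tau>\<in>?C. t i * cnj (u j) * of_nat (ov i j \<sigma> \<tau>)) / (fact (n - 1))\<^sup>2"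
    unfolding summand by (simp add: sum_divide_distrib sum_distrib_left)
  also have "(\<Sum>i=1..n. \<Sum>j=1..n. \<Sum>\<sigma>\<in>?C. \<Sum>\<tau>\<in>?C. t i * cnj (u j) * of_nat (ov i j \<sigma> \<tau>)) =
     (\<Sum>\<sigma>\<in>?C. \<Sum>\<tau>\<in>?C. \<Sum>i=1..n. \<Sum>j=1..n. t i * cnj (u j) * of_nat (ov i j \<sigma> \<tau>))"
    by (subst sum_swap3) (intro sum.cong refl sum_swap3)
  also have "\<dots> = (\<Sum>\<sigma>\<in>?C. \<Sum>\<tau>\<in>?C. \<Sum>g\<in>perm_set n. \<theta> (inv \<sigma> \<circ> g) * cnj (\<psi> (inv \<tau> \<circ> g)))"
    by (intro sum.cong refl) (rule sum_ij)
  also have "\<dots> = (\<Sum>g\<in>perm_set n. \<Sum>\<sigma>\<in>?C. \<Sum>\<tau>\<in>?C. \<theta> (inv \<sigma> \<circ> g) * cnj (\<psi> (inv \<tau> \<circ> g)))"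
    by (rule sum_swap3)
  also have "\<dots> = (\<Sum>g\<in>perm_set n. (\<Sum>\<sigma>\<in>?C. \<theta> (inv \<sigma> \<circ> g)) * cnj (\<Sum>\<tau>\<in>?C. \<psi> (inv \<tau> \<circ> g)))"
    by (simp add: sum_product cnj_sum)
  finally show ?thesis unfolding cf_inner_def
    by (simp add: perm_set_def card_permutations)
qed

text \<open>Stated for any family \<open>\<phi>\<close> with the Worpitzky identity. The inverse
  matrix \<open>m\<close> writes each \<open>\<phi> e\<close> in powers
  \<open>r ^ cycle_count n p\<close>, and the product of such powers for \<open>r\<close> and
  \<open>s\<close> is the power for \<open>r * s\<close>. Its pairing with \<open>\<phi> k\<close>
  is \<open>eul n k (r * s)\<close>, which \<open>eul_mult\<close> expands over \<open>x\<close>;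
  then \<open>m\<close> turns the two factors into indicators of \<open>des n x = i\<close> and
  \<open>des n (inv x \<circ> z) = j\<close>.\<close>

lemma cf_inner_of_worpitzky:
  assumes n: "n \<ge> 1" and ijk: "i < n" "j < n" "k < n"
    and W: "\<And>r p. p \<in> perm_set n \<Longrightarrow> of_nat r ^ cycle_count n p = (\<Sum>e<n. of_nat (eul n e r) * \<phi> e p)"
    and z: "z \<in> perm_set n" "des n z = k"
  shows "cf_inner n (\<lambda>\<pi>. \<phi> i \<pi> * \<phi> j \<pi>) (\<phi> k) =
    of_nat (card {(x, y). x \<in> perm_set n \<and> y \<in> perm_set n \<and> des n x = i \<and> des n y = j \<and> x \<circ> y = z})"
proof -
  obtain m :: "nat \<Rightarrow> nat \<Rightarrow> real" where
    m: "\<And>k i. k < n \<Longrightarrow> i < n \<Longrightarrow> (\<Sum>r=1..n. m k r * real (eul n i r)) = (if i = k then 1 else 0)"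
    using eul_inverse[of n] by blast
  let ?m = "\<lambda>k r. complex_of_real (m k r)"
  have mc: "(\<Sum>r=1..n. ?m k r * of_nat (eul n i r)) = (if i = k then 1 else 0)" if "k < n" "i < n" for k i
  proof -
    have e: "(\<Sum>r=1..n. ?m k r * of_nat (eul n i r)) = of_real (\<Sum>r=1..n. m k r * real (eul n i r))" by simp
    show ?thesis unfolding e m[OF that] by simp
  qed
  have phi: "\<phi> e p = (\<Sum>r=1..n. ?m e r * of_nat r ^ cycle_count n p)" if "e < n" "p \<in> perm_set n" for e p
  proof -
    have "(\<Sum>r=1..n. ?m e r * of_nat r ^ cycle_count n p) =
       (\<Sum>r=1..n. \<Sum>e'<n. ?m e r * of_nat (eul n e' r) * \<phi> e' p)"
      by (simp add: W[OF that(2)] sum_distrib_left mult.assoc)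
    also have "\<dots> = (\<Sum>e'<n. \<Sum>r=1..n. ?m e r * of_nat (eul n e' r) * \<phi> e' p)" by (rule sum.swap)
    also have "\<dots> = (\<Sum>e'<n. (if e' = e then \<phi> e' p else 0))"
      by (intro sum.cong refl) (simp add: sum_distrib_right[symmetric] mc[OF that(1), unfolded One_nat_def])
    finally show ?thesis using that by (simp add: sum.delta)
  qed
  let ?C = "cyc_class n 1"
  let ?A = "\<lambda>g r. complex_of_real (ncycle_sum n g r)"
  have A: "(\<Sum>\<sigma>\<in>?C. of_nat r ^ cycle_count n (inv \<sigma> \<circ> g)) = ?A g r" for g r
    by (simp add: ncycle_sum_def)
  have mem: "inv \<sigma> \<circ> g \<in> perm_set n" if "g \<in> perm_set n" "\<sigma> \<in> ?C" for \<sigma> g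
    using that by (auto simp: cyc_class_def intro: perm_set_comp perm_set_inv)
  have S1: "(\<Sum>\<sigma>\<in>?C. \<phi> i (inv \<sigma> \<circ> g) * \<phi> j (inv \<sigma> \<circ> g)) = (\<Sum>r=1..n. \<Sum>s=1..n. ?m i r * ?m j s * ?A g (r * s))"
    if g: "g \<in> perm_set n" for g
  proof -
    have "(\<Sum>\<sigma>\<in>?C. \<phi> i (inv \<sigma> \<circ> g) * \<phi> j (inv \<sigma> \<circ> g)) =
      (\<Sum>\<sigma>\<in>?C. \<Sum>r=1..n. \<Sum>s=1..n. ?m i r * ?m j s * of_nat (r * s) ^ cycle_count n (inv \<sigma> \<circ> g))"
      using ijk by (intro sum.cong refl) (simp add: phi mem[OF g] sum_product power_mult_distrib ac_simps)
    also have "\<dots> = (\<Sum>r=1..n. \<Sum>s=1..n. \<Sum>\<sigma>\<in>?C. ?m i r * ?m j s * of_nat (r * s) ^ cycle_count n (inv \<sigma> \<circ> g))"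
      by (rule sum_swap3[symmetric])
    also have "\<dots> = (\<Sum>r=1..n. \<Sum>s=1..n. ?m i r * ?m j s * ?A g (r * s))"
      unfolding A[symmetric] sum_distrib_left ..
    finally show ?thesis .
  qed
  \<comment> \<open>The coefficients \<open>m\<close> and the sums over n-cycles are real, so the
    conjugation disappears.\<close>
  have S2: "cnj (\<Sum>\<tau>\<in>?C. \<phi> k (inv \<tau> \<circ> g)) = (\<Sum>t=1..n. ?m k t * ?A g t)" if g: "g \<in> perm_set n" for g
  proof -
    have "(\<Sum>\<tau>\<in>?C. \<phi> k (inv \<tau> \<circ> g)) = (\<Sum>\<tau>\<in>?C. \<Sum>t=1..n. ?m k t * of_nat t ^ cycle_count n (inv \<tau> \<circ> g))"
      using ijk by (intro sum.cong refl) (simp add: phi mem[OF g])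
    also have "\<dots> = (\<Sum>t=1..n. ?m k t * ?A g t)"
      unfolding A[symmetric] sum_distrib_left by (rule sum.swap)
    finally show ?thesis by (simp add: cnj_sum)
  qed
  let ?N = "fact n * (fact (n - 1))\<^sup>2 :: complex"
  have orth: "(\<Sum>g\<in>perm_set n. ?A g r * ?A g t) = ?N * (\<Sum>l<n. of_nat (eul n l r) * of_nat (eul n l t))" for r t
    using arg_cong[OF sum_ncycle_sum_mult[OF n, of r t], of complex_of_real] by (simp add: mult.assoc)
  \<comment> \<open>By orthogonality, pairing with \<open>\<phi> k\<close> extracts the coefficient
    of index \<open>k\<close> from the Worpitzky expansion for \<open>r\<close>.\<close>
  have P: "(\<Sum>g\<in>perm_set n. ?A g r * (\<Sum>t=1..n. ?m k t * ?A g t)) = ?N * of_nat (eul n k r)" for r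
  proof -
    have "(\<Sum>g\<in>perm_set n. ?A g r * (\<Sum>t=1..n. ?m k t * ?A g t)) =
      (\<Sum>g\<in>perm_set n. \<Sum>t=1..n. ?m k t * (?A g r * ?A g t))"
      by (simp add: sum_distrib_left ac_simps)
    also have "\<dots> = (\<Sum>t=1..n. ?m k t * (\<Sum>g\<in>perm_set n. ?A g r * ?A g t))"
      unfolding sum_distrib_left by (rule sum.swap)
    also have "\<dots> = ?N * (\<Sum>t=1..n. \<Sum>l<n. of_nat (eul n l r) * (?m k t * of_nat (eul n l t)))"
      unfolding orth by (simp add: sum_distrib_left ac_simps)
    also have "(\<Sum>t=1..n. \<Sum>l<n. of_nat (eul n l r) * (?m k t * of_nat (eul n l t))) =
       (\<Sum>l<n. of_nat (eul n l r) * (\<Sum>t=1..n. ?m k t * of_nat (eul n l t)))"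
      unfolding sum_distrib_left by (rule sum.swap)
    also have "\<dots> = (\<Sum>l<n. if l = k then of_nat (eul n l r) else 0)"
      using ijk by (intro sum.cong refl) (simp add: mc[unfolded One_nat_def])
    finally show ?thesis using ijk by (simp add: sum.delta)
  qed
  let ?t = "\<lambda>c. (\<Sum>r=1..n. ?m i r * of_nat r ^ c) * (\<Sum>r=1..n. ?m j r * of_nat r ^ c)"
  let ?u = "\<lambda>c. \<Sum>r=1..n. ?m k r * of_nat r ^ c"
  have "cf_inner n (\<lambda>\<pi>. \<phi> i \<pi> * \<phi> j \<pi>) (\<phi> k) = 1 / ?N *
     (\<Sum>g\<in>perm_set n. (\<Sum>\<sigma>\<in>?C. \<phi> i (inv \<sigma> \<circ> g) * \<phi> j (inv \<sigma> \<circ> g)) * cnj (\<Sum>\<tau>\<in>?C. \<phi> k (inv \<tau> \<circ> g)))"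
    by (rule cf_inner_eq[OF n, where t = ?t and u = ?u]) (use phi ijk in auto)
  also have "\<dots> = 1 / ?N * (\<Sum>g\<in>perm_set n. (\<Sum>r=1..n. \<Sum>s=1..n. ?m i r * ?m j s * ?A g (r * s)) *
      (\<Sum>t=1..n. ?m k t * ?A g t))"
    by (intro arg_cong[where f = "(*) (1 / ?N)"] sum.cong refl) (simp only: S1 S2)
  also have "\<dots> = 1 / ?N * (\<Sum>g\<in>perm_set n. \<Sum>r=1..n. \<Sum>s=1..n.
      ?m i r * ?m j s * (?A g (r * s) * (\<Sum>t=1..n. ?m k t * ?A g t)))"
    by (simp add: sum_distrib_right mult.assoc)
  also have "(\<Sum>g\<in>perm_set n. \<Sum>r=1..n. \<Sum>s=1..n. ?m i r * ?m j s * (?A g (r * s) * (\<Sum>t=1..n. ?m k t * ?A g t))) =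
     (\<Sum>r=1..n. \<Sum>s=1..n. \<Sum>g\<in>perm_set n. ?m i r * ?m j s * (?A g (r * s) * (\<Sum>t=1..n. ?m k t * ?A g t)))"
    by (rule sum_swap3[symmetric])
  also have "\<dots> = (\<Sum>r=1..n. \<Sum>s=1..n. ?m i r * ?m j s * (?N * of_nat (eul n k (r * s))))"
    unfolding P[symmetric] sum_distrib_left[of "?m i _ * ?m j _"] ..
  also have "\<dots> = ?N * (\<Sum>r=1..n. \<Sum>s=1..n. ?m i r * ?m j s * of_nat (eul n k (r * s)))"
    by (simp add: sum_distrib_left ac_simps)
  also have "1 / ?N * \<dots> = (\<Sum>r=1..n. \<Sum>s=1..n. ?m i r * ?m j s * of_nat (eul n k (r * s)))"
    by simp
  also have "\<dots> = (\<Sum>r=1..n. \<Sum>s=1..n. \<Sum>x\<in>perm_set n.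
      (?m i r * of_nat (eul n (des n x) r)) * (?m j s * of_nat (eul n (des n (inv x \<circ> z)) s)))"
    unfolding z(2)[symmetric] eul_mult[OF n z(1), symmetric]
    by (simp add: sum_distrib_left ac_simps)
  also have "\<dots> = (\<Sum>x\<in>perm_set n. \<Sum>r=1..n. \<Sum>s=1..n.
      (?m i r * of_nat (eul n (des n x) r)) * (?m j s * of_nat (eul n (des n (inv x \<circ> z)) s)))"
    by (rule sum_swap3)
  also have "\<dots> = (\<Sum>x\<in>perm_set n. if des n x = i \<and> des n (inv x \<circ> z) = j then 1 else 0)"
    by (intro sum.cong refl) (simp add: sum_product[symmetric] mc[unfolded One_nat_def] ijk des_less[OF n])
  also have "\<dots> = of_nat (card {x \<in> perm_set n. des n x = i \<and> des n (inv x \<circ> z) = j})"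
    by (simp add: sum.If_cases Int_def)
  also have "card {x \<in> perm_set n. des n x = i \<and> des n (inv x \<circ> z) = j} =
    card {(x, y). x \<in> perm_set n \<and> y \<in> perm_set n \<and> des n x = i \<and> des n y = j \<and> x \<circ> y = z}"
  proof (rule bij_betw_same_card[of "\<lambda>x. (x, inv x \<circ> z)"], rule bij_betw_byWitness[where f' = fst])
    have c: "x \<circ> (inv x \<circ> w) = w" "inv x \<circ> (x \<circ> w) = w" if "x \<in> perm_set n" for x w :: "nat \<Rightarrow> nat"
      using permutes_inv_o[OF perm_setD[OF that]] by (simp_all add: comp_assoc[symmetric])
    show "(\<lambda>x. (x, inv x \<circ> z)) ` {x \<in> perm_set n. des n x = i \<and> des n (inv x \<circ> z) = j} \<subseteq>
      {(x, y). x \<in> perm_set n \<and> y \<in> perm_set n \<and> des n x = i \<and> des n y = j \<and> x \<circ> y = z}"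
      using c(1) z(1) by (auto intro: perm_set_comp perm_set_inv)
    show "\<forall>a\<in>{(x, y). x \<in> perm_set n \<and> y \<in> perm_set n \<and> des n x = i \<and> des n y = j \<and> x \<circ> y = z}. (fst a, inv (fst a) \<circ> z) = a"
      using c(2) by auto
    show "fst ` {(x, y). x \<in> perm_set n \<and> y \<in> perm_set n \<and> des n x = i \<and> des n y = j \<and> x \<circ> y = z} \<subseteq>
      {x \<in> perm_set n. des n x = i \<and> des n (inv x \<circ> z) = j}"
      using c(2) by auto
  qed auto
  finally show ?thesis .
qed

section \<open>Traces on finite-dimensional function spaces\<close>

abbreviation clinear :: "(('a \<Rightarrow> complex) \<Rightarrow> ('b \<Rightarrow> complex)) \<Rightarrow> bool" where
  "clinear \<equiv> Vector_Spaces.linear fscale fscale"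

lemma clinearI:
  assumes "\<And>f g. A (f + g) = A f + A g" "\<And>c f. A (fscale c f) = fscale c (A f)"
  shows "clinear A"
  unfolding Vector_Spaces.linear_iff by (simp add: assms cfun.vector_space_axioms)

lemma sum_fun_apply: "(\<Sum>i\<in>I. f i) x = (\<Sum>i\<in>I. f i x)"
  by (induction I rule: infinite_finite_induct) auto

lemma fscale_apply [simp]: "fscale c f x = c * f x"
  by (simp add: fscale_def)

text \<open>Expanding each basis in the other one, both sides become the double sum of
  \<open>?S b c * ?R (A c) b\<close>.\<close>

lemma trace_basis_independent:
  assumes A: "clinear A" and B: "cfun.independent B" "finite B" and C: "cfun.independent C" "finite C"
    and BC: "cfun.span B = cfun.span C" and inv: "\<And>v. v \<in> cfun.span B \<Longrightarrow> A v \<in> cfun.span B"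
  shows "(\<Sum>b\<in>B. cfun.representation B (A b) b) = (\<Sum>c\<in>C. cfun.representation C (A c) c)"
proof -
  interpret A: Vector_Spaces.linear fscale fscale A by (rule A)
  let ?R = "cfun.representation B" and ?S = "cfun.representation C"
  have Cin: "c \<in> cfun.span B" if "c \<in> C" for c using cfun.span_base[OF that] BC by simp
  have Bin: "b \<in> cfun.span C" if "b \<in> B" for b using cfun.span_base[OF that] BC by simp
  have 1: "?R (A b) b = (\<Sum>c\<in>C. ?S b c * ?R (A c) b)" if "b \<in> B" for b
  proof -
    have "A b = A (\<Sum>c\<in>C. fscale (?S b c) c)"
      using cfun.sum_representation_eq[OF C(1) Bin[OF that] C(2)] by simp
    also have "\<dots> = (\<Sum>c\<in>C. fscale (?S b c) (A c))" by (simp add: A.sum A.scale)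
    finally have e: "A b = (\<Sum>c\<in>C. fscale (?S b c) (A c))" .
    have "?R (\<Sum>c\<in>C. fscale (?S b c) (A c)) = (\<lambda>x. \<Sum>c\<in>C. ?R (fscale (?S b c) (A c)) x)"
      by (rule cfun.representation_sum[OF B(1)]) (simp add: cfun.span_scale inv Cin)
    also have "\<dots> = (\<lambda>x. \<Sum>c\<in>C. ?S b c * ?R (A c) x)"
      by (intro ext sum.cong refl) (simp add: cfun.representation_scale[OF B(1)] inv Cin)
    finally show ?thesis unfolding e by (rule fun_cong)
  qed
  have 2: "(\<Sum>b\<in>B. ?S b c * ?R (A c) b) = ?S (A c) c" if "c \<in> C" for c
  proof -
    have in_span: "A c \<in> cfun.span B" using inv Cin that by simp
    have "?S (\<Sum>b\<in>B. fscale (?R (A c) b) b) = (\<lambda>x. \<Sum>b\<in>B. ?S (fscale (?R (A c) b) b) x)"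
      by (rule cfun.representation_sum[OF C(1)]) (simp add: cfun.span_scale Bin)
    also have "\<dots> = (\<lambda>x. \<Sum>b\<in>B. ?R (A c) b * ?S b x)"
      by (intro ext sum.cong refl) (simp add: cfun.representation_scale[OF C(1)] Bin)
    finally have "?S (A c) = (\<lambda>x. \<Sum>b\<in>B. ?R (A c) b * ?S b x)"
      unfolding cfun.sum_representation_eq[OF B(1) in_span B(2) subset_refl] .
    then show ?thesis by (simp add: mult.commute)
  qed
  have "(\<Sum>b\<in>B. ?R (A b) b) = (\<Sum>b\<in>B. \<Sum>c\<in>C. ?S b c * ?R (A c) b)" by (simp add: 1)
  also have "\<dots> = (\<Sum>c\<in>C. \<Sum>b\<in>B. ?S b c * ?R (A c) b)" by (rule sum.swap)
  finally show ?thesis by (simp add: 2)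
qed

text \<open>The basis chosen inside \<open>trace_on\<close> is arbitrary; it is finite because it is
  independent and lies in the span of the finite set \<open>B\<close>.\<close>

lemma trace_on_basis:
  assumes A: "clinear A" and B: "cfun.independent B" "finite B"
    and inv: "\<And>v. v \<in> cfun.span B \<Longrightarrow> A v \<in> cfun.span B"
  shows "trace_on (cfun.span B) A = (\<Sum>b\<in>B. cfun.representation B (A b) b)"
proof -
  define C where "C = (SOME C. cfun.independent C \<and> cfun.span C = cfun.span B)"
  have "cfun.independent C \<and> cfun.span C = cfun.span B"
    unfolding C_def by (rule someI[of _ B]) (use B in simp)
  then have C: "cfun.independent C" "cfun.span C = cfun.span B" by auto
  have "finite C"
    using cfun.independent_span_bound[OF B(2) C(1)] C(2) cfun.span_superset by metis
  then show ?thesis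
    using trace_basis_independent[OF A B C(1) _ C(2)[symmetric] inv]
    unfolding trace_on_def Let_def C_def[symmetric] by simp
qed

lemma trace_on_direct_sum:
  assumes A: "clinear A" and ind: "cfun.independent (\<Union>i\<in>I. B i)" and fin: "finite I" "\<And>i. i \<in> I \<Longrightarrow> finite (B i)"
    and disj: "\<And>i j. i \<in> I \<Longrightarrow> j \<in> I \<Longrightarrow> i \<noteq> j \<Longrightarrow> B i \<inter> B j = {}"
    and inv: "\<And>i v. i \<in> I \<Longrightarrow> v \<in> cfun.span (B i) \<Longrightarrow> A v \<in> cfun.span (B i)"
  shows "trace_on (cfun.span (\<Union>i\<in>I. B i)) A = (\<Sum>i\<in>I. trace_on (cfun.span (B i)) A)"
proof -
  interpret A: Vector_Spaces.linear fscale fscale A by (rule A)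
  let ?B = "\<Union>i\<in>I. B i"
  have sub: "cfun.span (B i) \<subseteq> cfun.span ?B" if "i \<in> I" for i
    using that by (intro cfun.span_mono) auto
  have invB: "A v \<in> cfun.span ?B" if "v \<in> cfun.span ?B" for v
  proof -
    have "A b \<in> cfun.span ?B" if "b \<in> ?B" for b
      using that inv sub cfun.span_base by blast
    then have "cfun.span (A ` ?B) \<subseteq> cfun.span ?B"
      by (intro cfun.span_minimal) auto
    then show ?thesis using A.span_image[of ?B] that by auto
  qed
  have indi: "cfun.independent (B i)" if "i \<in> I" for i
    using cfun.independent_mono[OF ind] that by blast
  have rep: "cfun.representation ?B (A b) b = cfun.representation (B i) (A b) b" if "i \<in> I" "b \<in> B i" for i b
    using cfun.representation_extend[OF ind, of "A b" "B i"] inv[OF that(1)] cfun.span_base[OF that(2)] UN_upper[OF that(1), of B]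
    by simp
  have "trace_on (cfun.span ?B) A = (\<Sum>b\<in>?B. cfun.representation ?B (A b) b)"
    by (rule trace_on_basis[OF A ind]) (use fin invB in auto)
  also have "\<dots> = (\<Sum>i\<in>I. \<Sum>b\<in>B i. cfun.representation ?B (A b) b)"
    by (rule sum.UNION_disjoint) (use fin disj in auto)
  also have "\<dots> = (\<Sum>i\<in>I. trace_on (cfun.span (B i)) A)"
    by (intro sum.cong refl) (simp add: rep trace_on_basis[OF A indi fin(2) inv])
  finally show ?thesis .
qed

text \<open>An injective intertwiner carries a basis to a basis of the image, with the same matrix
  entries.\<close>

lemma trace_on_transfer:
  assumes A: "clinear A" and A': "clinear A'" and h: "clinear h" and X: "finite X"
    and inj: "inj_on h (cfun.span X)" and inv: "\<And>v. v \<in> cfun.span X \<Longrightarrow> A v \<in> cfun.span X"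
    and comm: "\<And>v. v \<in> cfun.span X \<Longrightarrow> h (A v) = A' (h v)"
  shows "trace_on (h ` cfun.span X) A' = trace_on (cfun.span X) A"
proof -
  interpret h: Vector_Spaces.linear fscale fscale h by (rule h)
  obtain B where B: "B \<subseteq> X" "cfun.independent B" "X \<subseteq> cfun.span B"
    by (rule cfun.maximal_independent_subset)
  have XB: "cfun.span X = cfun.span B"
    using B cfun.span_mono cfun.span_minimal[OF B(3) cfun.subspace_span] by blast
  have fB: "finite B" using B(1) X finite_subset by auto
  note inj = inj[unfolded XB] and inv = inv[unfolded XB] and comm = comm[unfolded XB]
  have injB: "inj_on h B" by (rule inj_on_subset[OF inj cfun.span_superset])
  have ind: "cfun.independent (h ` B)"
    using h.dependent_inj_imageD[of B] inj B(2) by blast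
  have inv': "A' v \<in> cfun.span (h ` B)" if "v \<in> cfun.span (h ` B)" for v
    using that inv comm unfolding h.span_image by force
  have rep: "cfun.representation (h ` B) (h v) (h b) = cfun.representation B v b"
    if v: "v \<in> cfun.span B" and b: "b \<in> B" for v b
  proof -
    let ?R = "cfun.representation B v"
    have hv: "h v = (\<Sum>b\<in>B. fscale (?R b) (h b))"
      using cfun.sum_representation_eq[OF B(2) v fB subset_refl] h.sum h.scale by (metis (mono_tags, lifting) sum.cong)
    have "cfun.representation (h ` B) (h v) = (\<lambda>x. \<Sum>b'\<in>B. cfun.representation (h ` B) (fscale (?R b') (h b')) x)"
      unfolding hv by (rule cfun.representation_sum[OF ind]) (auto intro: cfun.span_scale cfun.span_base)
    also have "\<dots> = (\<lambda>x. \<Sum>b'\<in>B. ?R b' * (if x = h b' then 1 else 0))"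
      by (intro ext sum.cong refl)
        (simp add: cfun.representation_scale[OF ind] cfun.span_base cfun.representation_basis[OF ind])
    finally have "cfun.representation (h ` B) (h v) (h b) = (\<Sum>b'\<in>B. ?R b' * (if h b = h b' then 1 else 0))"
      by (rule fun_cong)
    also have "\<dots> = (\<Sum>b'\<in>B. if b' = b then ?R b' else 0)"
      by (intro sum.cong refl) (use b injB in \<open>auto simp: inj_on_def\<close>)
    finally show ?thesis using b fB by simp
  qed
  have "trace_on (h ` cfun.span X) A' = trace_on (cfun.span (h ` B)) A'"
    by (simp add: XB h.span_image)
  also have "\<dots> = (\<Sum>b\<in>h ` B. cfun.representation (h ` B) (A' b) b)"
    by (rule trace_on_basis[OF A' ind _ inv']) (use fB in auto)
  also have "\<dots> = (\<Sum>b\<in>B. cfun.representation (h ` B) (h (A b)) (h b))"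
    using injB by (simp add: sum.reindex comm cfun.span_base)
  also have "\<dots> = (\<Sum>b\<in>B. cfun.representation B (A b) b)"
    by (intro sum.cong refl rep inv cfun.span_base)
  also have "\<dots> = trace_on (cfun.span B) A"
    by (rule trace_on_basis[OF A B(2) fB inv, symmetric])
  finally show ?thesis by (simp add: XB)
qed

section \<open>Point masses, independence and dimension\<close>

definition delta :: "'a \<Rightarrow> 'a \<Rightarrow> complex" where
  "delta x = (\<lambda>y. if y = x then 1 else 0)"

lemma delta_expand:
  assumes "finite X" "\<And>x. x \<notin> X \<Longrightarrow> f x = 0"
  shows "f = (\<Sum>x\<in>X. fscale (f x) (delta x))"
  using assms by (auto simp: fun_eq_iff sum_fun_apply delta_def if_distrib cong: if_cong)

lemma span_delta:
  assumes "finite X"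
  shows "cfun.span (delta ` X) = {f. \<forall>x. x \<notin> X \<longrightarrow> f x = 0}"
proof
  show "cfun.span (delta ` X) \<subseteq> {f. \<forall>x. x \<notin> X \<longrightarrow> f x = 0}"
    by (rule cfun.span_minimal) (auto simp: delta_def cfun.subspace_def)
  show "{f. \<forall>x. x \<notin> X \<longrightarrow> f x = 0} \<subseteq> cfun.span (delta ` X)"
  proof clarify
    fix f :: "'a \<Rightarrow> complex" assume "\<forall>x. x \<notin> X \<longrightarrow> f x = 0"
    then have "f = (\<Sum>x\<in>X. fscale (f x) (delta x))" using delta_expand[OF assms] by blast
    also have "\<dots> \<in> cfun.span (delta ` X)"
      by (intro cfun.span_sum cfun.span_scale cfun.span_base) auto
    finally show "f \<in> cfun.span (delta ` X)" .
  qed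
qed

lemma inj_delta: "inj delta"
  by (rule injI) (metis delta_def zero_neq_one)

lemma independent_delta:
  assumes "finite X"
  shows "cfun.independent (delta ` X)"
proof (rule cfun.independent_if_scalars_zero)
  fix c :: "('a \<Rightarrow> complex) \<Rightarrow> complex" and v
  assume s: "(\<Sum>v\<in>delta ` X. fscale (c v) v) = 0" and "v \<in> delta ` X"
  then obtain x where x: "x \<in> X" "v = delta x" by auto
  have "(\<Sum>v\<in>delta ` X. fscale (c v) v) x = (\<Sum>y\<in>X. c (delta y) * delta y x)"
    by (simp add: sum_fun_apply sum.reindex inj_on_subset[OF inj_delta])
  also have "\<dots> = c v" using x assms by (simp add: delta_def if_distrib cong: if_cong)
  finally show "c v = 0" using s by simp
qed (use assms in simp)

text \<open>Each basis vector goes to a basis vector, so a diagonal entry is 1 at a fixed point of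
  \<open>s\<close> and 0 elsewhere.\<close>

lemma trace_on_delta:
  assumes "finite X" "clinear A" "\<And>x. x \<in> X \<Longrightarrow> A (delta x) = delta (s x)" "\<And>x. x \<in> X \<Longrightarrow> s x \<in> X"
  shows "trace_on (cfun.span (delta ` X)) A = of_nat (card {x \<in> X. s x = x})"
proof -
  interpret A: Vector_Spaces.linear fscale fscale A by (rule assms(2))
  note ind = independent_delta[OF assms(1)]
  have inv: "A v \<in> cfun.span (delta ` X)" if "v \<in> cfun.span (delta ` X)" for v
  proof -
    have "cfun.span (A ` delta ` X) \<subseteq> cfun.span (delta ` X)"
      by (rule cfun.span_mono) (use assms in auto)
    then show ?thesis using A.span_image[of "delta ` X"] that by auto
  qed
  have "trace_on (cfun.span (delta ` X)) A = (\<Sum>x\<in>X. cfun.representation (delta ` X) (A (delta x)) (delta x))"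
    using trace_on_basis[OF assms(2) ind _ inv] assms(1)
    by (simp add: sum.reindex inj_on_subset[OF inj_delta])
  also have "\<dots> = (\<Sum>x\<in>X. if s x = x then 1 else 0)"
    using assms
    by (intro sum.cong refl) (auto simp: cfun.representation_basis[OF ind] dest: injD[OF inj_delta])
  finally show ?thesis using assms(1) by (simp add: sum.If_cases Int_def)
qed

text \<open>If \<open>v i = v j\<close> with \<open>i \<noteq> j\<close>, the coefficients 1 and -1
  would give a relation; so injectivity comes along with independence.\<close>

lemma independent_family:
  assumes "finite I" "\<And>c i. (\<Sum>i\<in>I. fscale (c i) (v i)) = 0 \<Longrightarrow> i \<in> I \<Longrightarrow> c i = 0"
  shows "inj_on v I" "cfun.independent (v ` I)"
proof -
  show inj: "inj_on v I"
  proof (rule inj_onI, rule ccontr)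
    fix i j assume ij: "i \<in> I" "j \<in> I" "v i = v j" "i \<noteq> j"
    define c :: "'a \<Rightarrow> complex" where "c k = (if k = i then 1 else if k = j then - 1 else 0)" for k
    have "(\<Sum>k\<in>I. fscale (c k) (v k)) = (\<Sum>k\<in>{i, j}. fscale (c k) (v k))"
      by (rule sum.mono_neutral_right) (use assms(1) ij in \<open>auto simp: c_def\<close>)
    also have "\<dots> = 0" using ij by (simp add: c_def fun_eq_iff)
    finally have "c i = 0" using assms(2) ij by blast
    then show False by (simp add: c_def)
  qed
  show "cfun.independent (v ` I)"
  proof (rule cfun.independent_if_scalars_zero)
    fix c x assume "(\<Sum>x\<in>v ` I. fscale (c x) x) = 0" "x \<in> v ` I"
    then show "c x = 0" using assms(2)[of "c \<circ> v"] inj by (auto simp: sum.reindex)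
  qed (use assms in simp)
qed

lemma span_eq_if_card_ge:
  assumes "cfun.independent B" "B \<subseteq> cfun.span X" "finite X" "card X \<le> card B"
  shows "cfun.span B = cfun.span X"
proof
  show "cfun.span B \<subseteq> cfun.span X" by (rule cfun.span_minimal[OF assms(2) cfun.subspace_span])
  show "cfun.span X \<subseteq> cfun.span B"
  proof (rule ccontr)
    assume "\<not> cfun.span X \<subseteq> cfun.span B"
    then obtain x where x: "x \<in> cfun.span X" "x \<notin> cfun.span B" by auto
    then have "cfun.independent (insert x B)" using assms(1) by (simp add: cfun.independent_insertI)
    from cfun.independent_span_bound[OF assms(3) this] have "finite B" "card (insert x B) \<le> card X"
      using x assms(2) by auto
    moreover have "x \<notin> B" using x cfun.span_base by auto
    ultimately show False using assms(4) by simp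
  qed
qed

section \<open>Polytabloids of border shapes as functions on words\<close>

text \<open>A Young subgroup, described by a labelling of the positions; rows and columns of a shape
  are two such labellings.\<close>

definition stab :: "nat \<Rightarrow> (nat \<Rightarrow> nat) \<Rightarrow> (nat \<Rightarrow> nat) set" where
  "stab n \<kappa> = {\<tau> \<in> perm_set n. \<forall>p\<in>{1..n}. \<kappa> (\<tau> p) = \<kappa> p}"

lemma stab_perm: "\<tau> \<in> stab n \<kappa> \<Longrightarrow> \<tau> \<in> perm_set n"
  by (simp add: stab_def)

lemma finite_stab [simp]: "finite (stab n \<kappa>)"
  by (simp add: stab_def)

lemma perm_set_image: "x \<in> perm_set n \<Longrightarrow> p \<in> {1..n} \<Longrightarrow> x p \<in> {1..n}"
  using permutes_in_image[OF perm_setD] by blast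

lemma stab_comp: "\<sigma> \<in> stab n \<kappa> \<Longrightarrow> \<tau> \<in> stab n \<kappa> \<Longrightarrow> \<sigma> \<circ> \<tau> \<in> stab n \<kappa>"
  using perm_set_image by (auto simp: stab_def intro: perm_set_comp)

lemma id_perm_set: "id \<in> perm_set n"
  by (simp add: perm_set_def)

lemma id_stab: "id \<in> stab n \<kappa>"
  by (simp add: stab_def id_perm_set)

lemma perm_set_cancel:
  assumes "x \<in> perm_set n"
  shows "x \<circ> (inv x \<circ> y) = y" "inv x \<circ> (x \<circ> y) = y" "x (inv x p) = p" "inv x (x p) = p"
  using permutes_inv_o[OF perm_setD[OF assms]] permutes_inverses[OF perm_setD[OF assms]]
  by (simp_all add: comp_assoc[symmetric])

lemma stab_inv:
  assumes "\<tau> \<in> stab n \<kappa>"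
  shows "inv \<tau> \<in> stab n \<kappa>"
proof -
  note t = stab_perm[OF assms]
  have "\<kappa> (inv \<tau> p) = \<kappa> p" if "p \<in> {1..n}" for p
    using assms perm_set_image[OF perm_set_inv[OF t] that] perm_set_cancel(3)[OF t, of p]
    by (auto simp: stab_def dest!: bspec[of _ _ "inv \<tau> p"])
  then show ?thesis using perm_set_inv[OF t] by (simp add: stab_def)
qed

text \<open>The least moved point \<open>p\<close> goes up, and the point \<open>q\<close> that is
  mapped to \<open>p\<close> lies further right; moreover
  \<open>\<kappa> q = \<kappa> (\<tau> q) = \<kappa> p\<close>.\<close>

lemma stab_inversion:
  assumes "\<tau> \<in> stab n \<kappa>" "\<tau> \<noteq> id"
  shows "\<exists>p q. p \<in> {1..n} \<and> q \<in> {1..n} \<and> p < q \<and> \<kappa> p = \<kappa> q \<and> \<tau> p > \<tau> q"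
proof -
  note t = stab_perm[OF assms(1)]
  have "\<exists>p. \<tau> p \<noteq> p" using assms(2) by (auto simp: fun_eq_iff)
  define p where "p = (LEAST p. \<tau> p \<noteq> p)"
  have p: "\<tau> p \<noteq> p" unfolding p_def by (rule LeastI_ex) fact
  have least: "\<tau> x = x" if "x < p" for x using not_less_Least[of x "\<lambda>p. \<tau> p \<noteq> p"] that by (auto simp: p_def)
  have pn: "p \<in> {1..n}" using p permutes_not_in[OF perm_setD[OF t], of p] by blast
  define q where "q = inv \<tau> p"
  have tq: "\<tau> q = p" using perm_set_cancel(3)[OF t] by (simp add: q_def)
  have qn: "q \<in> {1..n}" unfolding q_def by (rule perm_set_image[OF perm_set_inv[OF t] pn])
  have "q > p"
    using least[of q] tq p by (metis linorder_neqE_nat)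
  moreover have "\<tau> p > p"
    using least[of "\<tau> p"] p permutes_inj[OF perm_setD[OF t]] by (metis injD linorder_neqE_nat)
  moreover have "\<kappa> q = \<kappa> p" using assms(1) qn tq by (auto simp: stab_def)
  ultimately show ?thesis using pn qn tq by metis
qed

text \<open>A set \<open>D\<close> of positions cuts the word \<open>u 1, \<dots>, u n\<close> into the rows of a border shape, which is
  traversed from its upper right to its lower left end: a step in \<open>D\<close> goes down, any other step
  goes left.\<close>

definition row_of :: "nat set \<Rightarrow> nat \<Rightarrow> nat" where
  "row_of D p = card {d \<in> D. d < p}"

text \<open>The path ends in column 0, so the column at position \<open>p\<close> is the number of
  left steps still ahead.\<close>

definition col_of :: "nat \<Rightarrow> nat set \<Rightarrow> nat \<Rightarrow> nat" where
  "col_of n D p = card ({p..<n} - D)"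

definition word_tabloid :: "nat \<Rightarrow> nat set \<Rightarrow> (nat \<Rightarrow> nat) \<Rightarrow> tabloid" where
  "word_tabloid n D u = restrict (\<lambda>x. row_of D (inv u x)) {1..n}"

abbreviation row_group :: "nat \<Rightarrow> nat set \<Rightarrow> (nat \<Rightarrow> nat) set" where
  "row_group n D \<equiv> stab n (row_of D)"

abbreviation col_group :: "nat \<Rightarrow> nat set \<Rightarrow> (nat \<Rightarrow> nat) set" where
  "col_group n D \<equiv> stab n (col_of n D)"

text \<open>The column group acts on positions, from the right, and is therefore the same for all
  words. The column stabilizer of a tableau acts on entries and is its conjugate by
  \<open>u\<close>.\<close>

definition word_polytabloid :: "nat \<Rightarrow> nat set \<Rightarrow> (nat \<Rightarrow> nat) \<Rightarrow> tabloid \<Rightarrow> complex" where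
  "word_polytabloid n D u =
     (\<lambda>T. \<Sum>\<rho>\<in>col_group n D. of_int (sign \<rho>) * (if T = word_tabloid n D (u \<circ> \<rho>) then 1 else 0))"

text \<open>Functions on tabloids of all shapes are compared by pulling them back to functions on words.\<close>

definition pull :: "nat \<Rightarrow> nat set \<Rightarrow> (tabloid \<Rightarrow> complex) \<Rightarrow> (nat \<Rightarrow> nat) \<Rightarrow> complex" where
  "pull n D f = (\<lambda>u. if u \<in> perm_set n then f (word_tabloid n D u) else 0)"

definition left_act :: "(nat \<Rightarrow> nat) \<Rightarrow> ((nat \<Rightarrow> nat) \<Rightarrow> complex) \<Rightarrow> (nat \<Rightarrow> nat) \<Rightarrow> complex" where
  "left_act \<pi> F = (\<lambda>u. F (inv \<pi> \<circ> u))"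

definition pullpoly :: "nat \<Rightarrow> nat set \<Rightarrow> (nat \<Rightarrow> nat) \<Rightarrow> (nat \<Rightarrow> nat) \<Rightarrow> complex" where
  "pullpoly n D u = pull n D (word_polytabloid n D u)"

text \<open>The tabloid module with row breaks \<open>D\<close>, realized inside the functions on
  words.\<close>

definition row_space :: "nat \<Rightarrow> nat set \<Rightarrow> ((nat \<Rightarrow> nat) \<Rightarrow> complex) set" where
  "row_space n D = {f. (\<forall>u. u \<notin> perm_set n \<longrightarrow> f u = 0) \<and>
     (\<forall>u\<in>perm_set n. \<forall>v\<in>perm_set n. word_tabloid n D u = word_tabloid n D v \<longrightarrow> f u = f v)}"

definition poly_space :: "nat \<Rightarrow> nat set \<Rightarrow> ((nat \<Rightarrow> nat) \<Rightarrow> complex) set" where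
  "poly_space n D = cfun.span (pullpoly n D ` perm_set n)"

definition col_antisym :: "nat \<Rightarrow> nat set \<Rightarrow> ((nat \<Rightarrow> nat) \<Rightarrow> complex) \<Rightarrow> (nat \<Rightarrow> nat) \<Rightarrow> complex" where
  "col_antisym n D f u = (\<Sum>\<rho>\<in>col_group n D. of_int (sign \<rho>) * f (u \<circ> \<rho>))"

section \<open>Row functions and column antisymmetrizers\<close>

lemma word_tabloid_eq_iff:
  assumes x: "x \<in> perm_set n" and y: "y \<in> perm_set n"
  shows "word_tabloid n D x = word_tabloid n D y \<longleftrightarrow> inv y \<circ> x \<in> row_group n D"
proof
  assume e: "word_tabloid n D x = word_tabloid n D y"
  have "row_of D (inv y (x p)) = row_of D p" if "p \<in> {1..n}" for p
    using fun_cong[OF e, of "x p"] perm_set_image[OF x that] perm_set_cancel(4)[OF x]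
    by (simp add: word_tabloid_def)
  then show "inv y \<circ> x \<in> row_group n D"
    using perm_set_comp[OF perm_set_inv[OF y] x] by (simp add: stab_def)
next
  assume s: "inv y \<circ> x \<in> row_group n D"
  have "row_of D (inv x z) = row_of D (inv y z)" if "z \<in> {1..n}" for z
    using s perm_set_image[OF perm_set_inv[OF x] that] perm_set_cancel(3)[OF x, of z]
    by (auto simp: stab_def dest!: bspec[of _ _ "inv x z"])
  then show "word_tabloid n D x = word_tabloid n D y"
    by (auto simp: word_tabloid_def fun_eq_iff)
qed

lemma word_tabloid_comp_row:
  assumes "x \<in> perm_set n" "\<tau> \<in> row_group n D"
  shows "word_tabloid n D (x \<circ> \<tau>) = word_tabloid n D x"
  using word_tabloid_eq_iff[OF perm_set_comp[OF assms(1) stab_perm[OF assms(2)]] assms(1), of D] assms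
  by (simp add: perm_set_cancel comp_assoc)

lemma row_spaceI:
  assumes "\<And>u. u \<notin> perm_set n \<Longrightarrow> f u = 0"
    and "\<And>u v. u \<in> perm_set n \<Longrightarrow> v \<in> perm_set n \<Longrightarrow> word_tabloid n D u = word_tabloid n D v \<Longrightarrow> f u = f v"
  shows "f \<in> row_space n D"
  unfolding row_space_def mem_Collect_eq using assms by blast

lemma row_space_outside: "f \<in> row_space n D \<Longrightarrow> u \<notin> perm_set n \<Longrightarrow> f u = 0"
  by (simp add: row_space_def)

lemma row_space_eq:
  "f \<in> row_space n D \<Longrightarrow> u \<in> perm_set n \<Longrightarrow> v \<in> perm_set n \<Longrightarrow> word_tabloid n D u = word_tabloid n D v \<Longrightarrow> f u = f v"
  unfolding row_space_def mem_Collect_eq by blast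

lemma subspace_row_space: "cfun.subspace (row_space n D)"
proof (rule cfun.subspaceI)
  show "0 \<in> row_space n D" by (rule row_spaceI) auto
  show "f + g \<in> row_space n D" if "f \<in> row_space n D" "g \<in> row_space n D" for f g
    by (rule row_spaceI) (use row_space_outside[OF that(1)] row_space_outside[OF that(2)]
      row_space_eq[OF that(1)] row_space_eq[OF that(2)] in \<open>simp, metis plus_fun_apply\<close>)
  show "fscale c f \<in> row_space n D" if "f \<in> row_space n D" for c f
    by (rule row_spaceI) (use row_space_outside[OF that] row_space_eq[OF that] in \<open>simp, metis fscale_apply\<close>)
qed

lemma pull_in_row_space: "pull n D f \<in> row_space n D"
  by (rule row_spaceI) (simp_all add: pull_def)

lemma poly_space_subset: "poly_space n D \<subseteq> row_space n D"
  unfolding poly_space_def pullpoly_def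
  by (rule cfun.span_minimal) (use pull_in_row_space subspace_row_space in auto)

text \<open>Equal row numbers mean that no break of \<open>D\<close> separates \<open>p\<close> from
  \<open>q\<close>, hence no break of \<open>E\<close> does.\<close>

lemma row_of_mono_set:
  assumes "finite D" "E \<subseteq> D" "row_of D p = row_of D q"
  shows "row_of E p = row_of E q"
proof -
  have "{d \<in> D. d < p} = {d \<in> D. d < q}"
  proof (cases "p \<le> q")
    case True
    then show ?thesis using assms by (intro card_subset_eq) (auto simp: row_of_def)
  next
    case False
    then show ?thesis using assms by (intro card_subset_eq[symmetric]) (auto simp: row_of_def)
  qed
  then have "{d \<in> E. d < p} = {d \<in> E. d < q}" using assms(2) by blast
  then show ?thesis by (simp add: row_of_def)
qed

text \<open>Removing breaks merges rows, and constancy on the coarser tabloid classes is the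
  stronger condition.\<close>

lemma row_space_mono:
  assumes "finite D" "E \<subseteq> D"
  shows "row_space n E \<subseteq> row_space n D"
proof -
  have "word_tabloid n E u = word_tabloid n E v" if e: "word_tabloid n D u = word_tabloid n D v" for u v
  proof
    fix x
    show "word_tabloid n E u x = word_tabloid n E v x"
    proof (cases "x \<in> {1..n}")
      case True
      then have "row_of D (inv u x) = row_of D (inv v x)"
        using fun_cong[OF e, of x] by (simp add: word_tabloid_def)
      then have "row_of E (inv u x) = row_of E (inv v x)" by (rule row_of_mono_set[OF assms])
      then show ?thesis by (simp add: word_tabloid_def)
    next
      case False
      then show ?thesis by (simp only: word_tabloid_def restrict_def if_False)
    qed
  qed
  note coarsen = this
  show ?thesis
  proof
    fix f assume f: "f \<in> row_space n E"
    show "f \<in> row_space n D"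
    proof (rule row_spaceI)
      show "f u = 0" if "u \<notin> perm_set n" for u by (rule row_space_outside[OF f that])
      show "f u = f v" if "u \<in> perm_set n" "v \<in> perm_set n" "word_tabloid n D u = word_tabloid n D v" for u v
        by (rule row_space_eq[OF f that(1,2) coarsen[OF that(3)]])
    qed
  qed
qed

lemma sign_comp_transpose:
  assumes "\<rho> \<in> perm_set n" "a \<noteq> b"
  shows "sign (\<rho> \<circ> transpose a b) = - sign \<rho>"
  using sign_compose[OF permutation_p[OF perm_setD[OF assms(1)]] permutation_swap_id, of a b] assms(2)
  by (simp add: sign_swap_id)

lemma step_transpose:
  assumes "d \<in> {1..<n}"
  shows "d \<in> D \<Longrightarrow> transpose d (Suc d) \<in> col_group n D"
    and "d \<notin> D \<Longrightarrow> transpose d (Suc d) \<in> row_group n D"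
proof -
  let ?t = "transpose d (Suc d)"
  have t: "?t \<in> perm_set n" using assms by (intro perm_set_transpose) auto
  show "?t \<in> col_group n D" if "d \<in> D"
  proof -
    have "{d..<n} - D = {Suc d..<n} - D" using that assms by (auto simp: Suc_le_eq le_less)
    then have "col_of n D d = col_of n D (Suc d)" by (simp add: col_of_def)
    then show ?thesis using t by (auto simp: stab_def Transposition.transpose_def)
  qed
  show "?t \<in> row_group n D" if "d \<notin> D"
  proof -
    have "{e \<in> D. e < d} = {e \<in> D. e < Suc d}" using that by (auto simp: less_Suc_eq)
    then have "row_of D d = row_of D (Suc d)" by (simp add: row_of_def)
    then show ?thesis using t by (auto simp: stab_def Transposition.transpose_def)
  qed
qed

lemma sum_stab_right:
  assumes "s \<in> stab n \<kappa>"
  shows "(\<Sum>\<rho>\<in>stab n \<kappa>. F (\<rho> \<circ> s)) = (\<Sum>\<rho>\<in>stab n \<kappa>. F \<rho>)"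
proof (rule sum.reindex_bij_witness[where i = "\<lambda>\<rho>. \<rho> \<circ> inv s" and j = "\<lambda>\<rho>. \<rho> \<circ> s"])
  note c = permutes_inv_o[OF perm_setD[OF stab_perm[OF assms]]]
  fix \<rho> assume "\<rho> \<in> stab n \<kappa>"
  then show "\<rho> \<circ> s \<in> stab n \<kappa>" "\<rho> \<circ> inv s \<in> stab n \<kappa>"
    using assms by (auto intro: stab_comp stab_inv)
  show "\<rho> \<circ> s \<circ> inv s = \<rho>" "\<rho> \<circ> inv s \<circ> s = \<rho>" by (simp_all add: comp_assoc c)
qed simp

text \<open>For a break \<open>d\<close> of \<open>D\<close> outside \<open>E\<close>, the
  transposition of \<open>d\<close> and \<open>d + 1\<close> lies in the column group of
  \<open>D\<close> and in the row group of \<open>E\<close>. It changes the sign but not the values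
  of \<open>f\<close>, so the sum is its own negative.\<close>

lemma col_antisym_row_space:
  assumes f: "f \<in> row_space n E" and D: "D \<subseteq> {1..<n}" "\<not> D \<subseteq> E" and u: "u \<in> perm_set n"
  shows "col_antisym n D f u = 0"
proof -
  from D(2) obtain d where d: "d \<in> D" "d \<notin> E" by auto
  then have d_range: "d \<in> {1..<n}" using D(1) by auto
  let ?s = "transpose d (Suc d)"
  note st = step_transpose[OF d_range]
  have "of_int (sign (\<rho> \<circ> ?s)) * f (u \<circ> (\<rho> \<circ> ?s)) = - (of_int (sign \<rho>) * f (u \<circ> \<rho>))"
    if "\<rho> \<in> col_group n D" for \<rho>
  proof -
    have r: "u \<circ> \<rho> \<in> perm_set n" using u stab_perm[OF that] by (rule perm_set_comp)
    have "word_tabloid n E (u \<circ> \<rho> \<circ> ?s) = word_tabloid n E (u \<circ> \<rho>)"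
      by (rule word_tabloid_comp_row[OF r st(2)[OF d(2)]])
    then have "f (u \<circ> \<rho> \<circ> ?s) = f (u \<circ> \<rho>)"
      by (rule row_space_eq[OF f perm_set_comp[OF r stab_perm[OF st(2)[OF d(2)]]] r])
    then show ?thesis using sign_comp_transpose[OF stab_perm[OF that], of d "Suc d"] by (simp add: comp_assoc)
  qed
  then have "(\<Sum>\<rho>\<in>col_group n D. of_int (sign (\<rho> \<circ> ?s)) * f (u \<circ> (\<rho> \<circ> ?s))) = - col_antisym n D f u"
    by (simp add: col_antisym_def sum_negf)
  moreover have "(\<Sum>\<rho>\<in>col_group n D. of_int (sign (\<rho> \<circ> ?s)) * f (u \<circ> (\<rho> \<circ> ?s))) = col_antisym n D f u"
    unfolding col_antisym_def by (rule sum_stab_right[OF st(1)[OF d(1)]])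
  ultimately show ?thesis by simp
qed

lemma card_tabloid_class:
  assumes y: "y \<in> perm_set n"
  shows "card {x \<in> perm_set n. word_tabloid n D x = word_tabloid n D y} = card (row_group n D)"
proof (rule bij_betw_same_card[of "\<lambda>x. inv y \<circ> x"], rule bij_betw_byWitness[where f' = "\<lambda>\<tau>. y \<circ> \<tau>"])
  show "(\<lambda>x. inv y \<circ> x) ` {x \<in> perm_set n. word_tabloid n D x = word_tabloid n D y} \<subseteq> row_group n D"
    using word_tabloid_eq_iff[OF _ y] by auto
  show "(\<lambda>\<tau>. y \<circ> \<tau>) ` row_group n D \<subseteq> {x \<in> perm_set n. word_tabloid n D x = word_tabloid n D y}"
    using word_tabloid_comp_row[OF y] perm_set_comp[OF y stab_perm] by auto
qed (simp_all add: perm_set_cancel[OF y])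

text \<open>Antisymmetrizing is adjoint to forming polytabloids. The factor appears because every
  tabloid comes from \<open>card (row_group n D)\<close> words.\<close>

lemma pullpoly_inner:
  assumes f: "f \<in> row_space n D" and u: "u \<in> perm_set n"
  shows "(\<Sum>x\<in>perm_set n. f x * cnj (pullpoly n D u x)) = of_nat (card (row_group n D)) * col_antisym n D f u"
proof -
  have "(\<Sum>x\<in>perm_set n. f x * cnj (pullpoly n D u x)) =
    (\<Sum>x\<in>perm_set n. \<Sum>\<rho>\<in>col_group n D. of_int (sign \<rho>) * (if word_tabloid n D x = word_tabloid n D (u \<circ> \<rho>) then f x else 0))"
    by (intro sum.cong refl) (auto simp: pullpoly_def pull_def word_polytabloid_def sum_distrib_left intro!: sum.cong)
  also have "\<dots> = (\<Sum>\<rho>\<in>col_group n D. of_int (sign \<rho>) *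
      (\<Sum>x\<in>perm_set n. if word_tabloid n D x = word_tabloid n D (u \<circ> \<rho>) then f x else 0))"
    unfolding sum_distrib_left by (rule sum.swap)
  also have "\<dots> = (\<Sum>\<rho>\<in>col_group n D. of_int (sign \<rho>) * (of_nat (card (row_group n D)) * f (u \<circ> \<rho>)))"
  proof (intro sum.cong refl arg_cong2[where f = "(*)"])
    fix \<rho> assume "\<rho> \<in> col_group n D"
    then have r: "u \<circ> \<rho> \<in> perm_set n" using u stab_perm perm_set_comp by blast
    have "(\<Sum>x\<in>perm_set n. if word_tabloid n D x = word_tabloid n D (u \<circ> \<rho>) then f x else 0) =
      (\<Sum>x\<in>{x \<in> perm_set n. word_tabloid n D x = word_tabloid n D (u \<circ> \<rho>)}. f x)"
      by (rule sum.inter_filter[symmetric]) simp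
    also have "\<dots> = (\<Sum>x\<in>{x \<in> perm_set n. word_tabloid n D x = word_tabloid n D (u \<circ> \<rho>)}. f (u \<circ> \<rho>))"
      using row_space_eq[OF f _ r] by (intro sum.cong refl) auto
    finally show "(\<Sum>x\<in>perm_set n. if word_tabloid n D x = word_tabloid n D (u \<circ> \<rho>) then f x else 0) =
       of_nat (card (row_group n D)) * f (u \<circ> \<rho>)"
      using card_tabloid_class[OF r] by simp
  qed
  finally show ?thesis by (simp add: col_antisym_def sum_distrib_left mult.left_commute)
qed

text \<open>By \<open>pullpoly_inner\<close> such an \<open>f\<close> is orthogonal to all
  polytabloids of \<open>D\<close>, hence to itself.\<close>

lemma poly_space_positive:
  assumes f: "f \<in> poly_space n D" and R: "\<And>u. u \<in> perm_set n \<Longrightarrow> col_antisym n D f u = 0"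
  shows "f = 0"
proof -
  have fr: "f \<in> row_space n D" using f poly_space_subset by auto
  have "(\<Sum>x\<in>perm_set n. f x * cnj (g x)) = 0" if "g \<in> poly_space n D" for g
  proof -
    have "cfun.span (pullpoly n D ` perm_set n) \<subseteq> {g. (\<Sum>x\<in>perm_set n. f x * cnj (g x)) = 0}"
    proof (rule cfun.span_minimal)
      show "pullpoly n D ` perm_set n \<subseteq> {g. (\<Sum>x\<in>perm_set n. f x * cnj (g x)) = 0}"
        using pullpoly_inner[OF fr] R by auto
      have "(\<Sum>x\<in>perm_set n. f x * cnj (c * g x)) = cnj c * (\<Sum>x\<in>perm_set n. f x * cnj (g x))" for c g
        by (simp add: sum_distrib_left ac_simps)
      then show "cfun.subspace {g. (\<Sum>x\<in>perm_set n. f x * cnj (g x)) = 0}"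
        by (auto simp: cfun.subspace_def algebra_simps sum.distrib simp del: complex_cnj_mult)
    qed
    then show ?thesis using that by (auto simp: poly_space_def)
  qed
  from this[OF f] have "complex_of_real (\<Sum>x\<in>perm_set n. (cmod (f x))\<^sup>2) = 0"
    by (simp add: complex_norm_square[symmetric])
  then have "(\<Sum>x\<in>perm_set n. (cmod (f x))\<^sup>2) = 0" by (simp only: of_real_eq_0_iff)
  then have "f x = 0" if "x \<in> perm_set n" for x
    using that by (simp add: sum_nonneg_eq_0_iff)
  moreover have "f x = 0" if "x \<notin> perm_set n" for x by (rule row_space_outside[OF fr that])
  ultimately show ?thesis by (auto simp: fun_eq_iff)
qed

lemma col_antisym_sum: "col_antisym n D (\<Sum>i\<in>I. f i) u = (\<Sum>i\<in>I. col_antisym n D (f i) u)"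
  unfolding col_antisym_def sum_fun_apply sum_distrib_left by (rule sum.swap)

text \<open>Induction from large sets \<open>D\<close> to small ones: the antisymmetrizer of
  \<open>D\<close> kills \<open>f E\<close> unless \<open>D \<subseteq> E\<close>, and the strictly
  larger \<open>E\<close> are already settled, so it kills \<open>f D\<close> too. With
  \<open>P = UNIV\<close> and \<open>g = 0\<close> this says that the sum is direct; a smaller
  \<open>P\<close> bounds the components of a row function \<open>g\<close>.\<close>

lemma poly_space_direct:
  assumes f: "\<And>D. D \<subseteq> {1..<n} \<Longrightarrow> f D \<in> poly_space n D"
    and up: "\<And>D E. D \<in> P \<Longrightarrow> D \<subseteq> E \<Longrightarrow> E \<subseteq> {1..<n} \<Longrightarrow> E \<in> P"
    and g: "\<And>D u. D \<in> P \<Longrightarrow> D \<subseteq> {1..<n} \<Longrightarrow> u \<in> perm_set n \<Longrightarrow> col_antisym n D g u = 0"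
    and sum: "(\<Sum>D\<in>Pow {1..<n}. f D) = g"
    and D: "D \<in> P" "D \<subseteq> {1..<n}"
  shows "f D = 0"
  using D
proof (induction "n - card D" arbitrary: D rule: less_induct)
  case less
  have big: "f E = 0" if "D \<subset> E" "E \<subseteq> {1..<n}" for E
  proof (rule less.hyps)
    have "card D < card E" using that finite_subset[OF that(2)] by (simp add: psubset_card_mono)
    moreover have "card E \<le> card {1..<n}" using that(2) by (intro card_mono) auto
    ultimately show "n - card E < n - card D" by simp
    show "E \<in> P" using up[OF less.prems(1)] that by auto
  qed (rule that)
  have z: "col_antisym n D (f E) u = 0" if "E \<subseteq> {1..<n}" "E \<noteq> D" "u \<in> perm_set n" for E u
  proof (cases "D \<subseteq> E")
    case True
    then show ?thesis using big[of E] that by (auto simp: col_antisym_def)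
  next
    case False
    then show ?thesis
      using col_antisym_row_space[OF _ less.prems(2) False that(3)] f[OF that(1)] poly_space_subset by blast
  qed
  show "f D = 0"
  proof (rule poly_space_positive[OF f[OF less.prems(2)]])
    fix u assume u: "u \<in> perm_set n"
    have "0 = col_antisym n D (\<Sum>D\<in>Pow {1..<n}. f D) u" unfolding sum using g less.prems u by simp
    also have "\<dots> = (\<Sum>E\<in>Pow {1..<n}. col_antisym n D (f E) u)" by (rule col_antisym_sum)
    also have "\<dots> = (\<Sum>E\<in>{D}. col_antisym n D (f E) u)"
      by (rule sum.mono_neutral_right) (use less.prems z u in auto)
    finally show "col_antisym n D (f D) u = 0" by simp
  qed
qed

section \<open>Standard fillings and their polytabloids\<close>

definition ascents :: "nat \<Rightarrow> (nat \<Rightarrow> nat) \<Rightarrow> nat set" where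
  "ascents n u = {i \<in> {1..<n}. u i < u (Suc i)}"

lemma ascents_subset: "ascents n u \<subseteq> {1..<n}"
  by (auto simp: ascents_def)

text \<open>Between two positions of one column every step goes down, that is, is an ascent.
  Together with \<open>same_row\<close> this makes a word cut at its ascents a standard filling: it
  increases down the columns and, as rows are traversed from right to left, along the rows.\<close>

lemma same_col:
  assumes "a < b" "b \<le> n" "1 \<le> a" "col_of n (ascents n w) a = col_of n (ascents n w) b"
  shows "w a < w b" "row_of (ascents n w) a < row_of (ascents n w) b"
proof -
  let ?D = "ascents n w"
  have "{b..<n} - ?D = {a..<n} - ?D"
    by (rule card_subset_eq) (use assms in \<open>auto simp: col_of_def\<close>)
  note eq = this
  have sub: "{a..<b} \<subseteq> ?D"
  proof (rule subsetI, rule ccontr)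
    fix j assume j: "j \<in> {a..<b}" "j \<notin> ?D"
    then have "j \<in> {a..<n} - ?D" using assms(2) by simp
    then show False unfolding eq[symmetric] using j(1) by simp
  qed
  have "w a < w j" if "a < j" "j \<le> b" for j
    using that
  proof (induction j)
    case (Suc j)
    then have "j \<in> ?D" by (intro subsetD[OF sub]) simp
    then have "w j < w (Suc j)" by (simp add: ascents_def)
    then show ?case using Suc by (cases "a = j") auto
  qed simp
  then show "w a < w b" using assms(1) by simp
  have "finite ?D" using finite_subset[OF ascents_subset] by simp
  moreover have "a \<in> {d \<in> ?D. d < b} - {d \<in> ?D. d < a}" using sub assms(1) by auto
  ultimately show "row_of ?D a < row_of ?D b" unfolding row_of_def
    by (intro psubset_card_mono) (use assms(1) in auto)
qed

lemma same_row:
  assumes "w \<in> perm_set n" "a < b" "b \<le> n" "1 \<le> a" "row_of (ascents n w) a = row_of (ascents n w) b"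
  shows "w b < w a"
proof -
  let ?D = "ascents n w"
  have "finite ?D" using finite_subset[OF ascents_subset] by simp
  then have "{d \<in> ?D. d < a} = {d \<in> ?D. d < b}"
    by (intro card_subset_eq) (use assms in \<open>auto simp: row_of_def\<close>)
  note eq = this
  have nin: "j \<notin> ?D" if "a \<le> j" "j < b" for j
  proof
    assume "j \<in> ?D"
    then have "j \<in> {d \<in> ?D. d < b}" using that(2) by simp
    then show False unfolding eq[symmetric] using that(1) by simp
  qed
  have "w j < w a" if "a < j" "j \<le> b" for j
    using that
  proof (induction j)
    case (Suc j)
    have "w j \<noteq> w (Suc j)" using permutes_inj[OF perm_setD[OF assms(1)]] by (metis injD n_not_Suc_n)
    moreover have "\<not> w j < w (Suc j)" using nin[of j] Suc.prems assms(3,4) by (auto simp: ascents_def)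
    ultimately have "w (Suc j) < w j" by simp
    then show ?case using Suc by (cases "a = j") auto
  qed simp
  then show ?thesis using assms(2) by simp
qed

text \<open>A numerical substitute for the dominance order: it depends on the tabloid only and grows
  as large letters move to rows with a larger number.\<close>

definition row_energy :: "nat \<Rightarrow> nat set \<Rightarrow> (nat \<Rightarrow> nat) \<Rightarrow> nat" where
  "row_energy n D u = (\<Sum>p=1..n. u p * row_of D p)"

lemma row_energy_tabloid:
  assumes "x \<in> perm_set n" "y \<in> perm_set n" "word_tabloid n D x = word_tabloid n D y"
  shows "row_energy n D x = row_energy n D y"
proof -
  let ?t = "inv y \<circ> x"
  have t: "?t \<in> row_group n D" using word_tabloid_eq_iff assms by blast
  have "row_energy n D x = (\<Sum>p=1..n. y (?t p) * row_of D (?t p))"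
    unfolding row_energy_def using t
    by (intro sum.cong refl) (simp add: stab_def perm_set_cancel[OF assms(2)])
  also have "\<dots> = row_energy n D y"
    unfolding row_energy_def
    using sum.permute[OF perm_setD[OF stab_perm[OF t]], of "\<lambda>p. y p * row_of D p"] by (simp add: o_def)
  finally show ?thesis .
qed

text \<open>Rearrangement inequality: a column permutation that is not the identity has an inversion in
  some column, and undoing it increases the energy.\<close>

lemma row_energy_col:
  assumes w: "w \<in> perm_set n" and \<rho>: "\<rho> \<in> col_group n (ascents n w)" "\<rho> \<noteq> id"
  shows "row_energy n (ascents n w) (w \<circ> \<rho>) < row_energy n (ascents n w) w"
proof -
  let ?D = "ascents n w" and ?C = "col_group n (ascents n w)"
  let ?e = "\<lambda>\<rho>. row_energy n (ascents n w) (w \<circ> \<rho>)"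
  have improve: "\<exists>\<rho>'\<in>?C. ?e \<rho> < ?e \<rho>'" if \<rho>: "\<rho> \<in> ?C" "\<rho> \<noteq> id" for \<rho>
  proof -
    obtain p q where pq: "p \<in> {1..n}" "q \<in> {1..n}" "p < q" "col_of n ?D p = col_of n ?D q" "\<rho> p > \<rho> q"
      using stab_inversion[OF \<rho>] by blast
    let ?t = "transpose p q"
    have t: "?t \<in> ?C" using pq perm_set_transpose[of p n q] by (auto simp: stab_def Transposition.transpose_def)
    have im: "\<rho> p \<in> {1..n}" "\<rho> q \<in> {1..n}" using perm_set_image[OF stab_perm[OF \<rho>(1)]] pq by auto
    have "col_of n ?D (\<rho> p) = col_of n ?D (\<rho> q)" using \<rho>(1) pq by (auto simp: stab_def)
    then have wlt: "w (\<rho> q) < w (\<rho> p)" using same_col(1)[OF pq(5), of n w] im by simp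
    have rlt: "row_of ?D p < row_of ?D q" using same_col(2)[OF pq(3), of n w] pq by simp
    have split: "(\<Sum>x=1..n. F x) = F p + F q + (\<Sum>x\<in>{1..n} - {p, q}. F x)" for F :: "nat \<Rightarrow> nat"
    proof -
      have "(\<Sum>x\<in>{1..n} - {p}. F x) = F q + (\<Sum>x\<in>{1..n} - {p} - {q}. F x)"
        using pq by (intro sum.remove) auto
      moreover have "{1..n} - {p} - {q} = {1..n} - {p, q}" by auto
      ultimately show ?thesis using sum.remove[of "{1..n}" p F] pq by simp
    qed
    obtain k where k: "w (\<rho> p) = w (\<rho> q) + Suc k" using wlt less_iff_Suc_add by auto
    obtain l where l: "row_of ?D q = row_of ?D p + Suc l" using rlt less_iff_Suc_add by auto
    have "(\<Sum>x\<in>{1..n} - {p, q}. (w \<circ> (\<rho> \<circ> ?t)) x * row_of ?D x) = (\<Sum>x\<in>{1..n} - {p, q}. (w \<circ> \<rho>) x * row_of ?D x)"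
      by (intro sum.cong refl) auto
    then have "?e \<rho> < ?e (\<rho> \<circ> ?t)"
      unfolding row_energy_def split by (simp add: k l algebra_simps)
    then show ?thesis using stab_comp[OF \<rho>(1) t] by blast
  qed
  have "finite (?e ` ?C)" "?e ` ?C \<noteq> {}" using id_stab by auto
  then obtain m where m: "m \<in> ?C" "?e m = Max (?e ` ?C)" using Max_in by (metis (no_types, lifting) imageE)
  have max: "?e \<rho>' \<le> ?e m" if "\<rho>' \<in> ?C" for \<rho>' unfolding m(2) using that by simp
  have "m = id" using improve[OF m(1)] max by (meson not_less)
  then show ?thesis using improve[OF \<rho>] max by (metis comp_id order_less_le_trans)
qed

text \<open>Words with one tabloid differ by a row permutation. Unless it is the identity, it has an
  inversion within some row, although both words decrease along the positions of every row.\<close>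

lemma tabloid_ascents_inj:
  assumes w: "w \<in> perm_set n" and v: "v \<in> perm_set n" and e: "ascents n w = ascents n v"
    and t: "word_tabloid n (ascents n v) w = word_tabloid n (ascents n v) v"
  shows "w = v"
proof (rule ccontr)
  assume ne: "w \<noteq> v"
  let ?t = "inv v \<circ> w"
  have tr: "?t \<in> row_group n (ascents n v)" using t word_tabloid_eq_iff[OF w v] by simp
  have "w = v \<circ> ?t" by (rule perm_set_cancel(1)[OF v, symmetric])
  then have "?t \<noteq> id" using ne by (metis comp_id)
  from stab_inversion[OF tr this] obtain p q where
    pq: "p \<in> {1..n}" "q \<in> {1..n}" "p < q" "row_of (ascents n v) p = row_of (ascents n v) q" "?t p > ?t q" by blast
  have im: "?t p \<in> {1..n}" "?t q \<in> {1..n}" using perm_set_image[OF stab_perm[OF tr]] pq by auto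
  have "w q < w p" using same_row[OF w pq(3)] pq e by simp
  moreover have "row_of (ascents n v) (?t q) = row_of (ascents n v) (?t p)" using tr pq by (auto simp: stab_def)
  then have "v (?t p) < v (?t q)" using same_row[OF v pq(5)] im by simp
  ultimately show False using perm_set_cancel(3)[OF v] by simp
qed

definition std_poly :: "nat \<Rightarrow> (nat \<Rightarrow> nat) \<Rightarrow> (nat \<Rightarrow> nat) \<Rightarrow> complex" where
  "std_poly n w = pullpoly n (ascents n w) w"

text \<open>Every term of the polytabloid except that of the identity has smaller energy than
  \<open>v\<close>, so a word of at least that energy can only meet the tabloid of
  \<open>v\<close>.\<close>

lemma std_poly_triangular:
  assumes w: "w \<in> perm_set n" and v: "v \<in> perm_set n" and e: "ascents n w = ascents n v"
    and le: "row_energy n (ascents n v) v \<le> row_energy n (ascents n v) w"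
  shows "std_poly n v w = (if w = v then 1 else 0)"
proof -
  let ?D = "ascents n v"
  have "of_int (sign \<rho>) * (if word_tabloid n ?D w = word_tabloid n ?D (v \<circ> \<rho>) then 1 else 0) =
     (if \<rho> = id then if w = v then 1 else 0 else (0 :: complex))" if r: "\<rho> \<in> col_group n ?D" for \<rho>
  proof (cases "\<rho> = id")
    case True
    then show ?thesis using tabloid_ascents_inj[OF w v e] by auto
  next
    case False
    have "row_energy n ?D (v \<circ> \<rho>) < row_energy n ?D w" using row_energy_col[OF v r False] le by simp
    then have "word_tabloid n ?D w \<noteq> word_tabloid n ?D (v \<circ> \<rho>)"
      using row_energy_tabloid[OF w perm_set_comp[OF v stab_perm[OF r]], of ?D] by auto
    then show ?thesis using False by simp
  qed
  then have "std_poly n v w = (\<Sum>\<rho>\<in>col_group n ?D. if \<rho> = id then if w = v then 1 else 0 else 0)"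
    using w by (simp add: std_poly_def pullpoly_def pull_def word_polytabloid_def)
  then show ?thesis using id_stab[of n "col_of n ?D"] by simp
qed

lemma std_poly_in_poly_space: "w \<in> perm_set n \<Longrightarrow> std_poly n w \<in> poly_space n (ascents n w)"
  unfolding std_poly_def poly_space_def by (intro cfun.span_base) auto

definition words_with :: "nat \<Rightarrow> nat set \<Rightarrow> (nat \<Rightarrow> nat) set" where
  "words_with n D = {w \<in> perm_set n. ascents n w = D}"

lemma finite_words_with [simp]: "finite (words_with n D)"
  by (simp add: words_with_def)

lemma sum_by_ascents:
  "(\<Sum>w\<in>perm_set n. F w) = (\<Sum>D\<in>Pow {1..<n}. \<Sum>w\<in>words_with n D. F w)"
proof -
  have "(\<Sum>D\<in>Pow {1..<n}. \<Sum>w\<in>words_with n D. F w) = (\<Sum>w\<in>(\<Union>D\<in>Pow {1..<n}. words_with n D). F w)"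
    by (rule sum.UNION_disjoint[symmetric]) (auto simp: words_with_def)
  moreover have "(\<Union>D\<in>Pow {1..<n}. words_with n D) = perm_set n"
    using ascents_subset by (fastforce simp: words_with_def)
  ultimately show ?thesis by simp
qed

lemma std_span_subset: "cfun.span (std_poly n ` words_with n D) \<subseteq> poly_space n D"
  unfolding poly_space_def by (rule cfun.span_mono) (auto simp: words_with_def std_poly_def)

text \<open>The relation is evaluated at a word of maximal energy among those with nonzero
  coefficient.\<close>

lemma std_poly_independent_part:
  assumes s: "(\<Sum>w\<in>words_with n D. fscale (c w) (std_poly n w)) = 0" and w: "w \<in> words_with n D"
  shows "c w = 0"
proof (rule ccontr)
  assume "c w \<noteq> 0"
  let ?X = "{v \<in> words_with n D. c v \<noteq> 0}"
  have "finite ?X" "?X \<noteq> {}" using w \<open>c w \<noteq> 0\<close> by auto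
  then have "Max (row_energy n D ` ?X) \<in> row_energy n D ` ?X" by (intro Max_in) auto
  then obtain m where m1: "m \<in> ?X" "Max (row_energy n D ` ?X) = row_energy n D m" by (rule imageE)
  have m: "m \<in> ?X" "\<And>v. v \<in> ?X \<Longrightarrow> row_energy n D v \<le> row_energy n D m"
    using m1(1) \<open>finite ?X\<close> unfolding m1(2)[symmetric] by (auto intro!: Max_ge)
  have "0 = (\<Sum>v\<in>words_with n D. c v * std_poly n v m)"
    using fun_cong[OF s, of m] by (simp add: sum_fun_apply)
  also have "\<dots> = (\<Sum>v\<in>words_with n D. if v = m then c m else 0)"
  proof (intro sum.cong refl)
    fix v assume v: "v \<in> words_with n D"
    show "c v * std_poly n v m = (if v = m then c m else 0)"
    proof (cases "c v = 0")
      case False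
      then have "row_energy n D v \<le> row_energy n D m" using m(2) v by simp
      then show ?thesis using std_poly_triangular[of m n v] v m(1) by (auto simp: words_with_def)
    qed auto
  qed
  also have "\<dots> = c m" using m(1) by simp
  finally show False using m(1) by simp
qed

text \<open>Different break sets are separated by \<open>poly_space_direct\<close>, words with the
  same break set by triangularity.\<close>

lemma std_poly_family:
  shows "inj_on (std_poly n) (perm_set n)" "cfun.independent (std_poly n ` perm_set n)"
proof -
  have "c w = 0" if s: "(\<Sum>w\<in>perm_set n. fscale (c w) (std_poly n w)) = 0" and w: "w \<in> perm_set n" for c w
  proof -
    let ?f = "\<lambda>D. \<Sum>w\<in>words_with n D. fscale (c w) (std_poly n w)"
    have "?f (ascents n w) = 0"
    proof (rule poly_space_direct[where P = UNIV and g = 0])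
      show "?f D \<in> poly_space n D" for D
        using std_span_subset[of n D] by (intro subsetD[OF std_span_subset] cfun.span_sum cfun.span_scale cfun.span_base) auto
      show "(\<Sum>D\<in>Pow {1..<n}. ?f D) = 0" using s unfolding sum_by_ascents .
    qed (simp_all add: col_antisym_def ascents_subset del: One_nat_def)
    then show ?thesis by (rule std_poly_independent_part) (use w in \<open>simp add: words_with_def\<close>)
  qed
  then show "inj_on (std_poly n) (perm_set n)" "cfun.independent (std_poly n ` perm_set n)"
    using independent_family[of "perm_set n" "std_poly n"] by auto
qed

lemma row_space_support: "f \<in> row_space n D \<Longrightarrow> f \<in> cfun.span (delta ` perm_set n)"
  by (simp add: span_delta row_space_def)

text \<open>Dimension count: there are as many standard polytabloids as words.\<close>

lemma span_std_poly: "cfun.span (std_poly n ` perm_set n) = cfun.span (delta ` perm_set n)"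
proof (rule span_eq_if_card_ge[OF std_poly_family(2)])
  show "std_poly n ` perm_set n \<subseteq> cfun.span (delta ` perm_set n)"
    using std_poly_in_poly_space poly_space_subset row_space_support by blast
  show "card (delta ` perm_set n) \<le> card (std_poly n ` perm_set n)"
    using std_poly_family(1) by (simp add: card_image card_image_le)
qed simp

lemma decompose_by_ascents:
  assumes "f \<in> row_space n D"
  shows "\<exists>g. (\<forall>E. g E \<in> cfun.span (std_poly n ` words_with n E)) \<and> f = (\<Sum>E\<in>Pow {1..<n}. g E)"
proof -
  have "f \<in> cfun.span (std_poly n ` perm_set n)" unfolding span_std_poly by (rule row_space_support[OF assms])
  then obtain c where "f = (\<Sum>v\<in>std_poly n ` perm_set n. fscale (c v) v)"
    by (auto simp: cfun.span_finite)
  then have "f = (\<Sum>w\<in>perm_set n. fscale (c (std_poly n w)) (std_poly n w))"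
    using std_poly_family(1) by (simp add: sum.reindex)
  then have "f = (\<Sum>D\<in>Pow {1..<n}. \<Sum>w\<in>words_with n D. fscale (c (std_poly n w)) (std_poly n w))"
    unfolding sum_by_ascents .
  moreover have "(\<Sum>w\<in>words_with n E. fscale (c (std_poly n w)) (std_poly n w)) \<in> cfun.span (std_poly n ` words_with n E)" for E
    by (intro cfun.span_sum cfun.span_scale cfun.span_base) auto
  ultimately show ?thesis
    by (intro exI[of _ "\<lambda>E. \<Sum>w\<in>words_with n E. fscale (c (std_poly n w)) (std_poly n w)"]) blast
qed

text \<open>The decomposition of \<open>f\<close> into standard components is compared with the
  trivial one, which has \<open>f\<close> in place \<open>D\<close> and zero elsewhere; by
  directness they agree at \<open>D\<close>. This takes the place of the Garnir relations.\<close>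

lemma poly_space_eq_span:
  assumes D: "D \<subseteq> {1..<n}"
  shows "poly_space n D = cfun.span (std_poly n ` words_with n D)"
proof
  show "poly_space n D \<subseteq> cfun.span (std_poly n ` words_with n D)"
  proof
    fix f assume f: "f \<in> poly_space n D"
    from decompose_by_ascents[OF subsetD[OF poly_space_subset f]]
    obtain g where g: "\<And>E. g E \<in> cfun.span (std_poly n ` words_with n E)" "f = (\<Sum>E\<in>Pow {1..<n}. g E)"
      by blast
    define h where "h E = g E - (if E = D then f else 0)" for E
    have "h D = 0"
    proof (rule poly_space_direct[where P = UNIV and g = 0 and f = h])
      show "h E \<in> poly_space n E" for E
        using subsetD[OF std_span_subset g(1)] f cfun.span_diff unfolding poly_space_def h_def by auto
      show "(\<Sum>E\<in>Pow {1..<n}. h E) = 0"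
        using g(2) D by (simp add: h_def sum_subtractf)
    qed (use D in \<open>simp_all add: col_antisym_def\<close>)
    then have "g D = f" by (simp add: h_def)
    then show "f \<in> cfun.span (std_poly n ` words_with n D)" using g(1)[of D] by simp
  qed
qed (rule std_span_subset)

text \<open>The sets not contained in \<open>F\<close> are closed upwards, and their
  antisymmetrizers annihilate a row function of \<open>F\<close>; so its components at these sets
  vanish.\<close>

lemma row_space_eq_span:
  assumes F: "F \<subseteq> {1..<n}"
  shows "row_space n F = cfun.span (\<Union>D\<in>Pow F. std_poly n ` words_with n D)"
proof
  have fin: "finite F" using F finite_subset by auto
  show "cfun.span (\<Union>D\<in>Pow F. std_poly n ` words_with n D) \<subseteq> row_space n F"
  proof (rule cfun.span_minimal[OF _ subspace_row_space], clarify)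
    fix D w assume "D \<subseteq> F" and w: "w \<in> words_with n D"
    then have "row_space n D \<subseteq> row_space n F" using row_space_mono[OF fin] by blast
    moreover have "std_poly n w \<in> row_space n D"
      using std_poly_in_poly_space[of w n] poly_space_subset[of n D] w by (auto simp: words_with_def)
    ultimately show "std_poly n w \<in> row_space n F" by blast
  qed
  show "row_space n F \<subseteq> cfun.span (\<Union>D\<in>Pow F. std_poly n ` words_with n D)"
  proof
    fix f assume f: "f \<in> row_space n F"
    from decompose_by_ascents[OF f]
    obtain g where g: "\<And>E. g E \<in> cfun.span (std_poly n ` words_with n E)" "f = (\<Sum>E\<in>Pow {1..<n}. g E)"
      by blast
    have "g D = 0" if "\<not> D \<subseteq> F" "D \<subseteq> {1..<n}" for D
    proof (rule poly_space_direct[where P = "{D. \<not> D \<subseteq> F}" and g = f])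
      show "g E \<in> poly_space n E" for E using g(1) std_span_subset by auto
      show "(\<Sum>E\<in>Pow {1..<n}. g E) = f" using g(2) by simp
      show "col_antisym n E f u = 0" if "E \<in> {D. \<not> D \<subseteq> F}" "E \<subseteq> {1..<n}" "u \<in> perm_set n" for E u
        using col_antisym_row_space[OF f] that by auto
    qed (use that in auto)
    then have "f = (\<Sum>E\<in>Pow F. g E)"
      unfolding g(2) using F by (intro sum.mono_neutral_right) auto
    also have "\<dots> \<in> cfun.span (\<Union>D\<in>Pow F. std_poly n ` words_with n D)"
    proof (rule cfun.span_sum)
      fix E assume "E \<in> Pow F"
      then have "cfun.span (std_poly n ` words_with n E) \<subseteq> cfun.span (\<Union>D\<in>Pow F. std_poly n ` words_with n D)"
        by (intro cfun.span_mono) auto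
      then show "g E \<in> cfun.span (\<Union>D\<in>Pow F. std_poly n ` words_with n D)" using g(1) by auto
    qed
    finally show "f \<in> cfun.span (\<Union>D\<in>Pow F. std_poly n ` words_with n D)" .
  qed
qed

section \<open>The action of the symmetric group and its traces\<close>

lemma clinear_left_act: "clinear (left_act \<pi>)"
  by (rule clinearI) (auto simp: left_act_def fun_eq_iff)

lemma clinear_perm_act: "clinear (perm_act \<pi>)"
  by (rule clinearI) (auto simp: perm_act_def fun_eq_iff)

lemma clinear_pull: "clinear (pull n D)"
  by (rule clinearI) (auto simp: pull_def fun_eq_iff)

lemma inv_comp_in_perm_set_iff:
  assumes "\<pi> \<in> perm_set n"
  shows "inv \<pi> \<circ> u \<in> perm_set n \<longleftrightarrow> u \<in> perm_set n"
  using perm_set_comp[OF assms, of "inv \<pi> \<circ> u"] perm_set_comp[OF perm_set_inv[OF assms], of u]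
    perm_set_cancel(1)[OF assms, of u] by auto

lemma word_tabloid_inv_comp:
  assumes \<pi>: "\<pi> \<in> perm_set n" and u: "u \<in> perm_set n"
  shows "word_tabloid n D (inv \<pi> \<circ> u) = word_tabloid n D u \<circ> \<pi>"
proof
  fix x
  have "inv (inv \<pi> \<circ> u) = inv u \<circ> \<pi>"
    using permutes_bij[OF perm_setD[OF u]] permutes_bij[OF perm_setD[OF perm_set_inv[OF \<pi>]]]
      permutes_inv_inv[OF perm_setD[OF \<pi>]] by (simp add: o_inv_distrib)
  moreover have "\<pi> x \<in> {1..n} \<longleftrightarrow> x \<in> {1..n}" by (rule permutes_in_image[OF perm_setD[OF \<pi>]])
  ultimately show "word_tabloid n D (inv \<pi> \<circ> u) x = (word_tabloid n D u \<circ> \<pi>) x"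
    by (simp add: word_tabloid_def restrict_def)
qed

lemma word_tabloid_comp:
  assumes \<pi>: "\<pi> \<in> perm_set n" and u: "u \<in> perm_set n"
  shows "word_tabloid n D (\<pi> \<circ> u) \<circ> \<pi> = word_tabloid n D u"
  using word_tabloid_inv_comp[OF \<pi> perm_set_comp[OF \<pi> u], of D] by (simp add: perm_set_cancel[OF \<pi>])

lemma comp_eq_word_tabloid_iff:
  assumes \<pi>: "\<pi> \<in> perm_set n" and u: "u \<in> perm_set n"
  shows "T \<circ> \<pi> = word_tabloid n D u \<longleftrightarrow> T = word_tabloid n D (\<pi> \<circ> u)"
proof
  assume "T \<circ> \<pi> = word_tabloid n D u"
  then have "T \<circ> \<pi> = word_tabloid n D (\<pi> \<circ> u) \<circ> \<pi>" using word_tabloid_comp[OF assms] by simp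
  then show "T = word_tabloid n D (\<pi> \<circ> u)"
    using permutes_surj[OF perm_setD[OF \<pi>]] by (simp add: fun.inj_map_strong fun_eq_iff) (metis surjD)
qed (simp add: word_tabloid_comp[OF assms])

lemma perm_act_word_polytabloid:
  assumes \<pi>: "\<pi> \<in> perm_set n" and u: "u \<in> perm_set n"
  shows "perm_act \<pi> (word_polytabloid n D u) = word_polytabloid n D (\<pi> \<circ> u)"
  unfolding perm_act_def word_polytabloid_def
  by (intro ext sum.cong refl)
    (simp add: comp_eq_word_tabloid_iff[OF \<pi> perm_set_comp[OF u stab_perm]] comp_assoc)

lemma pull_perm_act:
  assumes \<pi>: "\<pi> \<in> perm_set n"
  shows "pull n D (perm_act \<pi> f) = left_act \<pi> (pull n D f)"
  using inv_comp_in_perm_set_iff[OF \<pi>]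
  by (auto simp: pull_def perm_act_def left_act_def fun_eq_iff word_tabloid_inv_comp[OF \<pi>])

lemma perm_act_span_poly:
  assumes \<pi>: "\<pi> \<in> perm_set n" and f: "f \<in> cfun.span (word_polytabloid n D ` perm_set n)"
  shows "perm_act \<pi> f \<in> cfun.span (word_polytabloid n D ` perm_set n)"
proof -
  interpret A: Vector_Spaces.linear fscale fscale "perm_act \<pi>" by (rule clinear_perm_act)
  have "perm_act \<pi> ` word_polytabloid n D ` perm_set n \<subseteq> word_polytabloid n D ` perm_set n"
    using perm_act_word_polytabloid[OF \<pi>] perm_set_comp[OF \<pi>] by auto
  then have "cfun.span (perm_act \<pi> ` word_polytabloid n D ` perm_set n) \<subseteq> cfun.span (word_polytabloid n D ` perm_set n)"
    by (rule cfun.span_mono)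
  then show ?thesis using A.span_image[of "word_polytabloid n D ` perm_set n"] f by auto
qed

lemma poly_space_eq_pull: "poly_space n D = pull n D ` cfun.span (word_polytabloid n D ` perm_set n)"
proof -
  interpret A: Vector_Spaces.linear fscale fscale "pull n D" by (rule clinear_pull)
  show ?thesis unfolding A.span_image[symmetric] poly_space_def by (simp add: pullpoly_def[abs_def] image_image)
qed

text \<open>\<open>pull\<close> sees only the values at tabloids of words, so the functions are
  restricted to those supported there; the spans of polytabloids are among them.\<close>

lemma inj_on_pull: "inj_on (pull n D) (cfun.span (delta ` word_tabloid n D ` perm_set n))"
proof (rule inj_onI)
  fix f g assume fg: "f \<in> cfun.span (delta ` word_tabloid n D ` perm_set n)"
    "g \<in> cfun.span (delta ` word_tabloid n D ` perm_set n)" and e: "pull n D f = pull n D g"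
  show "f = g"
  proof
    fix T show "f T = g T"
    proof (cases "T \<in> word_tabloid n D ` perm_set n")
      case True
      then obtain u where "u \<in> perm_set n" "T = word_tabloid n D u" by auto
      then show ?thesis using fun_cong[OF e, of u] by (simp add: pull_def)
    next
      case False
      then show ?thesis using fg by (simp add: span_delta)
    qed
  qed
qed

lemma span_word_polytabloid_subset:
  "cfun.span (word_polytabloid n D ` perm_set n) \<subseteq> cfun.span (delta ` word_tabloid n D ` perm_set n)"
proof (rule cfun.span_minimal[OF _ cfun.subspace_span], clarify)
  fix u assume u: "u \<in> perm_set n"
  have "word_tabloid n D (u \<circ> \<rho>) \<in> word_tabloid n D ` perm_set n" if "\<rho> \<in> col_group n D" for \<rho>
    using perm_set_comp[OF u stab_perm[OF that]] by auto
  then show "word_polytabloid n D u \<in> cfun.span (delta ` word_tabloid n D ` perm_set n)"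
    unfolding span_delta[OF finite_imageI[OF finite_perm_set]] word_polytabloid_def
    by (auto intro!: sum.neutral)
qed

lemma trace_poly_space:
  assumes \<pi>: "\<pi> \<in> perm_set n"
  shows "trace_on (poly_space n D) (left_act \<pi>) =
    trace_on (cfun.span (word_polytabloid n D ` perm_set n)) (perm_act \<pi>)"
  unfolding poly_space_eq_pull
  by (rule trace_on_transfer[OF clinear_perm_act clinear_left_act clinear_pull _
        inj_on_subset[OF inj_on_pull span_word_polytabloid_subset] perm_act_span_poly[OF \<pi>]])
    (simp_all add: pull_perm_act[OF \<pi>])

lemma row_space_eq_pull: "row_space n D = pull n D ` cfun.span (delta ` word_tabloid n D ` perm_set n)"
proof
  show "row_space n D \<subseteq> pull n D ` cfun.span (delta ` word_tabloid n D ` perm_set n)"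
  proof
    fix f assume f: "f \<in> row_space n D"
    define pick where "pick = inv_into (perm_set n) (word_tabloid n D)"
    define g where "g T = (if T \<in> word_tabloid n D ` perm_set n then f (pick T) else 0)" for T
    have "f = pull n D g"
    proof
      fix u show "f u = pull n D g u"
      proof (cases "u \<in> perm_set n")
        case True
        then have T: "word_tabloid n D u \<in> word_tabloid n D ` perm_set n" by auto
        have "f u = f (pick (word_tabloid n D u))"
          by (rule row_space_eq[OF f True]) (simp_all add: pick_def inv_into_into[OF T] f_inv_into_f[OF T])
        then show ?thesis using True T by (simp add: pull_def g_def)
      next
        case False
        then show ?thesis using row_space_outside[OF f] by (simp add: pull_def)
      qed
    qed
    moreover have "g \<in> cfun.span (delta ` word_tabloid n D ` perm_set n)"
      by (simp add: span_delta g_def)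
    ultimately show "f \<in> pull n D ` cfun.span (delta ` word_tabloid n D ` perm_set n)" by blast
  qed
qed (use pull_in_row_space in auto)

text \<open>The row space is the permutation module on tabloids, whose character counts fixed
  points; \<open>\<pi>\<close> and \<open>inv \<pi>\<close> fix the same ones.\<close>

lemma trace_row_space_fixed:
  assumes \<pi>: "\<pi> \<in> perm_set n"
  shows "trace_on (row_space n D) (left_act \<pi>) =
    of_nat (card {T \<in> word_tabloid n D ` perm_set n. T \<circ> \<pi> = T})"
proof -
  let ?X = "word_tabloid n D ` perm_set n"
  interpret A: Vector_Spaces.linear fscale fscale "perm_act \<pi>" by (rule clinear_perm_act)
  note c = permutes_inv_o[OF perm_setD[OF \<pi>]]
  have comp_iff: "S \<circ> \<pi> = T \<longleftrightarrow> S = T \<circ> inv \<pi>" for S T :: tabloid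
    by (metis c comp_assoc comp_id)
  have s: "perm_act \<pi> (delta T) = delta (T \<circ> inv \<pi>)" for T
    by (auto simp: perm_act_def delta_def fun_eq_iff[of "\<lambda>x. if _ x then _ else _"] comp_iff)
  have X: "T \<circ> inv \<pi> \<in> ?X" if T: "T \<in> ?X" for T
  proof -
    obtain u where "u \<in> perm_set n" "T = word_tabloid n D u" using T by auto
    moreover from this have "T \<circ> inv \<pi> = word_tabloid n D (\<pi> \<circ> u)"
      using word_tabloid_comp[OF \<pi>] comp_iff by metis
    ultimately show ?thesis using perm_set_comp[OF \<pi>] by auto
  qed
  have inv: "perm_act \<pi> f \<in> cfun.span (delta ` ?X)" if "f \<in> cfun.span (delta ` ?X)" for f
  proof -
    have "perm_act \<pi> ` delta ` ?X \<subseteq> delta ` ?X" using s X by auto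
    then have "cfun.span (perm_act \<pi> ` delta ` ?X) \<subseteq> cfun.span (delta ` ?X)" by (rule cfun.span_mono)
    then show ?thesis using A.span_image[of "delta ` ?X"] that by auto
  qed
  have "trace_on (row_space n D) (left_act \<pi>) = trace_on (cfun.span (delta ` ?X)) (perm_act \<pi>)"
    unfolding row_space_eq_pull
    by (rule trace_on_transfer[OF clinear_perm_act clinear_left_act clinear_pull _ inj_on_pull inv])
      (simp_all add: pull_perm_act[OF \<pi>])
  also have "\<dots> = of_nat (card {T \<in> ?X. T \<circ> inv \<pi> = T})"
    by (rule trace_on_delta[OF _ clinear_perm_act s X]) simp_all
  also have "{T \<in> ?X. T \<circ> inv \<pi> = T} = {T \<in> ?X. T \<circ> \<pi> = T}" using comp_iff by metis
  finally show ?thesis .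
qed

lemma left_act_poly_space:
  assumes \<pi>: "\<pi> \<in> perm_set n" and f: "f \<in> poly_space n D"
  shows "left_act \<pi> f \<in> poly_space n D"
  using f perm_act_span_poly[OF \<pi>] pull_perm_act[OF \<pi>, symmetric] unfolding poly_space_eq_pull by auto

text \<open>The tabloid module with row break set \<open>F\<close> is the direct sum of the modules of the border
  shapes with break sets \<open>D \<subseteq> F\<close>.\<close>

lemma fixed_tabloids_eq_sum_traces:
  assumes \<pi>: "\<pi> \<in> perm_set n" and F: "F \<subseteq> {1..<n}"
  shows "of_nat (card {T \<in> word_tabloid n F ` perm_set n. T \<circ> \<pi> = T}) =
    (\<Sum>D\<in>Pow F. trace_on (cfun.span (word_polytabloid n D ` perm_set n)) (perm_act \<pi>))"
proof -
  let ?B = "\<lambda>D. std_poly n ` words_with n D"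
  have fin: "finite F" using F finite_subset by auto
  have sp: "cfun.span (?B D) = poly_space n D" if "D \<in> Pow F" for D
    using poly_space_eq_span[of D n] that F by blast
  have "trace_on (cfun.span (\<Union>D\<in>Pow F. ?B D)) (left_act \<pi>) = (\<Sum>D\<in>Pow F. trace_on (cfun.span (?B D)) (left_act \<pi>))"
  proof (rule trace_on_direct_sum[OF clinear_left_act])
    show "cfun.independent (\<Union>D\<in>Pow F. ?B D)"
      by (rule cfun.independent_mono[OF std_poly_family(2)[of n]]) (auto simp: words_with_def)
    show "?B D \<inter> ?B E = {}" if "D \<noteq> E" for D E
      using that std_poly_family(1)[of n] by (auto simp: words_with_def inj_on_def)
    show "left_act \<pi> v \<in> cfun.span (?B D)" if "D \<in> Pow F" "v \<in> cfun.span (?B D)" for D v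
      using left_act_poly_space[OF \<pi>] that(2) unfolding sp[OF that(1)] by blast
  qed (use fin in auto)
  then show ?thesis
    unfolding row_space_eq_span[OF F, symmetric] trace_row_space_fixed[OF \<pi>]
    by (simp add: sp trace_poly_space[OF \<pi>])
qed

section \<open>The Worpitzky identity\<close>

lemma row_of_Suc:
  assumes "finite D"
  shows "row_of D (Suc p) = (if p \<in> D then Suc (row_of D p) else row_of D p)"
proof -
  have "{d \<in> D. d < Suc p} = (if p \<in> D then insert p {d \<in> D. d < p} else {d \<in> D. d < p})"
    by (auto simp: less_Suc_eq)
  then show ?thesis using assms by (simp add: row_of_def)
qed

lemma row_of_mono: "finite D \<Longrightarrow> p \<le> q \<Longrightarrow> row_of D p \<le> row_of D q"
  unfolding row_of_def by (rule card_mono) auto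

lemma row_of_first: "D \<subseteq> {1..<n} \<Longrightarrow> row_of D 1 = 0"
  by (auto simp: row_of_def)

lemma row_of_last: "D \<subseteq> {1..<n} \<Longrightarrow> row_of D n = card D"
  unfolding row_of_def by (rule arg_cong[where f = card]) auto

text \<open>Row numbers start at 0, end at \<open>card D\<close> and grow by at most one per
  step.\<close>

lemma row_of_image:
  assumes "D \<subseteq> {1..<n}" "n \<ge> 1"
  shows "row_of D ` {1..n} = {..card D}"
proof -
  have fin: "finite D" using assms(1) finite_subset by auto
  have "row_of D ` {1..p} = {..row_of D p}" if "p \<ge> 1" for p
    using that
  proof (induction p rule: nat_induct_at_least)
    case base
    show ?case using row_of_first[OF assms(1)] by simp
  next
    case (Suc p)
    have "{1..Suc p} = insert (Suc p) {1..p}" by auto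
    then show ?case using Suc row_of_Suc[OF fin, of p] by (auto simp: atMost_Suc)
  qed
  from this[OF assms(2)] show ?thesis using row_of_last[OF assms(1)] by simp
qed

lemma row_of_determines:
  assumes D: "D \<subseteq> {1..<n}" and E: "E \<subseteq> {1..<n}" and row: "\<And>p. p \<in> {1..n} \<Longrightarrow> row_of D p = row_of E p"
  shows "D = E"
proof -
  have fin: "finite D" "finite E" using D E finite_subset by auto
  have "p \<in> D \<longleftrightarrow> p \<in> E" if "p \<in> {1..<n}" for p
    using row_of_Suc[OF fin(1), of p] row_of_Suc[OF fin(2), of p] row[of p] row[of "Suc p"] that
    by (auto split: if_splits)
  then show ?thesis using D E by blast
qed

text \<open>For \<open>R = {..d}\<close> these are the fixed tabloids with \<open>d + 1\<close>
  rows, over all break sets of size \<open>d\<close>; \<open>extensional\<close> matches the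
  \<open>restrict\<close> in \<open>word_tabloid\<close>.\<close>

definition fixed_surj :: "nat \<Rightarrow> (nat \<Rightarrow> nat) \<Rightarrow> nat set \<Rightarrow> (nat \<Rightarrow> nat) set" where
  "fixed_surj n \<pi> R = {f \<in> extensional {1..n}. f ` {1..n} = R \<and> (\<forall>x\<in>{1..n}. f (\<pi> x) = f x)}"

lemma finite_fixed_surj:
  assumes "finite R"
  shows "finite (fixed_surj n \<pi> R)"
proof (rule finite_subset)
  show "fixed_surj n \<pi> R \<subseteq> {1..n} \<rightarrow>\<^sub>E R" by (auto simp: fixed_surj_def PiE_def)
qed (use assms in \<open>simp add: finite_PiE\<close>)

lemma word_tabloid_surj:
  assumes F: "F \<subseteq> {1..<n}" and n: "n \<ge> 1" and u: "u \<in> perm_set n"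
  shows "word_tabloid n F u ` {1..n} = {..card F}" "word_tabloid n F u \<in> extensional {1..n}"
proof -
  have "word_tabloid n F u ` {1..n} = row_of F ` inv u ` {1..n}"
    by (auto simp: word_tabloid_def)
  also have "inv u ` {1..n} = {1..n}" by (rule permutes_image[OF perm_setD[OF perm_set_inv[OF u]]])
  finally show "word_tabloid n F u ` {1..n} = {..card F}" using row_of_image[OF F n] by simp
  show "word_tabloid n F u \<in> extensional {1..n}" by (simp add: word_tabloid_def)
qed

text \<open>The number of entries in rows up to \<open>r\<close> depends on the break set alone, and
  it is the last position of these rows.\<close>

lemma word_tabloid_determines_breaks:
  assumes F: "F \<subseteq> {1..<n}" and G: "G \<subseteq> {1..<n}" and u: "u \<in> perm_set n" and v: "v \<in> perm_set n"
    and e: "word_tabloid n F u = word_tabloid n G v"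
  shows "F = G"
proof -
  have fin: "finite F" "finite G" using F G finite_subset by auto
  have cnt: "card {x \<in> {1..n}. word_tabloid n H w x \<le> r} = card {p \<in> {1..n}. row_of H p \<le> r}"
    if w: "w \<in> perm_set n" for H w r
  proof (rule bij_betw_same_card[of "inv w"], rule bij_betw_byWitness[where f' = w])
    show "inv w ` {x \<in> {1..n}. word_tabloid n H w x \<le> r} \<subseteq> {p \<in> {1..n}. row_of H p \<le> r}"
      using perm_set_image[OF perm_set_inv[OF w]] by (auto simp: word_tabloid_def)
    show "w ` {p \<in> {1..n}. row_of H p \<le> r} \<subseteq> {x \<in> {1..n}. word_tabloid n H w x \<le> r}"
      using perm_set_image[OF w] perm_set_cancel(4)[OF w] by (auto simp: word_tabloid_def)
  qed (simp_all add: perm_set_cancel[OF w])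
  have seg: "row_of H p \<le> r \<longleftrightarrow> p \<le> card {p \<in> {1..n}. row_of H p \<le> r}"
    if fH: "finite H" and p: "p \<in> {1..n}" for H p r
  proof
    assume "row_of H p \<le> r"
    then have "row_of H q \<le> r" if "q \<le> p" for q using row_of_mono[OF fH that] by simp
    then have "{1..p} \<subseteq> {p \<in> {1..n}. row_of H p \<le> r}" using p by auto
    from card_mono[OF _ this] show "p \<le> card {p \<in> {1..n}. row_of H p \<le> r}" by simp
  next
    assume le: "p \<le> card {p \<in> {1..n}. row_of H p \<le> r}"
    show "row_of H p \<le> r"
    proof (rule ccontr)
      assume "\<not> row_of H p \<le> r"
      have "q < p" if "row_of H q \<le> r" for q
        using row_of_mono[OF fH, of p q] \<open>\<not> row_of H p \<le> r\<close> that by (meson not_less order_trans)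
      then have "{p \<in> {1..n}. row_of H p \<le> r} \<subseteq> {1..<p}" by auto
      from card_mono[OF _ this] have "card {p \<in> {1..n}. row_of H p \<le> r} \<le> p - 1" by simp
      with le have "p \<le> p - 1" by (rule order_trans)
      moreover have "1 \<le> p" using p by simp
      ultimately show False by linarith
    qed
  qed
  have "row_of F p \<le> r \<longleftrightarrow> row_of G p \<le> r" if p: "p \<in> {1..n}" for p r
    unfolding seg[OF fin(1) p] seg[OF fin(2) p] using cnt[OF u, of F r] cnt[OF v, of G r] e by simp
  then have "row_of F p = row_of G p" if "p \<in> {1..n}" for p
    using that by (metis order_antisym order_refl)
  then show ?thesis by (rule row_of_determines[OF F G])
qed

text \<open>\<open>u\<close> lists the entries sorted by row, and the breaks are the places where
  the row changes. As every row up to \<open>d\<close> is attained, each change is by exactly one,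
  so \<open>row_of F\<close> recovers the row.\<close>

lemma surj_is_word_tabloid:
  assumes n: "n \<ge> 1" and T: "T \<in> extensional {1..n}" "T ` {1..n} = {..d}"
  shows "\<exists>F u. F \<subseteq> {1..<n} \<and> card F = d \<and> u \<in> perm_set n \<and> T = word_tabloid n F u"
proof -
  from sorting_perm[of n T] obtain u where u: "u \<in> perm_set n"
      "\<forall>v\<in>{1..n}. \<forall>w\<in>{1..n}. inv u v < inv u w \<longleftrightarrow> T v < T w \<or> T v = T w \<and> v < w" by blast
  have mono: "T (u p) \<le> T (u q)" if "p \<in> {1..n}" "q \<in> {1..n}" "p \<le> q" for p q
  proof (cases "p = q")
    case False
    have im: "u p \<in> {1..n}" "u q \<in> {1..n}" using perm_set_image[OF u(1)] that by auto
    have "inv u (u p) < inv u (u q)" using False that perm_set_cancel(4)[OF u(1)] by simp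
    then show ?thesis using u(2) im by (metis less_imp_le order_refl)
  qed simp
  have attained: "\<exists>q\<in>{1..n}. T (u q) = r" if "r \<le> d" for r
  proof -
    have "r \<in> T ` {1..n}" using T(2) that by simp
    then obtain x where x: "x \<in> {1..n}" "T x = r" by blast
    then show ?thesis
      using perm_set_image[OF perm_set_inv[OF u(1)]] perm_set_cancel(3)[OF u(1)]
      by (intro bexI[of _ "inv u x"]) auto
  qed
  have bound: "T (u p) \<le> d" if "p \<in> {1..n}" for p
    using T(2) perm_set_image[OF u(1) that] by blast
  define F where "F = {i \<in> {1..<n}. T (u i) \<noteq> T (u (Suc i))}"
  have fin: "finite F" and F: "F \<subseteq> {1..<n}" by (auto simp: F_def)
  have row: "row_of F p = T (u p)" if "p \<ge> 1" "p \<le> n" for p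
    using that
  proof (induction p rule: nat_induct_at_least)
    case base
    obtain q where "q \<in> {1..n}" "T (u q) = 0" using attained[of 0] by auto
    then have "T (u 1) = 0" using mono[of 1 q] n by auto
    then show ?case using row_of_first[OF F] by simp
  next
    case (Suc p)
    then have p: "p \<in> {1..n}" "Suc p \<in> {1..n}" by auto
    have "T (u (Suc p)) \<le> Suc (T (u p))"
    proof (rule ccontr)
      assume a: "\<not> T (u (Suc p)) \<le> Suc (T (u p))"
      then obtain q where q: "q \<in> {1..n}" "T (u q) = Suc (T (u p))"
        using attained[of "Suc (T (u p))"] bound[OF p(2)] by auto
      show False
      proof (cases "q \<le> p")
        case True
        then show False using mono[OF q(1) p(1)] q(2) by simp
      next
        case False
        then show False using mono[OF p(2) q(1)] q(2) a by simp
      qed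
    qed
    moreover have "T (u p) \<le> T (u (Suc p))" using mono[OF p] by simp
    ultimately show ?case using Suc p row_of_Suc[OF fin, of p] by (auto simp: F_def)
  qed
  have "T = word_tabloid n F u"
  proof
    fix x show "T x = word_tabloid n F u x"
    proof (cases "x \<in> {1..n}")
      case True
      then have "inv u x \<in> {1..n}" by (rule perm_set_image[OF perm_set_inv[OF u(1)]])
      then show ?thesis using True row[of "inv u x"] perm_set_cancel(3)[OF u(1)] by (simp add: word_tabloid_def)
    next
      case False
      then show ?thesis using T(1) by (simp add: word_tabloid_def extensional_def del: atLeastAtMost_iff)
    qed
  qed
  moreover have "card F = d"
  proof -
    obtain q where "q \<in> {1..n}" "T (u q) = d" using attained[of d] by auto
    then have "T (u n) = d" using mono[of q n] bound[of n] n by auto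
    then show ?thesis using row[of n] n row_of_last[OF F] by simp
  qed
  ultimately show ?thesis using F u(1) by blast
qed

lemma card_fixed_surj_eq_sum:
  assumes n: "n \<ge> 1" and \<pi>: "\<pi> \<in> perm_set n"
  shows "card (fixed_surj n \<pi> {..d}) =
    (\<Sum>F\<in>{F. F \<subseteq> {1..<n} \<and> card F = d}. card {T \<in> word_tabloid n F ` perm_set n. T \<circ> \<pi> = T})"
proof -
  let ?I = "{F. F \<subseteq> {1..<n} \<and> card F = d}"
  let ?A = "\<lambda>F. {T \<in> word_tabloid n F ` perm_set n. T \<circ> \<pi> = T}"
  have fix_iff: "T \<circ> \<pi> = T \<longleftrightarrow> (\<forall>x\<in>{1..n}. T (\<pi> x) = T x)" for T :: tabloid
    using permutes_not_in[OF perm_setD[OF \<pi>]] by (auto simp: fun_eq_iff)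
  have "fixed_surj n \<pi> {..d} = (\<Union>F\<in>?I. ?A F)"
  proof
    show "fixed_surj n \<pi> {..d} \<subseteq> (\<Union>F\<in>?I. ?A F)"
    proof
      fix T assume T: "T \<in> fixed_surj n \<pi> {..d}"
      then obtain F u where "F \<subseteq> {1..<n}" "card F = d" "u \<in> perm_set n" "T = word_tabloid n F u"
        using surj_is_word_tabloid[OF n, of T d] by (auto simp: fixed_surj_def)
      moreover have "T \<circ> \<pi> = T" using T fix_iff by (simp add: fixed_surj_def)
      ultimately show "T \<in> (\<Union>F\<in>?I. ?A F)" by blast
    qed
    show "(\<Union>F\<in>?I. ?A F) \<subseteq> fixed_surj n \<pi> {..d}"
    proof clarify
      fix F u assume F: "F \<subseteq> {1..<n}" and u: "u \<in> perm_set n"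
        and fx: "word_tabloid n F u \<circ> \<pi> = word_tabloid n F u"
      show "word_tabloid n F u \<in> fixed_surj n \<pi> {..card F}"
        unfolding fixed_surj_def mem_Collect_eq
        using word_tabloid_surj[OF F n u] fx[unfolded fix_iff] by blast
    qed
  qed
  moreover have "card (\<Union>F\<in>?I. ?A F) = (\<Sum>F\<in>?I. card (?A F))"
  proof (rule card_UN_disjoint)
    show "finite ?I" by (rule finite_subset[of _ "Pow {1..<n}"]) auto
    show "\<forall>F\<in>?I. finite (?A F)" by simp
    show "\<forall>F\<in>?I. \<forall>G\<in>?I. F \<noteq> G \<longrightarrow> ?A F \<inter> ?A G = {}"
      using word_tabloid_determines_breaks by blast
  qed
  ultimately show ?thesis by simp
qed

text \<open>A word is fixed iff it is constant on the cycles; \<open>pick\<close> selects the point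
  of a cycle at which its letter is read.\<close>

lemma card_fixed_words:
  assumes \<pi>: "\<pi> \<in> perm_set n"
  shows "card {f \<in> {1..n} \<rightarrow>\<^sub>E {..<r}. \<forall>x\<in>{1..n}. f (\<pi> x) = f x} = r ^ cycle_count n \<pi>"
proof -
  let ?C = "cycles {1..n} \<pi>"
  note p = perm_setD[OF \<pi>]
  let ?X = "{f \<in> {1..n} \<rightarrow>\<^sub>E {..<r}. \<forall>x\<in>{1..n}. f (\<pi> x) = f x}"
  define pick where "pick A = (SOME x. x \<in> A)" for A :: "nat set"
  have pick: "pick A \<in> A" if "A \<in> ?C" for A
  proof -
    obtain x where "A = orbit \<pi> x" using \<open>A \<in> ?C\<close> by (auto simp: cycles_def)
    then have "x \<in> A" using self_in_orbit[OF p] by simp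
    then show ?thesis unfolding pick_def by (rule someI)
  qed
  have sub: "A \<subseteq> {1..n}" if "A \<in> ?C" for A
    using that permutes_orbit_subset[OF p] unfolding cycles_def by blast
  have const: "f y = f x" if f: "f \<in> ?X" and x: "x \<in> {1..n}" and y: "y \<in> orbit \<pi> x" for f x y
    using y
  proof induction
    case base
    then show ?case using f x by auto
  next
    case (step y)
    then have "y \<in> {1..n}" using permutes_orbit_subset[OF p x] by auto
    then show ?case using f step by auto
  qed
  have "bij_betw (\<lambda>g. restrict (\<lambda>x. g (orbit \<pi> x)) {1..n}) (?C \<rightarrow>\<^sub>E {..<r}) ?X"
  proof (rule bij_betw_byWitness[where f' = "\<lambda>f. restrict (\<lambda>A. f (pick A)) ?C"])
    show "\<forall>g\<in>?C \<rightarrow>\<^sub>E {..<r}. restrict (\<lambda>A. restrict (\<lambda>x. g (orbit \<pi> x)) {1..n} (pick A)) ?C = g"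
    proof
      fix g assume g: "g \<in> ?C \<rightarrow>\<^sub>E {..<r}"
      show "restrict (\<lambda>A. restrict (\<lambda>x. g (orbit \<pi> x)) {1..n} (pick A)) ?C = g"
      proof
        fix A show "restrict (\<lambda>A. restrict (\<lambda>x. g (orbit \<pi> x)) {1..n} (pick A)) ?C A = g A"
        proof (cases "A \<in> ?C")
          case True
          have "pick A \<in> {1..n}" using pick[OF True] sub[OF True] by blast
          moreover have "orbit \<pi> (pick A) = A" using in_cycle_eq[OF p _ True pick[OF True]] by simp
          ultimately show ?thesis using True by simp
        qed (use g in \<open>auto simp: PiE_def extensional_def\<close>)
      qed
    qed
    show "\<forall>f\<in>?X. restrict (\<lambda>x. restrict (\<lambda>A. f (pick A)) ?C (orbit \<pi> x)) {1..n} = f"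
    proof
      fix f assume f: "f \<in> ?X"
      show "restrict (\<lambda>x. restrict (\<lambda>A. f (pick A)) ?C (orbit \<pi> x)) {1..n} = f"
      proof
        fix x show "restrict (\<lambda>x. restrict (\<lambda>A. f (pick A)) ?C (orbit \<pi> x)) {1..n} x = f x"
        proof (cases "x \<in> {1..n}")
          case True
          then have o: "orbit \<pi> x \<in> ?C" by (simp add: cycles_def)
          then show ?thesis using True const[OF f True pick[OF o]] by simp
        qed (use f in \<open>auto simp: PiE_def extensional_def\<close>)
      qed
    qed
    show "(\<lambda>g. restrict (\<lambda>x. g (orbit \<pi> x)) {1..n}) ` (?C \<rightarrow>\<^sub>E {..<r}) \<subseteq> ?X"
    proof
      fix f assume "f \<in> (\<lambda>g. restrict (\<lambda>x. g (orbit \<pi> x)) {1..n}) ` (?C \<rightarrow>\<^sub>E {..<r})"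
      then obtain g where g: "g \<in> ?C \<rightarrow>\<^sub>E {..<r}" "f = restrict (\<lambda>x. g (orbit \<pi> x)) {1..n}" by auto
      have "f (\<pi> x) = f x" if "x \<in> {1..n}" for x
        using that permutes_in_image[OF p] permutation_orbit_step[OF permutation_p[OF p]] by (simp add: g(2))
      moreover have "f \<in> {1..n} \<rightarrow>\<^sub>E {..<r}" using g by (auto simp: cycles_def)
      ultimately show "f \<in> ?X" by blast
    qed
    show "(\<lambda>f. restrict (\<lambda>A. f (pick A)) ?C) ` ?X \<subseteq> ?C \<rightarrow>\<^sub>E {..<r}"
    proof
      fix g assume "g \<in> (\<lambda>f. restrict (\<lambda>A. f (pick A)) ?C) ` ?X"
      then obtain f where f: "f \<in> ?X" "g = restrict (\<lambda>A. f (pick A)) ?C" by auto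
      have "f (pick A) < r" if "A \<in> ?C" for A
        using f(1) pick[OF that] sub[OF that] by auto
      then show "g \<in> ?C \<rightarrow>\<^sub>E {..<r}" by (auto simp: f(2))
    qed
  qed
  from bij_betw_same_card[OF this, symmetric] have "card ?X = card (?C \<rightarrow>\<^sub>E {..<r})" .
  also have "\<dots> = r ^ card ?C"
    using finite_cycles[OF p] by (simp add: card_PiE del: One_nat_def)
  finally show ?thesis by (simp only: cycle_count_eq)
qed

lemma card_fixed_surj_cong:
  assumes \<pi>: "\<pi> \<in> perm_set n" and R: "finite R" "card R = m"
  shows "card (fixed_surj n \<pi> R) = card (fixed_surj n \<pi> {..<m})"
proof -
  obtain h where h: "bij_betw h R {..<m}" using ex_bij_betw_finite_nat[OF R(1)] R(2) by (auto simp: atLeast0LessThan)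
  have main: "(\<lambda>f. restrict (h \<circ> f) {1..n}) ` fixed_surj n \<pi> A \<subseteq> fixed_surj n \<pi> B"
    if hAB: "bij_betw h A B" for h :: "nat \<Rightarrow> nat" and A B
  proof
    fix g assume "g \<in> (\<lambda>f. restrict (h \<circ> f) {1..n}) ` fixed_surj n \<pi> A"
    then obtain f where f: "f \<in> fixed_surj n \<pi> A" "g = restrict (h \<circ> f) {1..n}" by auto
    have "g ` {1..n} = h ` f ` {1..n}" unfolding f(2) by auto
    also have "\<dots> = B" using f(1) hAB by (auto simp: fixed_surj_def bij_betw_def)
    finally have "g ` {1..n} = B" .
    moreover have "g (\<pi> x) = g x" if "x \<in> {1..n}" for x
      using f that perm_set_image[OF \<pi> that] by (simp add: fixed_surj_def)
    ultimately show "g \<in> fixed_surj n \<pi> B" unfolding fixed_surj_def f(2) by auto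
  qed
  let ?k = "inv_into R h"
  have k: "bij_betw ?k {..<m} R" by (rule bij_betw_inv_into[OF h])
  have "bij_betw (\<lambda>f. restrict (h \<circ> f) {1..n}) (fixed_surj n \<pi> R) (fixed_surj n \<pi> {..<m})"
  proof (rule bij_betw_byWitness[where f' = "\<lambda>f. restrict (?k \<circ> f) {1..n}"])
    show "\<forall>f\<in>fixed_surj n \<pi> R. restrict (?k \<circ> restrict (h \<circ> f) {1..n}) {1..n} = f"
    proof
      fix f assume f: "f \<in> fixed_surj n \<pi> R"
      have "?k (h (f x)) = f x" if "x \<in> {1..n}" for x
        using f that bij_betw_inv_into_left[OF h] by (auto simp: fixed_surj_def)
      then show "restrict (?k \<circ> restrict (h \<circ> f) {1..n}) {1..n} = f"
        using f by (auto simp: fun_eq_iff fixed_surj_def extensional_def)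
    qed
    show "\<forall>f\<in>fixed_surj n \<pi> {..<m}. restrict (h \<circ> restrict (?k \<circ> f) {1..n}) {1..n} = f"
    proof
      fix f assume f: "f \<in> fixed_surj n \<pi> {..<m}"
      have "h (?k (f x)) = f x" if "x \<in> {1..n}" for x
        using f that bij_betw_inv_into_right[OF h] unfolding fixed_surj_def by blast
      then show "restrict (h \<circ> restrict (?k \<circ> f) {1..n}) {1..n} = f"
        using f by (auto simp: fun_eq_iff fixed_surj_def extensional_def)
    qed
  qed (use main[OF h] main[OF k] in auto)
  then show ?thesis by (rule bij_betw_same_card)
qed

text \<open>Fixed words are classified by the set \<open>R\<close> of letters that occur. The count
  depends on \<open>card R\<close> only, which is at least 1 and at most \<open>n\<close>; the index
  \<open>d\<close> is \<open>card R - 1\<close>.\<close>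

lemma power_cycle_count_eq_sum:
  assumes n: "n \<ge> 1" and \<pi>: "\<pi> \<in> perm_set n"
  shows "r ^ cycle_count n \<pi> = (\<Sum>d<n. (r choose Suc d) * card (fixed_surj n \<pi> {..d}))"
proof -
  let ?s = "\<lambda>m. card (fixed_surj n \<pi> {..<m})"
  have zero: "?s m = 0" if "m = 0 \<or> m > n" for m
  proof -
    have "fixed_surj n \<pi> {..<m} = {}"
    proof (rule ccontr)
      assume "fixed_surj n \<pi> {..<m} \<noteq> {}"
      then obtain f where "f ` {1..n} = {..<m}" by (auto simp: fixed_surj_def)
      moreover have "card (f ` {1..n}) \<le> n" using card_image_le[of "{1..n}" f] by simp
      moreover have "f ` {1..n} \<noteq> {}" using n by auto
      ultimately show False using that by auto
    qed
    then show ?thesis by simp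
  qed
  have "{f \<in> {1..n} \<rightarrow>\<^sub>E {..<r}. \<forall>x\<in>{1..n}. f (\<pi> x) = f x} = (\<Union>R\<in>Pow {..<r}. fixed_surj n \<pi> R)"
    by (auto simp: fixed_surj_def PiE_def)
  then have "r ^ cycle_count n \<pi> = card (\<Union>R\<in>Pow {..<r}. fixed_surj n \<pi> R)"
    using card_fixed_words[OF \<pi>, of r] by simp
  also have "\<dots> = (\<Sum>R\<in>Pow {..<r}. card (fixed_surj n \<pi> R))"
    by (rule card_UN_disjoint) (auto intro: finite_fixed_surj finite_subset, auto simp: fixed_surj_def)
  also have "\<dots> = (\<Sum>R\<in>Pow {..<r}. ?s (card R))"
    by (intro sum.cong refl card_fixed_surj_cong[OF \<pi>]) (auto intro: finite_subset)
  also have "\<dots> = (\<Sum>m\<in>{..r}. \<Sum>R\<in>{R \<in> Pow {..<r}. card R = m}. ?s (card R))"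
    by (rule sum.group[symmetric]) (auto simp: subset_eq_atLeast0_lessThan_card atLeast0LessThan dest: card_mono[rotated])
  also have "\<dots> = (\<Sum>m\<in>{..r}. (r choose m) * ?s m)"
    by (intro sum.cong refl) (simp add: n_subsets)
  \<comment> \<open>The range is enlarged so that it contains \<open>1..n\<close> whether or not
    \<open>r < n\<close>.\<close>
  also have "\<dots> = (\<Sum>m\<in>{..r + n}. (r choose m) * ?s m)"
    by (rule sum.mono_neutral_left) (auto simp: binomial_eq_0)
  also have "\<dots> = (\<Sum>m\<in>Suc ` {..<n}. (r choose m) * ?s m)"
  proof (rule sum.mono_neutral_right)
    show "\<forall>m\<in>{..r + n} - Suc ` {..<n}. (r choose m) * ?s m = 0"
    proof
      fix m assume m: "m \<in> {..r + n} - Suc ` {..<n}"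
      have "m = 0 \<or> m > n" using m by (cases m) auto
      then show "(r choose m) * ?s m = 0" using zero by simp
    qed
  qed auto
  also have "\<dots> = (\<Sum>d<n. (r choose Suc d) * ?s (Suc d))" by (simp add: sum.reindex)
  finally show ?thesis by (simp add: lessThan_Suc_atMost)
qed

section \<open>From fixed tabloids to the characters of the border shapes\<close>

definition ribbon_trace :: "nat \<Rightarrow> (nat \<Rightarrow> nat) \<Rightarrow> nat set \<Rightarrow> complex" where
  "ribbon_trace n \<pi> D = trace_on (cfun.span (word_polytabloid n D ` perm_set n)) (perm_act \<pi>)"

text \<open>The trace for \<open>D\<close> occurs once for every \<open>F\<close> of size
  \<open>d\<close> that contains \<open>D\<close>. Counted by complements, these number
  \<open>(n - 1 - card D) choose (n - 1 - d)\<close>, and Vandermonde's identity combines them with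
  \<open>r choose Suc d\<close> into \<open>eul n (card D) r\<close>.\<close>

lemma worpitzky_ribbon:
  assumes n: "n \<ge> 1" and \<pi>: "\<pi> \<in> perm_set n"
  shows "of_nat r ^ cycle_count n \<pi> =
    (\<Sum>e<n. of_nat (eul n e r) * (\<Sum>D\<in>{D. D \<subseteq> {1..<n} \<and> card D = e}. ribbon_trace n \<pi> D))"
proof -
  let ?P = "Pow {1..<n}" and ?t = "ribbon_trace n \<pi>"
  let ?I = "\<lambda>d. {F. F \<subseteq> {1..<n} \<and> card F = d}"
  have finI: "finite (?I d)" for d by (rule finite_subset[of _ ?P]) auto
  have cardP: "card D < n" if "D \<in> ?P" for D
    using card_mono[of "{1..<n}" D] that n by auto
  have num: "card {F \<in> ?I d. D \<subseteq> F} = (n - 1 - card D) choose (n - 1 - d)" if D: "D \<in> ?P" and d: "d < n" for D d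
  proof -
    have "bij_betw (\<lambda>F. {1..<n} - F) {F \<in> ?I d. D \<subseteq> F} {G. G \<subseteq> {1..<n} - D \<and> card G = n - 1 - d}"
    proof (rule bij_betw_byWitness[where f' = "\<lambda>G. {1..<n} - G"])
      have fs: "finite G" if "G \<subseteq> {1..<n}" for G using that finite_subset by auto
      show "(\<lambda>F. {1..<n} - F) ` {F \<in> ?I d. D \<subseteq> F} \<subseteq> {G. G \<subseteq> {1..<n} - D \<and> card G = n - 1 - d}"
        using fs by (auto simp: card_Diff_subset)
      show "(\<lambda>G. {1..<n} - G) ` {G. G \<subseteq> {1..<n} - D \<and> card G = n - 1 - d} \<subseteq> {F \<in> ?I d. D \<subseteq> F}"
      proof clarify
        fix G assume G: "G \<subseteq> {1..<n} - D" "card G = n - 1 - d"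
        then have "G \<subseteq> {1..<n}" by auto
        then have "card ({1..<n} - G) = d" using G(2) d fs by (simp add: card_Diff_subset)
        then show "{1..<n} - G \<in> ?I d \<and> D \<subseteq> {1..<n} - G" using G(1) D by auto
      qed
    qed auto
    from bij_betw_same_card[OF this]
    have "card {F \<in> ?I d. D \<subseteq> F} = card ({1..<n} - D) choose (n - 1 - d)" by (simp add: n_subsets)
    also have "card ({1..<n} - D) = n - 1 - card D"
      using D finite_subset[of D "{1..<n}"] by (simp add: card_Diff_subset)
    finally show ?thesis .
  qed
  have S: "of_nat (card (fixed_surj n \<pi> {..d})) = (\<Sum>D\<in>?P. of_nat ((n - 1 - card D) choose (n - 1 - d)) * ?t D)"
    if d: "d < n" for d
  proof -
    have "(of_nat (card (fixed_surj n \<pi> {..d})) :: complex) = (\<Sum>F\<in>?I d. \<Sum>D\<in>Pow F. ?t D)"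
      unfolding card_fixed_surj_eq_sum[OF n \<pi>] of_nat_sum
      by (intro sum.cong refl) (simp add: fixed_tabloids_eq_sum_traces[OF \<pi>] ribbon_trace_def)
    also have "\<dots> = (\<Sum>F\<in>?I d. \<Sum>D\<in>?P. if D \<subseteq> F then ?t D else 0)"
    proof (rule sum.cong[OF refl])
      fix F assume F: "F \<in> ?I d"
      have "{D \<in> ?P. D \<subseteq> F} = Pow F" using F by auto
      then show "(\<Sum>D\<in>Pow F. ?t D) = (\<Sum>D\<in>?P. if D \<subseteq> F then ?t D else 0)"
        using sum.inter_filter[of ?P ?t "\<lambda>D. D \<subseteq> F"] by simp
    qed
    also have "\<dots> = (\<Sum>D\<in>?P. \<Sum>F\<in>?I d. if D \<subseteq> F then ?t D else 0)" by (rule sum.swap)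
    also have "\<dots> = (\<Sum>D\<in>?P. of_nat ((n - 1 - card D) choose (n - 1 - d)) * ?t D)"
    proof (intro sum.cong refl)
      fix D assume D: "D \<in> ?P"
      have "(\<Sum>F\<in>?I d. if D \<subseteq> F then ?t D else 0) = (\<Sum>F\<in>{F \<in> ?I d. D \<subseteq> F}. ?t D)"
        by (rule sum.inter_filter[OF finI, symmetric])
      then show "(\<Sum>F\<in>?I d. if D \<subseteq> F then ?t D else 0) = of_nat ((n - 1 - card D) choose (n - 1 - d)) * ?t D"
        using num[OF D d] by simp
    qed
    finally show ?thesis .
  qed
  have V: "(\<Sum>d<n. (r choose Suc d) * ((n - 1 - e) choose (n - 1 - d))) = eul n e r" if "e < n" for e
  proof -
    have "eul n e r = (\<Sum>k\<le>n. (r choose k) * ((n - 1 - e) choose (n - k)))"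
      unfolding eul_def by (rule vandermonde[symmetric])
    \<comment> \<open>The term \<open>k = 0\<close> vanishes because \<open>n - 1 - e < n\<close>,
      which permits the shift to \<open>d = k - 1\<close>.\<close>
    also have "\<dots> = (\<Sum>k\<in>Suc ` {..<n}. (r choose k) * ((n - 1 - e) choose (n - k)))"
    proof (rule sum.mono_neutral_right)
      have "(n - 1 - e) choose n = 0" using that by (intro binomial_eq_0) simp
      moreover have "{..n} - Suc ` {..<n} = {0}" by (auto simp: image_iff) (metis Suc_le_eq lessThan_iff not0_implies_Suc)
      ultimately show "\<forall>k\<in>{..n} - Suc ` {..<n}. (r choose k) * ((n - 1 - e) choose (n - k)) = 0" by simp
    qed auto
    also have "\<dots> = (\<Sum>d<n. (r choose Suc d) * ((n - 1 - e) choose (n - 1 - d)))"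
      by (simp add: sum.reindex)
    finally show ?thesis by simp
  qed
  have "of_nat r ^ cycle_count n \<pi> = (\<Sum>d<n. of_nat (r choose Suc d) * (of_nat (card (fixed_surj n \<pi> {..d})) :: complex))"
    using arg_cong[OF power_cycle_count_eq_sum[OF n \<pi>, of r], of "of_nat :: nat \<Rightarrow> complex"] by simp
  also have "\<dots> = (\<Sum>d<n. \<Sum>D\<in>?P. of_nat ((r choose Suc d) * ((n - 1 - card D) choose (n - 1 - d))) * ?t D)"
    by (intro sum.cong refl) (simp add: S sum_distrib_left mult.assoc)
  also have "\<dots> = (\<Sum>D\<in>?P. of_nat (\<Sum>d<n. (r choose Suc d) * ((n - 1 - card D) choose (n - 1 - d))) * ?t D)"
    unfolding of_nat_sum sum_distrib_right by (rule sum.swap)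
  also have "\<dots> = (\<Sum>D\<in>?P. of_nat (eul n (card D) r) * ?t D)"
    by (intro sum.cong refl) (simp only: V cardP)
  also have "\<dots> = (\<Sum>e<n. \<Sum>D\<in>{D \<in> ?P. card D = e}. of_nat (eul n (card D) r) * ?t D)"
    by (rule sum.group[symmetric]) (use cardP in auto)
  also have "\<dots> = (\<Sum>e<n. of_nat (eul n e r) * (\<Sum>D\<in>?I e. ?t D))"
    by (intro sum.cong refl) (simp add: sum_distrib_left)
  finally show ?thesis .
qed

section \<open>Border shapes\<close>

definition ribbon_box :: "nat \<Rightarrow> nat set \<Rightarrow> nat \<Rightarrow> nat \<times> nat" where
  "ribbon_box n D p = (row_of D p, col_of n D p)"

definition ribbon :: "nat \<Rightarrow> nat set \<Rightarrow> (nat \<times> nat) set" where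
  "ribbon n D = ribbon_box n D ` {1..n}"

text \<open>The content, column minus row, drops by one at every step, left or down. It therefore
  determines the position, so no two boxes of a ribbon lie on one diagonal.\<close>

lemma col_row:
  assumes "D \<subseteq> {1..<n}" "1 \<le> p" "p \<le> n"
  shows "col_of n D p + card D + p = n + row_of D p"
proof -
  have fin: "finite D" using assms(1) finite_subset by auto
  have "D = {d \<in> D. d < p} \<union> D \<inter> {p..<n}" using assms(1) by auto
  then have "card D = card ({d \<in> D. d < p} \<union> D \<inter> {p..<n})" by simp
  also have "\<dots> = card {d \<in> D. d < p} + card (D \<inter> {p..<n})"
    by (rule card_Un_disjoint) (use fin in auto)
  finally have 1: "card D = row_of D p + card (D \<inter> {p..<n})" by (simp add: row_of_def)
  have "col_of n D p + card (D \<inter> {p..<n}) = card {p..<n}"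
    unfolding col_of_def using card_Diff_subset_Int[of "{p..<n}" D] card_mono[of "{p..<n}" "D \<inter> {p..<n}"] fin
    by (simp add: Int_commute)
  then show ?thesis using 1 assms by simp
qed

lemma inj_on_ribbon_box:
  assumes "D \<subseteq> {1..<n}"
  shows "inj_on (ribbon_box n D) {1..n}"
proof (rule inj_onI)
  fix p q assume "p \<in> {1..n}" "q \<in> {1..n}" "ribbon_box n D p = ribbon_box n D q"
  then show "p = q"
    using col_row[OF assms, of p] col_row[OF assms, of q] by (simp add: ribbon_box_def)
qed

lemma ribbon_box_in: "p \<in> {1..n} \<Longrightarrow> ribbon_box n D p \<in> ribbon n D"
  unfolding ribbon_def by (rule imageI)

lemma card_ribbon: "D \<subseteq> {1..<n} \<Longrightarrow> card (ribbon n D) = n"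
  by (simp add: ribbon_def card_image[OF inj_on_ribbon_box, simplified])

lemma bij_betw_ribbon_box: "D \<subseteq> {1..<n} \<Longrightarrow> bij_betw (ribbon_box n D) {1..n} (ribbon n D)"
  using inj_on_ribbon_box by (simp add: bij_betw_def ribbon_def)

text \<open>Conjugation by \<open>u\<close> carries the column group on positions to the column
  stabilizer on entries and preserves signs.\<close>

lemma polytabloid_eq_word_polytabloid:
  assumes D: "D \<subseteq> {1..<n}" and t: "t \<in> tableaux n (ribbon n D)" and u: "u \<in> perm_set n"
    and tu: "\<And>p. p \<in> {1..n} \<Longrightarrow> t (ribbon_box n D p) = u p"
  shows "polytabloid n (ribbon n D) t = word_polytabloid n D u"
proof -
  let ?\<beta> = "ribbon n D"
  have inv: "inv_into ?\<beta> s x = ribbon_box n D (inv v x)"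
    if s: "s \<in> tableaux n ?\<beta>" and v: "v \<in> perm_set n" and sv: "\<And>p. p \<in> {1..n} \<Longrightarrow> s (ribbon_box n D p) = v p"
      and x: "x \<in> {1..n}" for s v x
  proof (rule inv_into_f_eq)
    have i: "inv v x \<in> {1..n}" by (rule perm_set_image[OF perm_set_inv[OF v] x])
    show "inj_on s ?\<beta>" using s by (simp add: tableaux_def bij_betw_def)
    show "ribbon_box n D (inv v x) \<in> ?\<beta>" using i by (simp add: ribbon_def)
    show "s (ribbon_box n D (inv v x)) = x" using sv[OF i] perm_set_cancel(3)[OF v] by simp
  qed
  have tab: "tabloid ?\<beta> s = word_tabloid n D v"
    if s: "s \<in> tableaux n ?\<beta>" and v: "v \<in> perm_set n" and sv: "\<And>p. p \<in> {1..n} \<Longrightarrow> s (ribbon_box n D p) = v p" for s v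
  proof -
    have "s ` ?\<beta> = {1..n}" using s by (simp add: tableaux_def bij_betw_def)
    then show ?thesis unfolding tabloid_def word_tabloid_def
      using inv[OF s v sv] by (auto simp: ribbon_box_def fun_eq_iff)
  qed
  have iu: "snd (inv_into ?\<beta> t x) = col_of n D (inv u x)" if "x \<in> {1..n}" for x
    using inv[OF t u tu that] by (simp add: ribbon_box_def)
  have stabi: "col_stabilizer n ?\<beta> t = {\<pi> \<in> perm_set n. \<forall>x\<in>{1..n}. col_of n D (inv u (\<pi> x)) = col_of n D (inv u x)}"
    unfolding col_stabilizer_def using iu perm_set_image by (auto simp del: atLeastAtMost_iff)
  let ?conj = "\<lambda>\<rho>. u \<circ> \<rho> \<circ> inv u"
  have bij: "bij_betw ?conj (col_group n D) (col_stabilizer n ?\<beta> t)"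
  proof (rule bij_betw_byWitness[where f' = "\<lambda>\<pi>. inv u \<circ> \<pi> \<circ> u"])
    note c = permutes_inv_o[OF perm_setD[OF u]]
    show "\<forall>\<rho>\<in>col_group n D. inv u \<circ> (?conj \<rho>) \<circ> u = \<rho>"
      by (simp add: comp_assoc perm_set_cancel[OF u] c)
    show "\<forall>\<pi>\<in>col_stabilizer n ?\<beta> t. ?conj (inv u \<circ> \<pi> \<circ> u) = \<pi>"
      by (simp add: comp_assoc perm_set_cancel[OF u] c)
    show "?conj ` col_group n D \<subseteq> col_stabilizer n ?\<beta> t"
    proof
      fix \<pi> assume "\<pi> \<in> ?conj ` col_group n D"
      then obtain \<rho> where r: "\<rho> \<in> col_group n D" "\<pi> = ?conj \<rho>" by auto
      have "col_of n D (inv u (\<pi> x)) = col_of n D (inv u x)" if "x \<in> {1..n}" for x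
        using r perm_set_image[OF perm_set_inv[OF u] that] perm_set_cancel(4)[OF u] by (auto simp: stab_def)
      moreover have "\<pi> \<in> perm_set n" unfolding r(2)
        by (intro perm_set_comp u perm_set_inv stab_perm[OF r(1)])
      ultimately show "\<pi> \<in> col_stabilizer n ?\<beta> t" unfolding stabi by blast
    qed
    show "(\<lambda>\<pi>. inv u \<circ> \<pi> \<circ> u) ` col_stabilizer n ?\<beta> t \<subseteq> col_group n D"
    proof
      fix \<rho> assume "\<rho> \<in> (\<lambda>\<pi>. inv u \<circ> \<pi> \<circ> u) ` col_stabilizer n ?\<beta> t"
      then obtain \<pi> where r: "\<pi> \<in> col_stabilizer n ?\<beta> t" "\<rho> = inv u \<circ> \<pi> \<circ> u" by auto
      have "col_of n D (\<rho> x) = col_of n D x" if "x \<in> {1..n}" for x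
        using r(1) perm_set_image[OF u that] perm_set_cancel(4)[OF u] unfolding stabi r(2) by auto
      moreover have "\<rho> \<in> perm_set n" using r by (auto simp: stabi intro: perm_set_comp perm_set_inv u)
      ultimately show "\<rho> \<in> col_group n D" unfolding stab_def by blast
    qed
  qed
  have sgn: "sign (?conj \<rho>) = sign \<rho>" if "\<rho> \<in> perm_set n" for \<rho>
  proof -
    note p = permutation_p[OF perm_setD[OF u] finite_atLeastAtMost] permutation_p[OF perm_setD[OF that] finite_atLeastAtMost]
    have "sign (?conj \<rho>) = sign u * sign \<rho> * sign u"
      using p by (simp add: sign_compose permutation_compose permutation_inverse sign_inverse)
    also have "\<dots> = sign \<rho>" by (simp add: sign_def)
    finally show ?thesis .
  qed
  have tabc: "tabloid ?\<beta> (?conj \<rho> \<circ> t) = word_tabloid n D (u \<circ> \<rho>)" if r: "\<rho> \<in> col_group n D" for \<rho>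
  proof (rule tab)
    have "?conj \<rho> permutes {1..n}"
      by (intro perm_setD perm_set_comp u perm_set_inv stab_perm[OF r])
    then show "?conj \<rho> \<circ> t \<in> tableaux n ?\<beta>"
      using t bij_betw_trans[OF _ permutes_imp_bij] unfolding tableaux_def by blast
    show "u \<circ> \<rho> \<in> perm_set n" by (intro perm_set_comp u stab_perm[OF r])
    show "(?conj \<rho> \<circ> t) (ribbon_box n D p) = (u \<circ> \<rho>) p" if "p \<in> {1..n}" for p
      using tu[OF that] perm_set_cancel(4)[OF u] by simp
  qed
  show ?thesis unfolding polytabloid_def word_polytabloid_def
  proof
    fix T
    show "(\<Sum>\<pi>\<in>col_stabilizer n ?\<beta> t. of_int (sign \<pi>) * (if T = tabloid ?\<beta> (\<pi> \<circ> t) then 1 else 0)) =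
      (\<Sum>\<rho>\<in>col_group n D. of_int (sign \<rho>) * (if T = word_tabloid n D (u \<circ> \<rho>) then 1 else (0 :: complex)))"
      by (subst sum.reindex_bij_betw[OF bij, symmetric], intro sum.cong refl)
        (simp only: sgn[OF stab_perm] tabc)
  qed
qed

lemma specht_ribbon:
  assumes D: "D \<subseteq> {1..<n}"
  shows "specht n (ribbon n D) = cfun.span (word_polytabloid n D ` perm_set n)"
proof -
  note b = bij_betw_ribbon_box[OF D]
  have "polytabloid n (ribbon n D) ` tableaux n (ribbon n D) = word_polytabloid n D ` perm_set n"
  proof
    show "polytabloid n (ribbon n D) ` tableaux n (ribbon n D) \<subseteq> word_polytabloid n D ` perm_set n"
    proof clarify
      fix t assume t: "t \<in> tableaux n (ribbon n D)"
      define u where "u x = (if x \<in> {1..n} then t (ribbon_box n D x) else x)" for x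
      have "bij_betw (t \<circ> ribbon_box n D) {1..n} {1..n}"
        using bij_betw_trans[OF b] t by (simp add: tableaux_def)
      then have "bij_betw u {1..n} {1..n}"
        by (subst bij_betw_cong[of _ _ "t \<circ> ribbon_box n D"]) (auto simp: u_def)
      then have "u permutes {1..n}" by (rule bij_imp_permutes) (auto simp: u_def)
      then have "u \<in> perm_set n" by (simp add: perm_set_def)
      moreover from polytabloid_eq_word_polytabloid[OF D t this]
      have "polytabloid n (ribbon n D) t = word_polytabloid n D u" by (simp add: u_def)
      ultimately show "polytabloid n (ribbon n D) t \<in> word_polytabloid n D ` perm_set n" by blast
    qed
    show "word_polytabloid n D ` perm_set n \<subseteq> polytabloid n (ribbon n D) ` tableaux n (ribbon n D)"
    proof clarify
      fix u assume u: "u \<in> perm_set n"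
      define t where "t = u \<circ> inv_into {1..n} (ribbon_box n D)"
      have "t \<in> tableaux n (ribbon n D)"
        using bij_betw_trans[OF bij_betw_inv_into[OF b] permutes_imp_bij[OF perm_setD[OF u]]]
        by (simp add: tableaux_def t_def)
      moreover from polytabloid_eq_word_polytabloid[OF D this u]
      have "polytabloid n (ribbon n D) t = word_polytabloid n D u"
        using inv_into_f_f[OF inj_on_ribbon_box[OF D]] by (simp add: t_def)
      ultimately show "word_polytabloid n D u \<in> polytabloid n (ribbon n D) ` tableaux n (ribbon n D)" by (metis imageI)
    qed
  qed
  then show ?thesis by (simp add: specht_def)
qed

section \<open>Border shapes are exactly the ribbons of break sets\<close>

lemma skew_shape_ribbon:
  assumes D: "D \<subseteq> {1..<n}" and n: "n \<ge> 1"
  shows "skew_shape (ribbon n D)"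
proof -
  have fin: "finite D" using D finite_subset by auto
  \<comment> \<open>The left steps in row \<open>r\<close> and the rows below it; their number is
    the rightmost column of row \<open>r\<close>. The row thus occupies the columns from
    \<open>left (Suc r)\<close> to \<open>left r\<close>, and consecutive rows share one
    column.\<close>
  define left where "left r = card {q \<in> {1..<n} - D. r \<le> row_of D q}" for r
  define lam where "lam r = (if r \<le> card D then Suc (left r) else 0)" for r
  define mu where "mu r = left (Suc r)" for r
  have left_anti: "left s \<le> left r" if "r \<le> s" for r s
    unfolding left_def by (rule card_mono) (use that in auto)
  have row_le: "row_of D q \<le> card D" for q unfolding row_of_def by (rule card_mono[OF fin]) auto
  have left0: "left r = 0" if "r > card D" for r
    using row_le that by (auto simp: left_def not_le intro: le_less_trans)
  have "partition_seq lam" unfolding partition_seq_def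
  proof
    show "antimono lam" by (rule antimonoI) (auto simp: lam_def left_anti)
    show "finite {r. lam r \<noteq> 0}" by (rule finite_subset[of _ "{..card D}"]) (auto simp: lam_def split: if_splits)
  qed
  moreover have "partition_seq mu" unfolding partition_seq_def
  proof
    show "antimono mu" by (rule antimonoI) (auto simp: mu_def left_anti)
    have "r \<le> card D" if "mu r \<noteq> 0" for r
      using left0[of "Suc r"] that by (cases "Suc r > card D") (simp_all add: mu_def)
    then have "{r. mu r \<noteq> 0} \<subseteq> {..card D}" by blast
    then show "finite {r. mu r \<noteq> 0}" by (rule finite_subset) simp
  qed
  moreover have "mu \<le> lam"
  proof (rule le_funI)
    fix r show "mu r \<le> lam r"
      using left_anti[of r "Suc r"] left0[of "Suc r"] by (simp add: mu_def lam_def)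
  qed
  \<comment> \<open>One inclusion and equal cardinalities suffice, as the row lengths telescope to
    \<open>n\<close>.\<close>
  moreover have "ribbon n D = {(r, c). mu r \<le> c \<and> c < lam r}"
  proof (rule card_subset_eq)
    have S: "{(r, c). mu r \<le> c \<and> c < lam r} = (SIGMA r:{..card D}. {left (Suc r)..<Suc (left r)})"
      by (auto simp: mu_def lam_def split: if_splits)
    show "finite {(r, c). mu r \<le> c \<and> c < lam r}" unfolding S by simp
    show "ribbon n D \<subseteq> {(r, c). mu r \<le> c \<and> c < lam r}"
    proof
      fix x assume "x \<in> ribbon n D"
      then obtain p where p: "p \<in> {1..n}" "x = ribbon_box n D p" by (auto simp: ribbon_def)
      have "q \<ge> p" if "Suc (row_of D p) \<le> row_of D q" for q
        using row_of_mono[OF fin, of q p] that by (meson not_less_eq_eq nat_le_linear)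
      then have "mu (row_of D p) \<le> col_of n D p" unfolding mu_def left_def col_of_def
        by (intro card_mono) auto
      moreover have "col_of n D p \<le> left (row_of D p)" unfolding left_def col_of_def
        by (intro card_mono) (use row_of_mono[OF fin] p in auto)
      ultimately show "x \<in> {(r, c). mu r \<le> c \<and> c < lam r}" using row_le by (auto simp: p(2) ribbon_box_def lam_def)
    qed
    have "(\<Sum>r\<le>k. Suc (left r) - left (Suc r)) + left (Suc k) = Suc k + left 0" for k
    proof (induction k)
      case 0
      then show ?case using left_anti[of 0 1] by simp
    next
      case (Suc k)
      then show ?case using left_anti[of "Suc k" "Suc (Suc k)"] by simp
    qed
    from this[of "card D"] have "(\<Sum>r\<le>card D. Suc (left r) - left (Suc r)) = Suc (card D) + left 0"
      by (simp add: left0)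
    moreover have "left 0 + card D = n - 1"
    proof -
      have "left 0 = card ({1..<n} - D)" unfolding left_def by (rule arg_cong[where f = card]) auto
      also have "\<dots> = n - 1 - card D" using D fin by (simp add: card_Diff_subset)
      finally show ?thesis using card_mono[OF _ D] by simp
    qed
    ultimately show "card (ribbon n D) = card {(r, c). mu r \<le> c \<and> c < lam r}"
      unfolding S card_ribbon[OF D] using n by simp
  qed
  ultimately show ?thesis unfolding skew_shape_def by blast
qed

lemma col_of_Suc:
  assumes "p \<in> {1..<n}"
  shows "col_of n D p = (if p \<in> D then col_of n D (Suc p) else Suc (col_of n D (Suc p)))"
proof -
  have "{p..<n} = insert p {Suc p..<n}" using assms by auto
  then show ?thesis by (simp add: col_of_def insert_Diff_if)
qed

lemma connected_ribbon:
  assumes D: "D \<subseteq> {1..<n}"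
  shows "connected_boxes (ribbon n D)"
proof -
  let ?R = "{(x, y). x \<in> ribbon n D \<and> y \<in> ribbon n D \<and> adjacent x y}"
  have fin: "finite D" using D finite_subset by auto
  have sym: "sym ?R" by (auto simp: sym_def adjacent_def)
  have step: "(ribbon_box n D p, ribbon_box n D (Suc p)) \<in> ?R" if "p \<in> {1..<n}" for p
  proof -
    have "adjacent (ribbon_box n D p) (ribbon_box n D (Suc p))"
      using row_of_Suc[OF fin, of p] col_of_Suc[OF that, of D]
      by (auto simp: adjacent_def ribbon_box_def split: if_splits)
    then show ?thesis using that ribbon_box_in[of p n D] ribbon_box_in[of "Suc p" n D] by auto
  qed
  have reach: "(ribbon_box n D 1, ribbon_box n D p) \<in> ?R\<^sup>*" if "1 \<le> p" "p \<le> n" for p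
    using that
  proof (induction p rule: nat_induct_at_least)
    case (Suc p)
    then show ?case using step[of p] rtrancl.rtrancl_into_rtrancl[of _ _ ?R] by simp
  qed simp
  show ?thesis unfolding connected_boxes_def
  proof (intro ballI)
    fix a b assume "a \<in> ribbon n D" "b \<in> ribbon n D"
    then obtain p q where pq: "p \<in> {1..n}" "q \<in> {1..n}" "a = ribbon_box n D p" "b = ribbon_box n D q" by (auto simp: ribbon_def)
    have "(ribbon_box n D 1, a) \<in> ?R\<^sup>*" "(ribbon_box n D 1, b) \<in> ?R\<^sup>*" using reach pq by auto
    moreover from this have "(a, ribbon_box n D 1) \<in> ?R\<^sup>*" using sym_rtrancl[OF sym] by (meson symD)
    ultimately show "(a, b) \<in> ?R\<^sup>*" by (meson rtrancl_trans)
  qed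
qed

lemma ribbon_in_border_shapes:
  assumes D: "D \<subseteq> {1..<n}" and n: "n \<ge> 1"
  shows "ribbon n D \<in> border_shapes n (card D + 1)"
proof -
  have "\<not> {(r, c), (r, Suc c), (Suc r, c), (Suc r, Suc c)} \<subseteq> ribbon n D" for r c
  proof
    assume "{(r, c), (r, Suc c), (Suc r, c), (Suc r, Suc c)} \<subseteq> ribbon n D"
    then obtain p q where pq: "p \<in> {1..n}" "q \<in> {1..n}" "(r, c) = ribbon_box n D p" "(Suc r, Suc c) = ribbon_box n D q"
      by (auto simp: ribbon_def)
    then have "p = q" using col_row[OF D, of p] col_row[OF D, of q] by (auto simp: ribbon_box_def)
    then have "(r, c) = (Suc r, Suc c)" using pq(3,4) by metis
    then show False by simp
  qed
  moreover have "(0, col_of n D 1) \<in> ribbon n D"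
    using row_of_first[OF D] n by (auto simp: ribbon_def ribbon_box_def intro!: image_eqI[of _ _ 1])
  moreover have "(row_of D n, 0) \<in> ribbon n D"
    using n by (auto simp: ribbon_def ribbon_box_def col_of_def intro!: image_eqI[of _ _ n])
  moreover have "fst ` ribbon n D = {..card D}"
    using row_of_image[OF D n] by (simp add: ribbon_def image_image ribbon_box_def)
  ultimately show ?thesis
    unfolding border_shapes_def
    using skew_shape_ribbon[OF assms] connected_ribbon[OF D] card_ribbon[OF D] by auto
qed

lemma inj_on_ribbon: "inj_on (ribbon n) {D. D \<subseteq> {1..<n} \<and> card D = i}"
proof (rule inj_onI, clarify)
  fix D E assume DE: "D \<subseteq> {1..<n}" "E \<subseteq> {1..<n}" "card E = card D" and e: "ribbon n D = ribbon n E"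
  have "row_of D p = row_of E p" if p: "p \<in> {1..n}" for p
  proof -
    have "ribbon_box n D p \<in> ribbon n E" unfolding e[symmetric] by (rule ribbon_box_in[OF p])
    then obtain q where q: "q \<in> {1..n}" "ribbon_box n D p = ribbon_box n E q" by (auto simp: ribbon_def)
    then have "p = q" using col_row[OF DE(1), of p] col_row[OF DE(2), of q] p DE(3) by (auto simp: ribbon_box_def)
    then show ?thesis using q by (simp add: ribbon_box_def)
  qed
  then show "D = E" by (rule row_of_determines[OF DE(1,2)])
qed

text \<open>The boxes are ordered by decreasing content. Two boxes on one diagonal would, by
  convexity, enclose a 2x2 square, so the content is injective; by connectedness the contents fill
  an interval of \<open>n\<close> integers and boxes with neighbouring contents are adjacent. The
  steps that go down form \<open>D\<close>.\<close>

lemma border_shape_is_ribbon: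
  assumes n: "n \<ge> 1" and \<beta>: "\<beta> \<in> border_shapes n m"
  shows "\<exists>D. D \<subseteq> {1..<n} \<and> m = card D + 1 \<and> \<beta> = ribbon n D"
proof -
  have skew: "skew_shape \<beta>" and conn: "connected_boxes \<beta>"
    and no22: "\<And>r c. \<not> {(r, c), (r, Suc c), (Suc r, c), (Suc r, Suc c)} \<subseteq> \<beta>"
    and r0: "\<exists>c. (0, c) \<in> \<beta>" and c0: "\<exists>r. (r, 0) \<in> \<beta>"
    and card: "card \<beta> = n" and m: "card (fst ` \<beta>) = m"
    using \<beta> unfolding border_shapes_def by blast+
  have fin: "finite \<beta>" using card n card.infinite by fastforce
  obtain lam mu where lm: "partition_seq lam" "partition_seq mu" "\<beta> = {(r, c). mu r \<le> c \<and> c < lam r}"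
    using skew unfolding skew_shape_def by blast
  have convex: "(r, c) \<in> \<beta>" if "(a, b) \<in> \<beta>" "(a', b') \<in> \<beta>" "a \<le> r" "r \<le> a'" "b \<le> c" "c \<le> b'" for a b a' b' r c
  proof -
    have "mu r \<le> mu a" "lam a' \<le> lam r"
      using lm(1,2) that by (auto simp: partition_seq_def antimono_def)
    then show ?thesis using that unfolding lm(3) by auto
  qed
  define ct where "ct b = int (snd b) - int (fst b)" for b :: "nat \<times> nat"
  have ct_lt: "False" if "x \<in> \<beta>" "y \<in> \<beta>" "ct x = ct y" "fst x < fst y" for x y
  proof -
    obtain r c r' c' where xy: "x = (r, c)" "y = (r', c')" by (cases x, cases y)
    have "r < r'" "c < c'" using that by (auto simp: xy ct_def)
    then have "{(r, c), (r, Suc c), (Suc r, c), (Suc r, Suc c)} \<subseteq> \<beta>"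
      using convex[of r c r' c'] that(1,2) by (auto simp: xy)
    then show False using no22 by blast
  qed
  have inj: "inj_on ct \<beta>"
  proof (rule inj_onI)
    fix x y assume xy: "x \<in> \<beta>" "y \<in> \<beta>" "ct x = ct y"
    then have "fst x = fst y" using ct_lt[of x y] ct_lt[of y x] by (metis linorder_neqE_nat)
    then show "x = y" using xy(3) by (simp add: ct_def prod_eq_iff)
  qed
  let ?R = "{(x, y). x \<in> \<beta> \<and> y \<in> \<beta> \<and> adjacent x y}"
  have adj: "\<bar>ct x - ct y\<bar> = 1" if "adjacent x y" for x y
    using that by (auto simp: adjacent_def ct_def)
  \<comment> \<open>A path from content at least \<open>k\<close> to content below \<open>k\<close>
    has a step across, and adjacent boxes differ by one in content.\<close>
  have crossing: "\<exists>y z. (y, z) \<in> ?R \<and> ct y = k \<and> ct z = k - 1"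
    if ab: "a \<in> \<beta>" "b \<in> \<beta>" "k \<le> ct a" "ct b < k" for a b k
  proof -
    have "(a, b) \<in> ?R\<^sup>*" using conn ab by (auto simp: connected_boxes_def)
    then have "ct b < k \<longrightarrow> (\<exists>y z. (y, z) \<in> ?R \<and> k \<le> ct y \<and> ct z < k)"
    proof (induction rule: rtrancl_induct)
      case base
      then show ?case using ab by simp
    next
      case (step y z)
      then show ?case by (cases "ct y < k") (blast, intro impI exI[of _ y] exI[of _ z], auto)
    qed
    then obtain y z where yz: "(y, z) \<in> ?R" "k \<le> ct y" "ct z < k" using ab by blast
    then have "\<bar>ct y - ct z\<bar> = 1" using adj by blast
    then show ?thesis using yz by (intro exI[of _ y] exI[of _ z]) auto
  qed
  define lo where "lo = Min (ct ` \<beta>)"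
  define hi where "hi = Max (ct ` \<beta>)"
  have ne: "\<beta> \<noteq> {}" using r0 by auto
  have lohi: "lo \<in> ct ` \<beta>" "hi \<in> ct ` \<beta>" using fin ne by (auto simp: lo_def hi_def intro!: Min_in Max_in)
  have img: "ct ` \<beta> = {lo..hi}"
  proof
    show "ct ` \<beta> \<subseteq> {lo..hi}" using fin by (auto simp: lo_def hi_def)
    show "{lo..hi} \<subseteq> ct ` \<beta>"
    proof
      fix k assume k: "k \<in> {lo..hi}"
      show "k \<in> ct ` \<beta>"
      proof (cases "k = lo")
        case False
        obtain a b where "a \<in> \<beta>" "ct a = hi" "b \<in> \<beta>" "ct b = lo" using lohi by auto
        then obtain y z where "(y, z) \<in> ?R" "ct y = k" using crossing[of a b k] k False by auto
        then show ?thesis by auto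
      qed (use lohi in simp)
    qed
  qed
  have "card (ct ` \<beta>) = n" using inj card by (simp add: card_image)
  then have width: "hi - lo + 1 = int n" using img n by simp
  \<comment> \<open>Position 1 carries the largest content \<open>hi\<close>, position
    \<open>n\<close> the smallest.\<close>
  define b where "b p = inv_into \<beta> ct (hi + 1 - int p)" for p
  have b: "b p \<in> \<beta>" "ct (b p) = hi + 1 - int p" if "p \<in> {1..n}" for p
  proof -
    have "hi + 1 - int p \<in> ct ` \<beta>" unfolding img using that width by auto
    then show "b p \<in> \<beta>" "ct (b p) = hi + 1 - int p" unfolding b_def
      by (auto intro: inv_into_into f_inv_into_f)
  qed
  have b_onto: "\<exists>p\<in>{1..n}. x = b p" if "x \<in> \<beta>" for x
  proof -
    have cx: "ct x \<in> {lo..hi}" using img that by auto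
    define p where "p = nat (hi + 1 - ct x)"
    have p: "p \<in> {1..n}" "hi + 1 - int p = ct x" using cx width by (auto simp: p_def)
    then have "ct (b p) = ct x" using b by simp
    then show ?thesis using inj_onD[OF inj, of "b p" x] b(1)[OF p(1)] that p(1) by auto
  qed
  have step: "fst (b (Suc p)) = fst (b p) \<and> snd (b p) = Suc (snd (b (Suc p))) \<or>
      fst (b (Suc p)) = Suc (fst (b p)) \<and> snd (b (Suc p)) = snd (b p)" if p: "p \<in> {1..<n}" for p
  proof -
    have pp: "p \<in> {1..n}" "Suc p \<in> {1..n}" using p by auto
    obtain y z where yz: "(y, z) \<in> ?R" "ct y = ct (b p)" "ct z = ct (b p) - 1"
      using crossing[OF b(1)[OF pp(1)] b(1)[OF pp(2)], of "ct (b p)"] b(2)[OF pp(1)] b(2)[OF pp(2)] by auto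
    have "y = b p" using inj_onD[OF inj yz(2)] yz(1) b(1)[OF pp(1)] by auto
    moreover have "z = b (Suc p)"
    proof (rule inj_onD[OF inj])
      show "ct z = ct (b (Suc p))" using yz(3) b(2)[OF pp(1)] b(2)[OF pp(2)] by simp
    qed (use yz(1) b(1)[OF pp(2)] in auto)
    ultimately show ?thesis using yz by (auto simp: adjacent_def ct_def)
  qed
  define D where "D = {p \<in> {1..<n}. fst (b (Suc p)) = Suc (fst (b p))}"
  have D: "D \<subseteq> {1..<n}" and finD: "finite D" by (auto simp: D_def)
  have mono: "fst (b p) \<le> fst (b q) \<and> snd (b q) \<le> snd (b p)" if "p \<le> q" "1 \<le> p" "q \<le> n" for p q
    using that
  proof (induction q rule: dec_induct)
    case (step q)
    then show ?case using \<open>\<And>p. p \<in> {1..<n} \<Longrightarrow> _\<close>[of q] by auto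
  qed simp
  \<comment> \<open>Rows grow along the path, so a box in row 0 forces the path to start there; in
    the same way a box in column 0 fixes its end. This uses up the normalization of the
    translate.\<close>
  have row1: "fst (b 1) = 0"
  proof -
    obtain c where "(0, c) \<in> \<beta>" using r0 by blast
    then obtain q where "q \<in> {1..n}" "(0, c) = b q" using b_onto by blast
    then show ?thesis using mono[of 1 q] by (metis atLeastAtMost_iff fst_conv le_zero_eq order_refl)
  qed
  have row: "fst (b p) = row_of D p" if "1 \<le> p" "p \<le> n" for p
    using that
  proof (induction p rule: nat_induct_at_least)
    case base
    then show ?case using row1 row_of_first[OF D] by simp
  next
    case (Suc p)
    then show ?case using step[of p] row_of_Suc[OF finD, of p] by (auto simp: D_def)
  qed
  have coln: "snd (b n) = 0"
  proof -
    obtain r where "(r, 0) \<in> \<beta>" using c0 by blast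
    then obtain q where "q \<in> {1..n}" "(r, 0) = b q" using b_onto by blast
    then show ?thesis using mono[of q n] by (metis atLeastAtMost_iff snd_conv le_zero_eq order_refl)
  qed
  have bp: "b p = ribbon_box n D p" if p: "p \<in> {1..n}" for p
  proof -
    have nn: "n \<in> {1..n}" using n by simp
    have "- int (card D) = hi + 1 - int n"
      using b(2)[OF nn] coln row[of n] n row_of_last[OF D] by (simp add: ct_def)
    moreover have "int (snd (b p)) - int (row_of D p) = hi + 1 - int p"
      using b(2)[OF p] row[of p] p by (simp add: ct_def)
    moreover have "col_of n D p + card D + p = n + row_of D p" using col_row[OF D] p by simp
    ultimately have "snd (b p) = col_of n D p" by linarith
    then show ?thesis using row[of p] p by (simp add: ribbon_box_def prod_eq_iff)
  qed
  have "\<beta> = ribbon n D"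
    unfolding ribbon_def using b_onto b(1) bp by (auto simp: image_iff)
  moreover from this have "m = card D + 1"
    using m row_of_image[OF D n] by (simp add: ribbon_def image_image ribbon_box_def)
  ultimately show ?thesis using D by blast
qed

lemma border_shapes_eq:
  assumes "n \<ge> 1"
  shows "border_shapes n (i + 1) = ribbon n ` {D. D \<subseteq> {1..<n} \<and> card D = i}"
  using border_shape_is_ribbon[OF assms, of _ "i + 1"] ribbon_in_border_shapes[OF _ assms] by auto

lemma foulkes_eq_ribbon_sum:
  assumes "n \<ge> 1"
  shows "foulkes n i \<pi> = (\<Sum>D\<in>{D. D \<subseteq> {1..<n} \<and> card D = i}. ribbon_trace n \<pi> D)"
  unfolding foulkes_def border_shapes_eq[OF assms] sum.reindex[OF inj_on_ribbon]
  by (intro sum.cong refl) (simp add: specht_char_def specht_ribbon ribbon_trace_def)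

theorem theorem2p7:
  fixes n i j k :: nat and z :: "nat \<Rightarrow> nat"
  assumes "n \<ge> 1" and "i \<le> n - 1" and "j \<le> n - 1" and "k \<le> n - 1"
    and "z \<in> perm_set n" and "des n z = k"
  shows "cf_inner n (\<lambda>\<pi>. foulkes n i \<pi> * foulkes n j \<pi>) (foulkes n k) =
    of_nat (card {(x, y). x \<in> perm_set n \<and> y \<in> perm_set n \<and> des n x = i \<and> des n y = j \<and> x \<circ> y = z})"
proof (rule cf_inner_of_worpitzky[OF assms(1) _ _ _ _ assms(5,6)])
  show "i < n" "j < n" "k < n" using assms(1-4) by auto
  show "of_nat r ^ cycle_count n p = (\<Sum>e<n. of_nat (eul n e r) * foulkes n e p)" if "p \<in> perm_set n" for r p
    using worpitzky_ribbon[OF assms(1) that] by (simp add: foulkes_eq_ribbon_sum[OF assms(1)])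
qed

end
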